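(* Let $\theta\in\{0,1\}$ and let $q\in L_1(0,\pi)$ be a complex-valued function that is continuous on the interval $(0,\pi)$. Consider the boundary value problem $$u''-q(x)u+\lambda u=0 \ \text{ on } (0,\pi),\qquad u'(0)+(-1)^\theta u'(\pi)=0,\quad u(0)+(-1)^{\theta+1}u(\pi)=0,$$ and suppose that its characteristic determinant is not identically zero. Let $\lambda_n=\mu_n^2$ ($\operatorname{Re}\mu_n\ge0$, $n=1,2,\ldots$) be the eigenvalues of this problem, numbered neglecting their multiplicities in nondecreasing order of absolute value, and let $m(\lambda_n)$ denote the multiplicity of $\lambda_n$. Suppose that there are a constant $M$ and a subsequence $\lambda_{n_k}$ ($k=1,2,\ldots$) of the eigenvalues such that 1. $|\operatorname{Im}\mu_{n_k}|<M$ for all $k$; 2. $\displaystyle\lim_{k\to\infty}\frac{m(\lambda_{n_k})}{\ln|\lambda_{n_k}|}=0$. Then the system of eigenfunctions and associated functions of the problem is not a basis in $L_2(0,\pi)$.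
   Context: For $\lambda=\mu^2$, let $c(x,\mu)$, $s(x,\mu)$ be the solutions of $u''-q(x)u+\mu^2u=0$ on $[0,\pi]$ with $c(0,\mu)=s'(0,\mu)=1$, $c'(0,\mu)=s(0,\mu)=0$ (the prime denotes $d/dx$). The characteristic determinant of the problem is $\Delta(\mu)=c(\pi,\mu)-s'(\pi,\mu)$, and the eigenvalues are the numbers $\lambda=\mu^2$ with $\Delta(\mu)=0$. Let $L$ be the operator $Lu=-u''+qu$ in $L_2(0,\pi)$ with domain given by the boundary conditions in the claim. The root subspace for an eigenvalue $\lambda$ is the space of eigenfunctions and associated functions (generalized eigenvectors) of $L$ corresponding to $\lambda$; the multiplicity $m(\lambda)$ is its dimension (algebraic multiplicity), i.e. the multiplicity of $\lambda$ as a zero of the characteristic determinant regarded as a function of $\lambda$. "Numbered neglecting their multiplicities" means that each distinct eigenvalue is listed exactly once. The system of eigenfunctions and associated functions is the union over all eigenvalues $\lambda_n$ of (arbitrarily chosen) canonical systems, i.e. chains $u_n^{(0)},u_n^{(1)},\ldots,u_n^{(m(\lambda_n)-1)}$ in which $u_n^{(0)}$ is an eigenfunction and, for $h\ge1$, $u_n^{(h)}$ is an associated function of order $h$: $(L-\lambda_n)u_n^{(h)}=u_n^{(h-1)}$ (each root subspace contains, up to a scalar, exactly one eigenfunction). "Basis" means Schauder basis of $L_2(0,\pi)$, the system being ordered according to the numbering of the $\lambda_n$. *)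

theory Defs
  imports "HOL-Complex_Analysis.Complex_Analysis" "HOL-Library.Function_Algebras"
begin

text \<open>
  Functions on the interval from 0 to pi are represented by total functions of type
  \<^typ>\<open>real \<Rightarrow> complex\<close>; their values outside the interval never matter.
\<close>

abbreviation leb_0pi :: "real measure"
  where "leb_0pi \<equiv> lebesgue_on {0<..<pi}"

definition ddx :: "(real \<Rightarrow> complex) \<Rightarrow> real \<Rightarrow> complex"
  where "ddx u x = vector_derivative u (at x within {0..pi})"

text \<open>
  The equation \<open>-u'' + q u = f\<close>, for \<open>u\<close> differentiable on the closed interval with
  absolutely continuous derivative. Absolute continuity of \<open>u'\<close> is expressed by writing it as the
  indefinite integral of an integrable function \<open>w\<close>, which is then \<open>u''\<close> almost everywhere.
\<close>

definition sturm_liouville :: "(real \<Rightarrow> complex) \<Rightarrow> (real \<Rightarrow> complex) \<Rightarrow> (real \<Rightarrow> complex) \<Rightarrow> bool"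
  where "sturm_liouville q u f \<longleftrightarrow>
    (\<forall>x\<in>{0..pi}. (u has_vector_derivative ddx u x) (at x within {0..pi})) \<and>
    (\<exists>w. integrable leb_0pi w \<and>
         (\<forall>x\<in>{0..pi}. ddx u x = ddx u 0 + (LINT t|lebesgue_on {0<..<x}. w t)) \<and>
         (AE x in leb_0pi. - w x + q x * u x = f x))"

text \<open>
  The two fundamental solutions are unique on the closed interval, so the arbitrary choice
  made by \<open>SOME\<close> only affects values outside of it.
\<close>

definition sol_c :: "(real \<Rightarrow> complex) \<Rightarrow> complex \<Rightarrow> real \<Rightarrow> complex"
  where "sol_c q \<mu> = (SOME u. sturm_liouville q u (\<lambda>x. \<mu>\<^sup>2 * u x) \<and> u 0 = 1 \<and> ddx u 0 = 0)"

definition sol_s :: "(real \<Rightarrow> complex) \<Rightarrow> complex \<Rightarrow> real \<Rightarrow> complex"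
  where "sol_s q \<mu> = (SOME u. sturm_liouville q u (\<lambda>x. \<mu>\<^sup>2 * u x) \<and> u 0 = 0 \<and> ddx u 0 = 1)"

definition char_det :: "(real \<Rightarrow> complex) \<Rightarrow> complex \<Rightarrow> complex"
  where "char_det q \<mu> = sol_c q \<mu> pi - ddx (sol_s q \<mu>) pi"

text \<open>
  For both values of \<open>\<theta>\<close> the determinant of the boundary conditions is, up to sign,
  \<^const>\<open>char_det\<close> (by constancy of the Wronskian), so the eigenvalues do not depend on \<open>\<theta>\<close>.
\<close>

definition eigenvalues :: "(real \<Rightarrow> complex) \<Rightarrow> complex set"
  where "eigenvalues q = {\<mu>\<^sup>2 |\<mu>. char_det q \<mu> = 0}"

definition L2 :: "(real \<Rightarrow> complex) set"
  where "L2 = {f. f \<in> borel_measurable leb_0pi \<and> integrable leb_0pi (\<lambda>x. (cmod (f x))\<^sup>2)}"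

definition L2_norm :: "(real \<Rightarrow> complex) \<Rightarrow> real"
  where "L2_norm f = sqrt (LINT x|leb_0pi. (cmod (f x))\<^sup>2)"

text \<open>
  The graph of the operator \<open>L\<close>: \<open>L_op q \<theta> u f\<close> means that \<open>u\<close> lies in the domain of \<open>L\<close>
  (and is the continuously differentiable representative of its class) and that \<open>L u = f\<close>
  almost everywhere.
\<close>

definition L_op :: "(real \<Rightarrow> complex) \<Rightarrow> nat \<Rightarrow> (real \<Rightarrow> complex) \<Rightarrow> (real \<Rightarrow> complex) \<Rightarrow> bool"
  where "L_op q \<theta> u f \<longleftrightarrow>
    sturm_liouville q u f \<and> f \<in> L2 \<and>
    ddx u 0 + (-1) ^ \<theta> * ddx u pi = 0 \<and> u 0 + (-1) ^ (\<theta> + 1) * u pi = 0"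

definition eigenfunction :: "(real \<Rightarrow> complex) \<Rightarrow> nat \<Rightarrow> complex \<Rightarrow> (real \<Rightarrow> complex) \<Rightarrow> bool"
  where "eigenfunction q \<theta> l u \<longleftrightarrow> L_op q \<theta> u (\<lambda>x. l * u x) \<and> (\<exists>x\<in>{0..pi}. u x \<noteq> 0)"

text \<open>\<open>root_ker q \<theta> l k u\<close> means that \<open>u\<close> lies in the kernel of the \<open>k\<close>-th power of \<open>L - l\<close>.\<close>

primrec root_ker :: "(real \<Rightarrow> complex) \<Rightarrow> nat \<Rightarrow> complex \<Rightarrow> nat \<Rightarrow> (real \<Rightarrow> complex) \<Rightarrow> bool"
  where
    "root_ker q \<theta> l 0 u \<longleftrightarrow> (\<forall>x\<in>{0..pi}. u x = 0)"
  | "root_ker q \<theta> l (Suc k) u \<longleftrightarrow>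
      (\<exists>f. root_ker q \<theta> l k f \<and> L_op q \<theta> u (\<lambda>x. l * u x + f x))"

text \<open>
  The functions are normalised to vanish outside the closed interval, so that each class has
  exactly one representative here and the dimension is that of the space of classes.
\<close>

definition root_subspace :: "(real \<Rightarrow> complex) \<Rightarrow> nat \<Rightarrow> complex \<Rightarrow> (real \<Rightarrow> complex) set"
  where "root_subspace q \<theta> l =
    {u. (\<forall>x. x \<notin> {0..pi} \<longrightarrow> u x = 0) \<and> (\<exists>k. root_ker q \<theta> l k u)}"

definition fun_scale :: "complex \<Rightarrow> (real \<Rightarrow> complex) \<Rightarrow> real \<Rightarrow> complex"
  where "fun_scale a u = (\<lambda>x. a * u x)"

lemma vector_space_fun_scale: "vector_space fun_scale"
  by unfold_locales (auto simp: fun_scale_def fun_eq_iff algebra_simps)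

definition multiplicity_at :: "(real \<Rightarrow> complex) \<Rightarrow> nat \<Rightarrow> complex \<Rightarrow> nat"
  where "multiplicity_at q \<theta> l = vector_space.dim fun_scale (root_subspace q \<theta> l)"

definition canonical_system ::
    "(real \<Rightarrow> complex) \<Rightarrow> nat \<Rightarrow> complex \<Rightarrow> (nat \<Rightarrow> real \<Rightarrow> complex) \<Rightarrow> bool"
  where "canonical_system q \<theta> l u \<longleftrightarrow>
    eigenfunction q \<theta> l (u 0) \<and>
    (\<forall>h. 1 \<le> h \<and> h < multiplicity_at q \<theta> l \<longrightarrow>
         L_op q \<theta> (u h) (\<lambda>x. l * u h x + u (h - 1) x))"

text \<open>
  \<open>concat_blocks m u\<close> is the sequence
  \<open>u 0 0, \<dots>, u 0 (m 0 - 1), u 1 0, \<dots>, u 1 (m 1 - 1), \<dots>\<close>.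
\<close>

definition concat_blocks :: "(nat \<Rightarrow> nat) \<Rightarrow> (nat \<Rightarrow> nat \<Rightarrow> 'a) \<Rightarrow> nat \<Rightarrow> 'a"
  where "concat_blocks m u j =
    (let n = (LEAST n. j < (\<Sum>i\<le>n. m i)) in u n (j - (\<Sum>i<n. m i)))"

lemma concat_blocks_eq:
  assumes "h < m n"
  shows "concat_blocks m u ((\<Sum>i<n. m i) + h) = u n h"
proof -
  have "(LEAST k. (\<Sum>i<n. m i) + h < (\<Sum>i\<le>k. m i)) = n"
  proof (rule Least_equality)
    show "(\<Sum>i<n. m i) + h < (\<Sum>i\<le>n. m i)"
      using assms by (simp flip: lessThan_Suc_atMost)
  next
    fix k
    assume k: "(\<Sum>i<n. m i) + h < (\<Sum>i\<le>k. m i)"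
    show "n \<le> k"
    proof (rule ccontr)
      assume "\<not> n \<le> k"
      then have "(\<Sum>i\<le>k. m i) \<le> (\<Sum>i<n. m i)"
        by (intro sum_mono2) auto
      with k show False by simp
    qed
  qed
  then show ?thesis by (simp add: concat_blocks_def)
qed

definition schauder_basis_L2 :: "(nat \<Rightarrow> real \<Rightarrow> complex) \<Rightarrow> bool"
  where "schauder_basis_L2 \<phi> \<longleftrightarrow>
    (\<forall>j. \<phi> j \<in> L2) \<and>
    (\<forall>f\<in>L2. \<exists>!a :: nat \<Rightarrow> complex.
      (\<lambda>N. L2_norm (\<lambda>x. f x - (\<Sum>j<N. a j * \<phi> j x))) \<longlonglongrightarrow> 0)"

end

theory Submission
  imports Defs
begin

text \<open>
  Write \<open>\<lambda> = \<mu>\<^sup>2\<close> for an eigenvalue with \<open>\<mu>\<close> in the strip and far from the origin, and \<open>m\<close> for its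
  multiplicity. If the root functions form a basis, the coefficient functionals times the norms of
  the basis elements are uniformly bounded. The coefficient of the last function \<open>u\<close> of the block
  of \<open>\<lambda>\<close> is, up to a factor, the pairing with an eigenfunction \<open>v\<close> of the adjoint problem at
  \<open>\<lambda>\<close>, because this pairing annihilates every other root function (\<open>chain_pairing_zero\<close>). So a
  basis would give a lower bound for \<open>|\<integral>u v| / (\<parallel>u\<parallel> \<parallel>v\<parallel>)\<close> that does not depend on \<open>\<lambda>\<close>. The whole
  proof consists in showing that this quotient is at most \<open>C\<^sup>m / |\<mu>|\<close>
  (\<open>chain_top_pairing_estimate\<close>). Since \<open>m\<close> is small against \<open>ln |\<lambda>|\<close>, this tends to \<open>0\<close>.

  For \<open>q = 0\<close> and \<open>\<theta> = 0\<close> the functions \<open>cos (z (x - \<pi>/2))\<close> satisfy one boundary condition of the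
  problem for every \<open>z\<close>, and the functions \<open>sin (z (x - \<pi>/2))\<close> satisfy both adjoint conditions
  for every \<open>z\<close>: the problem is degenerate. For \<open>\<theta> = 1\<close> the roles are exchanged. With a potential, solutions \<open>solC\<close> and
  \<open>solS\<close> with the same initial data differ from these by \<open>O(1/z)\<close>, and the adjoint eigenfunction
  is \<open>solS + \<kappa> solC\<close> with \<open>\<kappa> = O(1/\<mu>)\<close>.

  Let \<open>u\<^sub>0, \<dots>, u\<^sub>h\<close> be a chain at \<open>\<lambda>\<close> with \<open>m = h + 1\<close>. Lagrange's identity, summed along the
  chain, says that for every solution \<open>y\<close> at \<open>\<nu>\<close>
  \<open>- (\<nu> - \<lambda>)\<^sup>m \<integral>u\<^sub>h y = P(\<nu>) A(y) + R(\<nu>) B(y)\<close>,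
  where \<open>P\<close> and \<open>R\<close> are polynomials of degree below \<open>m\<close> with coefficients \<open>u\<^sub>i(0)\<close> and \<open>u\<^sub>i'(0)\<close>,
  and \<open>A\<close>, \<open>B\<close> are the two adjoint boundary forms (\<open>chain_identity\<close>). It is used twice.

  With \<open>y = solC\<close> and \<open>\<nu> = l\<^sup>2\<close> for integers \<open>l\<close> near \<open>\<mu>\<close>, one of \<open>A\<close>, \<open>B\<close> is large and the other
  small, alternately, so \<open>P\<close> and \<open>R\<close> are bounded by \<open>\<parallel>u\<^sub>h\<parallel>\<close> at every second integer, up to a
  relative error \<open>O(1/\<mu>)\<close>. Interpolation through \<open>m\<close> such nodes extends the bounds to the
  disc of radius \<open>m\<close> around \<open>\<mu>\<close> at the cost of a factor \<open>C\<^sup>m\<close>, against which the error is still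
  negligible (\<open>init_poly_bound\<close>).

  With \<open>y = solS + \<kappa> solC\<close> on the circle of radius \<open>m\<close> around \<open>\<mu>\<close>, both forms are smaller by a factor
  \<open>1/\<mu>\<close>, and the maximum principle gives the bound for \<open>\<integral>u\<^sub>h v\<close> at the centre. The radius
  \<open>m\<close> matters: the powers \<open>m\<^sup>m\<close> lost in the first step are regained here, whereas a
  fixed radius would lose a factor \<open>m!\<close>, which is not \<open>o(|\<mu>|)\<close> in general.

  Two smaller points complete the argument. The blocks are nonempty, because the chains at a nonzero
  eigenvalue are not longer than its order as a zero of the characteristic determinant
  (\<open>multiplicity_pos\<close>). And the lower bound for the quotients comes from the principle of uniform
  boundedness (\<open>pairing_uniformly_bounded_below\<close>).
\<close>

section \<open>Second order equations with an integrable potential\<close>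

text \<open>
  As the potential is continuous inside the interval, a solution is twice continuously
  differentiable there, and only the integrability of the equation up to the end points is weak. In
  this form, with the derivative \<open>p\<close> as a separate argument, the fundamental theorem of calculus on the open
  interval replaces all calculus with absolutely continuous functions.
\<close>

definition ode_sol ::
    "(real \<Rightarrow> complex) \<Rightarrow> (real \<Rightarrow> complex) \<Rightarrow> (real \<Rightarrow> complex) \<Rightarrow> (real \<Rightarrow> complex) \<Rightarrow> bool"
  where "ode_sol Q u p g \<longleftrightarrow>
    (\<forall>x\<in>{0..pi}. (u has_vector_derivative p x) (at x within {0..pi})) \<and>
    continuous_on {0..pi} p \<and>
    (\<forall>x\<in>{0<..<pi}. (p has_vector_derivative (Q x * u x - g x)) (at x))"

lemma ode_sol_continuous:
  assumes "ode_sol Q u p g"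
  shows "continuous_on {0..pi} u" "continuous_on {0..pi} p"
proof -
  show "continuous_on {0..pi} u"
    unfolding continuous_on_eq_continuous_within
    using assms has_vector_derivative_continuous unfolding ode_sol_def by blast
  show "continuous_on {0..pi} p" using assms unfolding ode_sol_def by blast
qed

lemma ode_sol_derivs:
  assumes "ode_sol Q u p g" "x \<in> {0<..<pi}"
  shows "(u has_vector_derivative p x) (at x)"
    "(p has_vector_derivative (Q x * u x - g x)) (at x)"
proof -
  have "x \<in> {0..pi}" using assms(2) by simp
  then have "(u has_vector_derivative p x) (at x within {0..pi})"
    using assms(1) unfolding ode_sol_def by blast
  then have "(u has_vector_derivative p x) (at x within {0<..<pi})"
    by (rule has_vector_derivative_within_subset) (simp add: greaterThanLessThan_subseteq_atLeastAtMost_iff)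
  then show "(u has_vector_derivative p x) (at x)"
    using at_within_open[OF assms(2) open_greaterThanLessThan] by metis
  show "(p has_vector_derivative (Q x * u x - g x)) (at x)"
    using assms unfolding ode_sol_def by blast
qed

lemma ode_sol_deriv_within:
  "ode_sol Q u p g \<Longrightarrow> x \<in> {0..pi} \<Longrightarrow> (u has_vector_derivative p x) (at x within {0..pi})"
  unfolding ode_sol_def by blast

lemma ode_sol_lincomb:
  assumes "ode_sol Q u1 p1 g1" "ode_sol Q u2 p2 g2"
  shows "ode_sol Q (\<lambda>x. a * u1 x + b * u2 x) (\<lambda>x. a * p1 x + b * p2 x) (\<lambda>x. a * g1 x + b * g2 x)"
  unfolding ode_sol_def
proof (intro conjI ballI)
  show "((\<lambda>x. a * u1 x + b * u2 x) has_vector_derivative a * p1 x + b * p2 x) (at x within {0..pi})"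
    if "x \<in> {0..pi}" for x
    by (rule has_vector_derivative_add has_vector_derivative_mult_right
        ode_sol_deriv_within[OF assms(1) that] ode_sol_deriv_within[OF assms(2) that])+
  show "continuous_on {0..pi} (\<lambda>x. a * p1 x + b * p2 x)"
    by (rule continuous_on_add continuous_on_mult continuous_on_const
        ode_sol_continuous[OF assms(1)] ode_sol_continuous[OF assms(2)])+
  show "((\<lambda>x. a * p1 x + b * p2 x) has_vector_derivative
      Q x * (a * u1 x + b * u2 x) - (a * g1 x + b * g2 x)) (at x)" if "x \<in> {0<..<pi}" for x
  proof -
    have "((\<lambda>x. a * p1 x + b * p2 x) has_vector_derivative
      a * (Q x * u1 x - g1 x) + b * (Q x * u2 x - g2 x)) (at x)"
      by (rule has_vector_derivative_add has_vector_derivative_mult_right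
        ode_sol_derivs[OF assms(1) that] ode_sol_derivs[OF assms(2) that])+
    then show ?thesis by (simp add: algebra_simps)
  qed
qed

lemma ode_sol_cong:
  assumes "ode_sol Q u p g"
    and "\<And>x. x \<in> {0..pi} \<Longrightarrow> u x = u' x" "\<And>x. x \<in> {0..pi} \<Longrightarrow> p x = p' x"
    and "\<And>x. x \<in> {0<..<pi} \<Longrightarrow> Q x * u x - g x = Q' x * u x - g' x"
  shows "ode_sol Q' u' p' g'"
  unfolding ode_sol_def
proof (intro conjI ballI)
  show "(u' has_vector_derivative p' x) (at x within {0..pi})" if "x \<in> {0..pi}" for x
  proof (rule has_vector_derivative_transform[where f=u])
    show "(u has_vector_derivative p' x) (at x within {0..pi})"
      using assms(1) assms(3)[OF that] that unfolding ode_sol_def by metis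
    show "u' x = u x" if "x \<in> {0..pi}" for x using assms(2)[OF that] by simp
  qed (fact that)
  show "continuous_on {0..pi} p'"
    by (rule continuous_on_eq[OF ode_sol_continuous(2)[OF assms(1)]])  (simp add: assms(3))
  show "(p' has_vector_derivative Q' x * u' x - g' x) (at x)" if x: "x \<in> {0<..<pi}" for x
  proof -
    have "(p has_vector_derivative Q x * u x - g x) (at x)"
      using ode_sol_derivs[OF assms(1) x] by auto
    then have "(p' has_vector_derivative Q x * u x - g x) (at x)"
      by (rule has_vector_derivative_transform_within_open[where S="{0<..<pi}"])
        (use x assms(3) in auto)
    moreover have "Q x * u x - g x = Q' x * u' x - g' x"
      using assms(4)[OF x] assms(2)[of x] x by simp
    ultimately show ?thesis by simp
  qed
qed

lemma indefinite_integral_props: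
  fixes f :: "real \<Rightarrow> 'a::euclidean_space"
  assumes "f absolutely_integrable_on {0..pi}" "continuous_on {0<..<pi} f"
  shows "continuous_on {0..pi} (\<lambda>x. integral {0..x} f)"
    and "x \<in> {0<..<pi} \<Longrightarrow> ((\<lambda>x. integral {0..x} f) has_vector_derivative f x) (at x)"
proof -
  have i: "f integrable_on {0..pi}"
    using assms(1) set_lebesgue_integral_eq_integral(1) by blast
  show "continuous_on {0..pi} (\<lambda>x. integral {0..x} f)"
    using indefinite_integral_continuous_1[OF i] .
  assume x: "x \<in> {0<..<pi}"
  have "continuous (at x) f"
    using continuous_on_interior[OF assms(2)] x by (simp add: interior_open)
  then have "((\<lambda>x. integral {0..x} f) has_vector_derivative f x) (at x within {0..pi})"
    using integral_has_vector_derivative_continuous_at[OF i, of x "{}"] x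
      continuous_at_imp_continuous_at_within[of x f "{0..pi}"] by force
  then have "((\<lambda>x. integral {0..x} f) has_vector_derivative f x) (at x within {0<..<pi})"
    by (rule has_vector_derivative_within_subset)
      (simp add: greaterThanLessThan_subseteq_atLeastAtMost_iff)
  then show "((\<lambda>x. integral {0..x} f) has_vector_derivative f x) (at x)"
    using at_within_open[OF x open_greaterThanLessThan] by metis
qed

locale potential =
  fixes Q :: "real \<Rightarrow> complex"
  assumes Q_int: "Q absolutely_integrable_on {0..pi}"
    and Q_cont: "continuous_on {0<..<pi} Q"
begin

lemma Q_times_int:
  assumes "continuous_on {0..pi} g"
  shows "(\<lambda>x. Q x * g x) absolutely_integrable_on {0..pi}"
proof -
  have "g \<in> borel_measurable (lebesgue_on {0..pi})"
    by (intro continuous_imp_measurable_on_sets_lebesgue assms) simp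
  moreover have "bounded (g ` {0..pi})"
    by (rule compact_imp_bounded[OF compact_continuous_image[OF assms compact_Icc]])
  ultimately have "(\<lambda>x. g x * Q x) absolutely_integrable_on {0..pi}"
    using absolutely_integrable_bounded_measurable_product
      [where h="(*)" and S="{0..pi}" and f=g and g=Q] bilinear_times Q_int by force
  then show ?thesis by (simp add: mult.commute)
qed

lemma Q_times_cont:
  "continuous_on {0..pi} g \<Longrightarrow> continuous_on {0<..<pi} (\<lambda>x. Q x * g x)"
  by (rule continuous_on_mult[OF Q_cont], rule continuous_on_subset) auto

lemma norm_Q_int: "(\<lambda>x. cmod (Q x)) absolutely_integrable_on {0..pi}"
  using absolutely_integrable_norm[OF Q_int] by (simp add: o_def)

lemma norm_Q_times_int:
  fixes g :: "real \<Rightarrow> real"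
  assumes "continuous_on {0..pi} g"
  shows "(\<lambda>x. cmod (Q x) * g x) absolutely_integrable_on {0..pi}"
proof -
  have "g \<in> borel_measurable (lebesgue_on {0..pi})"
    by (intro continuous_imp_measurable_on_sets_lebesgue assms) simp
  moreover have "bounded (g ` {0..pi})"
    by (rule compact_imp_bounded[OF compact_continuous_image[OF assms compact_Icc]])
  ultimately have "(\<lambda>x. g x * cmod (Q x)) absolutely_integrable_on {0..pi}"
    using absolutely_integrable_bounded_measurable_product_real
      [where S="{0..pi}" and f=g and g="\<lambda>x. cmod (Q x)"] norm_Q_int by force
  then show ?thesis by (simp add: mult.commute)
qed

lemma norm_Q_times_cont:
  fixes g :: "real \<Rightarrow> real"
  shows "continuous_on {0..pi} g \<Longrightarrow> continuous_on {0<..<pi} (\<lambda>x. cmod (Q x) * g x)"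
  by (rule continuous_on_mult[OF continuous_on_norm[OF Q_cont]], rule continuous_on_subset) auto

text \<open>
  The natural clock of the equation: \<open>exp (c * mass x)\<close> is the weight in which integration against \<open>Q\<close>
  contracts, and the growth factor in Gronwall's lemma.
\<close>

definition mass :: "real \<Rightarrow> real" where "mass x = integral {0..x} (\<lambda>t. cmod (Q t))"

lemma mass_cont: "continuous_on {0..pi} mass"
  unfolding mass_def by (intro indefinite_integral_props norm_Q_int continuous_on_norm Q_cont) 

lemma mass_deriv: "x \<in> {0<..<pi} \<Longrightarrow> (mass has_real_derivative cmod (Q x)) (at x)"
  unfolding mass_def has_real_derivative_iff_has_vector_derivative
  by (intro indefinite_integral_props norm_Q_int continuous_on_norm Q_cont)

lemma mass_0 [simp]: "mass 0 = 0" by (simp add: mass_def)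

lemma integrable_sub:
  fixes f :: "real \<Rightarrow> 'a::euclidean_space"
  assumes "f absolutely_integrable_on {0..pi}" "x \<in> {0..pi}"
  shows "f integrable_on {0..x}"
  by (rule integrable_on_subinterval[of _ "{0..pi}"])
     (use assms set_lebesgue_integral_eq_integral(1) in auto)

lemma mass_mono: assumes "0 \<le> x" "x \<le> y" "y \<le> pi" shows "mass x \<le> mass y"
  unfolding mass_def using assms integrable_sub[OF norm_Q_int]
  by (intro integral_subset_le) auto

lemma mass_nonneg: "x \<in> {0..pi} \<Longrightarrow> 0 \<le> mass x"
  using mass_mono[of 0 x] by auto

lemma ode_sol_ftc:
  assumes "ode_sol Q u p g" "continuous_on {0..pi} g" "x \<in> {0..pi}"
  shows "((\<lambda>t. Q t * u t - g t) has_integral p x - p 0) {0..x}" "(p has_integral u x - u 0) {0..x}"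
proof -
  show "((\<lambda>t. Q t * u t - g t) has_integral p x - p 0) {0..x}"
    using assms(3) ode_sol_derivs(2)[OF assms(1)]
    by (intro fundamental_theorem_of_calculus_interior
        continuous_on_subset[OF ode_sol_continuous(2)[OF assms(1)]]) auto
  show "(p has_integral u x - u 0) {0..x}"
    using assms(3) ode_sol_derivs(1)[OF assms(1)]
    by (intro fundamental_theorem_of_calculus_interior
        continuous_on_subset[OF ode_sol_continuous(1)[OF assms(1)]]) auto
qed

text \<open>
  The right-hand side \<open>E\<close> of the integral inequality satisfies \<open>E' \<le> B |Q| E\<close>, so
  \<open>E * exp (- B * mass)\<close> does not increase.
\<close>

lemma Gronwall:
  fixes y :: "real \<Rightarrow> real"
  assumes cont: "continuous_on {0..pi} y" and nn: "\<And>x. x \<in> {0..pi} \<Longrightarrow> 0 \<le> y x"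
    and "0 \<le> B"
    and le: "\<And>x. x \<in> {0..pi} \<Longrightarrow> y x \<le> A + B * integral {0..x} (\<lambda>t. cmod (Q t) * y t)"
    and x: "x \<in> {0..pi}"
  shows "y x \<le> A * exp (B * mass x)"
proof -
  define E where "E x = A + B * integral {0..x} (\<lambda>t. cmod (Q t) * y t)" for x
  have Ec: "continuous_on {0..pi} E" unfolding E_def
    by (intro continuous_intros indefinite_integral_props norm_Q_times_int norm_Q_times_cont cont)
  have Ed: "(E has_real_derivative B * (cmod (Q x) * y x)) (at x)" if "x \<in> {0<..<pi}" for x
    unfolding E_def
    using indefinite_integral_props(2)[OF norm_Q_times_int[OF cont] norm_Q_times_cont[OF cont] that]
    by (auto intro!: derivative_eq_intros simp: has_real_derivative_iff_has_vector_derivative[symmetric])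
  define H where "H x = E x * exp (- B * mass x)" for x
  have Hd: "(H has_real_derivative B * cmod (Q x) * (y x - E x) * exp (- B * mass x)) (at x)"
    if "x \<in> {0<..<pi}" for x
    unfolding H_def by (rule derivative_eq_intros Ed[OF that] mass_deriv[OF that] refl)+ 
      (simp add: algebra_simps)
  have "H x \<le> H 0"
  proof (rule DERIV_nonpos_imp_decreasing_open[where f=H and a=0 and b=x])
    show "0 \<le> x" using x by auto
    show "continuous_on {0..x} H" unfolding H_def using x
      by (intro continuous_intros continuous_on_subset[OF Ec] continuous_on_subset[OF mass_cont]) auto
    fix t assume "0 < t" "t < x"
    then have t: "t \<in> {0<..<pi}" using x by auto
    have "y t \<le> E t" using le t by (auto simp: E_def)
    then show "\<exists>y. (H has_real_derivative y) (at t) \<and> y \<le> 0"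
      using Hd[OF t] \<open>0 \<le> B\<close>
      by (intro exI[of _ "B * cmod (Q t) * (y t - E t) * exp (- B * mass t)"] conjI
          mult_nonpos_nonneg mult_nonneg_nonpos) auto
  qed
  then have "E x * exp (- B * mass x) \<le> A" by (simp add: H_def E_def)
  then have "E x \<le> A * exp (B * mass x)"
    by (simp add: exp_minus field_simps)
  then show ?thesis using le[OF x] by (simp add: E_def)
qed

end

context potential
begin

text \<open>
  Picard iteration \<open>Y \<mapsto> T Y\<close> for the twice integrated equation, with \<open>P Y\<close> the derivative of \<open>T Y\<close>.
\<close>

lemma ode_sol_exists:
  assumes g: "continuous_on {0..pi} g"
  shows "\<exists>u p. ode_sol Q u p g \<and> u 0 = \<alpha> \<and> p 0 = \<beta>"
proof -
  define P where "P Y s = \<beta> + integral {0..s} (\<lambda>t. Q t * Y t - g t)" for Y s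
  define T where "T Y x = \<alpha> + integral {0..x} (P Y)" for Y x
  have ai: "(\<lambda>t. Q t * Y t - g t) absolutely_integrable_on {0..pi}"
    if "continuous_on {0..pi} Y" for Y
    by (intro set_integral_diff Q_times_int that absolutely_integrable_continuous_real g)
  have co: "continuous_on {0<..<pi} (\<lambda>t. Q t * Y t - g t)" if "continuous_on {0..pi} Y" for Y
    by (rule continuous_on_diff[OF Q_times_cont[OF that] continuous_on_subset[OF g]]) auto
  have Pc: "continuous_on {0..pi} (P Y)" if "continuous_on {0..pi} Y" for Y
    unfolding P_def
    by (intro continuous_on_add continuous_on_const indefinite_integral_props(1) ai co that)
  have Pd: "(P Y has_vector_derivative Q x * Y x - g x) (at x)"
    if "continuous_on {0..pi} Y" "x \<in> {0<..<pi}" for Y x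
    unfolding P_def
    using has_vector_derivative_add[OF has_vector_derivative_const
        indefinite_integral_props(2)[OF ai co]] that by fastforce
  have Td: "(T Y has_vector_derivative P Y x) (at x within {0..pi})"
    if "continuous_on {0..pi} Y" "x \<in> {0..pi}" for Y x
    unfolding T_def
    using has_vector_derivative_add[OF has_vector_derivative_const
        integral_has_vector_derivative[OF Pc]] that by fastforce
  have Tc: "continuous_on {0..pi} (T Y)" if "continuous_on {0..pi} Y" for Y
    unfolding continuous_on_eq_continuous_within
    using has_vector_derivative_continuous Td[OF that] by blast
  have est: "cmod (T Y x - T Z x) \<le> pi * B"
    if Y: "continuous_on {0..pi} Y" and Z: "continuous_on {0..pi} Z" and x: "x \<in> {0..pi}"
      and E: "continuous_on {0..pi} E" "\<And>t. t \<in> {0..pi} \<Longrightarrow> cmod (Y t - Z t) \<le> E t"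
      and B: "0 \<le> B" "\<And>s. s \<in> {0..x} \<Longrightarrow> integral {0..s} (\<lambda>t. cmod (Q t) * E t) \<le> B" for Y Z x E B
  proof -
    have P_est: "cmod (P Y s - P Z s) \<le> B" if s: "s \<in> {0..x}" for s
    proof -
      have s': "s \<in> {0..pi}" using s x by auto
      have "P Y s - P Z s = integral {0..s} (\<lambda>t. (Q t * Y t - g t) - (Q t * Z t - g t))"
        unfolding P_def using integral_diff[OF integrable_sub[OF ai[OF Y] s'] integrable_sub[OF ai[OF Z] s']] by simp
      also have "cmod \<dots> \<le> integral {0..s} (\<lambda>t. cmod (Q t) * E t)"
      proof (rule integral_norm_bound_integral)
        show "(\<lambda>t. (Q t * Y t - g t) - (Q t * Z t - g t)) integrable_on {0..s}"
          by (rule integrable_diff[OF integrable_sub[OF ai[OF Y] s'] integrable_sub[OF ai[OF Z] s']])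
        show "(\<lambda>t. cmod (Q t) * E t) integrable_on {0..s}"
          by (rule integrable_sub[OF norm_Q_times_int[OF E(1)] s'])
        fix t assume "t \<in> {0..s}"
        then have "cmod (Y t - Z t) \<le> E t" using s' by (intro E(2)) auto
        then show "cmod ((Q t * Y t - g t) - (Q t * Z t - g t)) \<le> cmod (Q t) * E t"
          by (simp add: norm_mult mult_left_mono flip: right_diff_distrib)
      qed
      also have "\<dots> \<le> B" by (rule B(2)[OF s])
      finally show ?thesis .
    qed
    have Pi: "P W integrable_on {0..x}" if "continuous_on {0..pi} W" for W
      using continuous_on_subset[OF Pc[OF that], of "{0..x}"] x
      by (intro integrable_continuous_real) auto
    have "T Y x - T Z x = integral {0..x} (\<lambda>s. P Y s - P Z s)"
      unfolding T_def using integral_diff[OF Pi[OF Y] Pi[OF Z]] by simp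
    also have "cmod \<dots> \<le> B * (x - 0)"
      using x B(1) P_est
      by (intro integral_bound continuous_on_diff continuous_on_subset[OF Pc[OF Y], of "{0..x}"]
          continuous_on_subset[OF Pc[OF Z], of "{0..x}"]) auto
    also have "\<dots> \<le> pi * B" using x B(1) mult_right_mono[of x pi B] by (simp add: mult.commute)
    finally show ?thesis .
  qed
  define S where "S n = (T ^^ n) (\<lambda>x. 0)" for n
  have S_Suc: "S (Suc n) = T (S n)" for n by (simp add: S_def)
  have Sc: "continuous_on {0..pi} (S n)" for n
    by (induction n) (auto simp: S_Suc intro: Tc, simp add: S_def)
  obtain C where "\<forall>y\<in>S 1 ` {0..pi}. cmod y \<le> C"
    using compact_imp_bounded[OF compact_continuous_image[OF Sc[of 1] compact_Icc]]
    unfolding bounded_iff by blast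
  then have C: "cmod (S 1 x) \<le> C" if "x \<in> {0..pi}" for x using that by blast
  have "0 \<le> C" using order_trans[OF norm_ge_zero C[of 0]] by simp
  \<comment> \<open>In the norm weighted by \<open>exp (- 2 pi mass)\<close> the integral operator contracts by one half.\<close>
  have step: "cmod (S (Suc n) x - S n x) \<le> C * (1/2) ^ n * exp (2 * pi * mass x)"
    if "x \<in> {0..pi}" for n x
    using that
  proof (induction n arbitrary: x)
    case 0
    have "C * 1 \<le> C * exp (2 * pi * mass x)"
      using mass_nonneg[OF 0] \<open>0 \<le> C\<close> by (intro mult_left_mono) auto
    then show ?case using C[OF 0] by (simp add: S_def)
  next
    case (Suc n)
    define c where "c = C * (1/2) ^ n"
    have "0 \<le> c" using \<open>0 \<le> C\<close> by (simp add: c_def)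
    define E where "E t = c * exp (2 * pi * mass t)" for t
    have Ec: "continuous_on {0..pi} E"
      unfolding E_def by (intro continuous_intros mass_cont)
    have "cmod (T (S (Suc n)) x - T (S n) x) \<le> pi * (c * exp (2 * pi * mass x) / (2 * pi))"
    proof (rule est[OF Sc Sc Suc.prems Ec])
      show "cmod (S (Suc n) t - S n t) \<le> E t" if "t \<in> {0..pi}" for t
        using Suc.IH[OF that] by (simp add: E_def c_def)
      show "0 \<le> c * exp (2 * pi * mass x) / (2 * pi)" using \<open>0 \<le> c\<close> by simp
      fix s assume s: "s \<in> {0..x}"
      define F where "F t = c * exp (2 * pi * mass t) / (2 * pi)" for t
      have "((\<lambda>t. cmod (Q t) * E t) has_integral F s - F 0) {0..s}"
      proof (rule fundamental_theorem_of_calculus_interior)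
        show "0 \<le> s" using s by simp
        have "continuous_on {0..s} mass"
          by (rule continuous_on_subset[OF mass_cont]) (use s Suc.prems in auto)
        then show "continuous_on {0..s} F"
          unfolding F_def by (intro continuous_intros) auto
        fix t assume "t \<in> {0<..<s}"
        then have t: "t \<in> {0<..<pi}" using s Suc.prems by auto
        have "(F has_real_derivative cmod (Q t) * E t) (at t)"
          unfolding F_def E_def
          by (rule derivative_eq_intros mass_deriv[OF t] refl | simp)+
        then show "(F has_vector_derivative cmod (Q t) * E t) (at t)"
          by (simp add: has_real_derivative_iff_has_vector_derivative)
      qed
      then have "integral {0..s} (\<lambda>t. cmod (Q t) * E t) = F s - F 0" by (rule integral_unique)
      also have "\<dots> \<le> F s" using \<open>0 \<le> c\<close> by (simp add: F_def)
      also have "\<dots> \<le> F x" unfolding F_def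
        using \<open>0 \<le> c\<close> mass_mono[of s x] s Suc.prems
        by (intro divide_right_mono mult_left_mono) auto
      finally show "integral {0..s} (\<lambda>t. cmod (Q t) * E t) \<le> c * exp (2 * pi * mass x) / (2 * pi)"
        by (simp add: F_def)
    qed
    then show ?case by (simp add: S_Suc c_def field_simps)
  qed
  define M where "M n = C * (1/2) ^ n * exp (2 * pi * mass pi)" for n
  define Y where "Y x = (\<Sum>n. S (Suc n) x - S n x)" for x
  have "uniform_limit {0..pi} (\<lambda>n x. \<Sum>i<n. S (Suc i) x - S i x) Y sequentially"
    unfolding Y_def
  proof (rule Weierstrass_m_test[where M=M])
    show "summable M" unfolding M_def
      by (intro summable_mult summable_mult2 summable_geometric) auto
    show "cmod (S (Suc n) x - S n x) \<le> M n" if "x \<in> {0..pi}" for n x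
      using step[OF that, of n] mass_mono[of x pi] that \<open>0 \<le> C\<close> unfolding M_def
      by (elim order_trans) (auto intro!: mult_left_mono)
  qed
  moreover have "(\<Sum>i<n. S (Suc i) x - S i x) = S n x" for n x
    using sum_lessThan_telescope[of "\<lambda>n. S n x" n] by (simp add: S_def)
  ultimately have ul: "uniform_limit {0..pi} S Y sequentially" by simp
  then have Yc: "continuous_on {0..pi} Y"
    by (rule uniform_limit_theorem[rotated]) (auto intro: always_eventually Sc)
  have fixed: "Y x = T Y x" if x: "x \<in> {0..pi}" for x
  proof (rule LIMSEQ_unique)
    show "(\<lambda>n. S (Suc n) x) \<longlonglongrightarrow> Y x"
      using tendsto_uniform_limitI[OF ul x] by (rule LIMSEQ_Suc)
    show "(\<lambda>n. S (Suc n) x) \<longlonglongrightarrow> T Y x"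
    proof (rule LIMSEQ_I)
      fix r :: real assume "0 < r"
      define e where "e = r / (2 * pi * (mass pi + 1))"
      have "0 < e" using \<open>0 < r\<close> mass_nonneg[of pi] by (simp add: e_def)
      then obtain N where N: "\<And>n t. n \<ge> N \<Longrightarrow> t \<in> {0..pi} \<Longrightarrow> cmod (S n t - Y t) \<le> e"
        using uniform_limitD[OF ul] unfolding eventually_sequentially dist_norm
        by (meson less_imp_le)
      have "cmod (S (Suc n) x - T Y x) < r" if "n \<ge> N" for n
      proof -
        have "cmod (T (S n) x - T Y x) \<le> pi * (mass pi * e)"
        proof (rule est[OF Sc Yc x continuous_on_const N[OF that]])
          show "0 \<le> mass pi * e" using \<open>0 < e\<close> mass_nonneg[of pi] by simp
          fix s assume "s \<in> {0..x}"
          then show "integral {0..s} (\<lambda>t. cmod (Q t) * e) \<le> mass pi * e"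
            using mass_mono[of s pi] x \<open>0 < e\<close> by (simp flip: mass_def)
        qed
        also have "\<dots> < 2 * pi * (mass pi + 1) * e"
          using \<open>0 < e\<close> mass_nonneg[of pi] by (simp add: algebra_simps add_strict_increasing)
        also have "\<dots> = r" using mass_nonneg[of pi] by (simp add: e_def)
        finally show ?thesis by (simp add: S_Suc)
      qed
      then show "\<exists>N. \<forall>n\<ge>N. cmod (S (Suc n) x - T Y x) < r" by blast
    qed
  qed
  have "ode_sol Q (T Y) (P Y) g"
    unfolding ode_sol_def
  proof (intro conjI ballI)
    fix x assume x: "x \<in> {0<..<pi}"
    then have "Y x = T Y x" using fixed by simp
    then show "(P Y has_vector_derivative Q x * T Y x - g x) (at x)"
      using Pd[OF Yc x] by simp
  qed (use Td Pc Yc in auto)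
  moreover have "T Y 0 = \<alpha>" "P Y 0 = \<beta>" by (auto simp: T_def P_def)
  ultimately show ?thesis by blast
qed

text \<open>
  Integrating the equation twice bounds \<open>|u|\<close> by a constant plus an integral of \<open>|Q| |u|\<close>, to which
  Gronwall's lemma applies; integrating it once then bounds \<open>|p|\<close>. The constants depend on \<open>Q\<close> only through its
  \<open>L\<^sub>1\<close> norm, hence are locally uniform in the spectral parameter.
\<close>

lemma ode_sol_bound:
  assumes sol: "ode_sol Q u p g" and g: "continuous_on {0..pi} g"
    and G: "\<And>x. x \<in> {0..pi} \<Longrightarrow> cmod (g x) \<le> G"
    and x: "x \<in> {0..pi}"
  defines "C \<equiv> (cmod (u 0) + pi * cmod (p 0) + pi\<^sup>2 * G) * exp (pi * mass pi)"
  shows "cmod (u x) \<le> C" "cmod (p x) \<le> cmod (p 0) + pi * G + mass pi * C"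
proof -
  have uc: "continuous_on {0..pi} (\<lambda>x. cmod (u x))"
    by (intro continuous_on_norm ode_sol_continuous(1)[OF sol])
  define J where "J x = integral {0..x} (\<lambda>t. cmod (Q t) * cmod (u t))" for x
  have Ji: "(\<lambda>t. cmod (Q t) * cmod (u t)) integrable_on {0..x}" if "x \<in> {0..pi}" for x
    by (rule integrable_sub[OF norm_Q_times_int[OF uc] that])
  have Jm: "J s \<le> J x" if "0 \<le> s" "s \<le> x" "x \<le> pi" for s x
    unfolding J_def using that by (intro integral_subset_le Ji) auto
  have G0: "0 \<le> G" using order_trans[OF norm_ge_zero G[of 0]] by simp
  have pb: "cmod (p s) \<le> cmod (p 0) + J s + pi * G" if s: "s \<in> {0..pi}" for s
  proof -
    have "cmod (p s - p 0) \<le> integral {0..s} (\<lambda>t. cmod (Q t) * cmod (u t) + G)"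
      unfolding integral_unique[OF ode_sol_ftc(1)[OF sol g s], symmetric]
    proof (rule integral_norm_bound_integral)
      show "(\<lambda>t. Q t * u t - g t) integrable_on {0..s}"
        using ode_sol_ftc(1)[OF sol g s] by blast
      show "(\<lambda>t. cmod (Q t) * cmod (u t) + G) integrable_on {0..s}"
        by (intro integrable_add Ji s) auto
      fix t assume "t \<in> {0..s}"
      then have "cmod (g t) \<le> G" using s by (intro G) auto
      then show "cmod (Q t * u t - g t) \<le> cmod (Q t) * cmod (u t) + G"
        using norm_triangle_ineq4[of "Q t * u t" "g t"] by (simp add: norm_mult)
    qed
    also have "\<dots> = J s + s * G" using s
      by (subst integral_add) (auto simp: Ji J_def)
    also have "\<dots> \<le> J s + pi * G" using s G0 by (simp add: mult_right_mono)
    finally show ?thesis using norm_triangle_sub[of "p s" "p 0"] by linarith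
  qed
  have J0: "0 \<le> J y" if "y \<in> {0..pi}" for y using Jm[of 0 y] that by (simp add: J_def)
  have ub: "cmod (u y) \<le> C" if y: "y \<in> {0..pi}" for y
  proof -
    have "cmod (u x) \<le> (cmod (u 0) + pi * cmod (p 0) + pi\<^sup>2 * G)
      + pi * integral {0..x} (\<lambda>t. cmod (Q t) * cmod (u t))" if x: "x \<in> {0..pi}" for x
    proof -
      have "cmod (u x - u 0) \<le> (cmod (p 0) + J x + pi * G) * (x - 0)"
        unfolding integral_unique[OF ode_sol_ftc(2)[OF sol g x], symmetric]
      proof (rule integral_bound)
        show "0 \<le> x" using x by simp
        show "continuous_on {0..x} p"
          by (rule continuous_on_subset[OF ode_sol_continuous(2)[OF sol]]) (use x in auto)
        show "\<And>t. t \<in> {0..x} \<Longrightarrow> cmod (p t) \<le> cmod (p 0) + J x + pi * G"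
          using pb Jm x by fastforce
      qed
      also have "\<dots> \<le> (cmod (p 0) + J x + pi * G) * pi"
        using x G0 J0[OF x] by (intro mult_left_mono add_nonneg_nonneg) auto
      finally show ?thesis using norm_triangle_sub[of "u x" "u 0"]
        by (simp add: J_def algebra_simps power2_eq_square)
    qed
    then have "cmod (u y) \<le> (cmod (u 0) + pi * cmod (p 0) + pi\<^sup>2 * G) * exp (pi * mass y)"
      by (intro Gronwall[OF uc] y) auto
    also have "\<dots> \<le> C" unfolding C_def
      using mass_mono[of y pi] y G0 by (intro mult_left_mono) auto
    finally show ?thesis .
  qed
  show "cmod (u x) \<le> C" by (rule ub[OF x])
  have "J x \<le> integral {0..x} (\<lambda>t. cmod (Q t) * C)"
    unfolding J_def
    using x ub by (intro integral_le Ji integrable_sub[OF norm_Q_times_int] mult_left_mono) auto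
  also have "\<dots> = mass x * C" by (simp add: mass_def)
  also have "\<dots> \<le> mass pi * C" using mass_mono[of x pi] x order_trans[OF norm_ge_zero ub[OF x]]
    by (intro mult_right_mono) auto
  finally show "cmod (p x) \<le> cmod (p 0) + pi * G + mass pi * C" using pb[OF x] by linarith
qed

lemma ode_sol_unique:
  assumes "ode_sol Q u p g" "ode_sol Q v r g" "u 0 = v 0" "p 0 = r 0" "x \<in> {0..pi}"
  shows "u x = v x" "p x = r x"
proof -
  have "ode_sol Q (\<lambda>x. u x - v x) (\<lambda>x. p x - r x) (\<lambda>x. 0)"
    using ode_sol_lincomb[OF assms(1,2), of 1 "-1"] by simp
  from ode_sol_bound[OF this, of 0] show "u x = v x" "p x = r x" using assms by auto
qed

end

section \<open>Classical solutions and the Lagrange identity\<close>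

lemma ode_sol_ddx:
  assumes "ode_sol Q u p g" "x \<in> {0..pi}"
  shows "ddx u x = p x"
  unfolding ddx_def
  by (rule vector_derivative_within_closed_interval[OF pi_gt_zero assms(2)
        ode_sol_deriv_within[OF assms]])

lemma ode_sol_shift:
  "ode_sol (\<lambda>x. Q x - l) u p g \<longleftrightarrow> ode_sol Q u p (\<lambda>x. l * u x + g x)"
proof
  show "ode_sol Q u p (\<lambda>x. l * u x + g x)" if "ode_sol (\<lambda>x. Q x - l) u p g"
    by (rule ode_sol_cong[OF that]) (auto simp: algebra_simps)
  show "ode_sol (\<lambda>x. Q x - l) u p g" if "ode_sol Q u p (\<lambda>x. l * u x + g x)"
    by (rule ode_sol_cong[OF that]) (auto simp: algebra_simps)
qed

lemma AE_lebesgue_on_subset: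
  assumes "AE x in lebesgue_on S. P x" "T \<subseteq> S" "S \<in> sets lebesgue" "T \<in> sets lebesgue"
  shows "AE x in lebesgue_on T. P x"
  using assms by (auto simp: AE_restrict_space_iff elim!: eventually_mono)

context potential
begin

lemma potential_shift: "potential (\<lambda>x. Q x - l)"
proof
  show "(\<lambda>x. Q x - l) absolutely_integrable_on {0..pi}"
    by (intro set_integral_diff Q_int absolutely_integrable_continuous_real continuous_on_const)
  show "continuous_on {0<..<pi} (\<lambda>x. Q x - l)"
    by (intro continuous_on_diff Q_cont continuous_on_const)
qed

lemma mass_shift_le: "potential.mass (\<lambda>x. Q x - l) pi \<le> mass pi + pi * cmod l"
proof -
  interpret s: potential "\<lambda>x. Q x - l" by (rule potential_shift)
  have pi0: "pi \<in> {0..pi}" by simp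
  have "s.mass pi \<le> integral {0..pi} (\<lambda>t. cmod (Q t) + cmod l)"
    unfolding s.mass_def
    by (intro integral_le integrable_add integrable_sub[OF norm_Q_int pi0] integrable_sub[OF s.norm_Q_int pi0]
        norm_triangle_ineq4) auto
  also have "\<dots> = mass pi + pi * cmod l"
    unfolding mass_def by (subst integral_add) (auto intro: integrable_sub[OF norm_Q_int pi0])
  finally show ?thesis .
qed

text \<open>
  The density \<open>w\<close> of the second derivative agrees almost everywhere with \<open>Q u - f\<close>, and replacing it by this
  function, which is continuous inside, does not change its indefinite integral.
\<close>

lemma sturm_liouville_iff_ode_sol:
  assumes f: "continuous_on {0..pi} f"
  shows "sturm_liouville Q u f \<longleftrightarrow> ode_sol Q u (ddx u) f"
proof -
  define h where "h x = Q x * u x - f x" for x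
  have main: "h absolutely_integrable_on {0..pi}" "continuous_on {0<..<pi} h"
    "\<And>x. x \<in> {0..pi} \<Longrightarrow> integrable (lebesgue_on {0<..<x}) h"
    "\<And>x. x \<in> {0..pi} \<Longrightarrow> (LINT t|lebesgue_on {0<..<x}. h t) = integral {0..x} h"
    if "\<And>x. x \<in> {0..pi} \<Longrightarrow> (u has_vector_derivative ddx u x) (at x within {0..pi})"
  proof -
    have uc: "continuous_on {0..pi} u"
      unfolding continuous_on_eq_continuous_within
      using has_vector_derivative_continuous that by blast
    show ai: "h absolutely_integrable_on {0..pi}"
      unfolding h_def
      by (intro set_integral_diff Q_times_int uc absolutely_integrable_continuous_real f)
    show "continuous_on {0<..<pi} h"
      unfolding h_def
      by (rule continuous_on_diff[OF Q_times_cont[OF uc] continuous_on_subset[OF f]]) auto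
    fix x assume x: "x \<in> {0..pi}"
    have "h absolutely_integrable_on {0..x}"
      by (rule absolutely_integrable_on_subinterval[OF ai]) (use x in auto)
    then have "h absolutely_integrable_on {0<..<x}"
      by (rule set_integrable_subset) auto
    then show "integrable (lebesgue_on {0<..<x}) h"
      by (rule absolutely_integrable_imp_integrable) simp
    then show "(LINT t|lebesgue_on {0<..<x}. h t) = integral {0..x} h"
      by (simp add: lebesgue_integral_eq_integral flip: integral_open_interval_real)
  qed
  show ?thesis
  proof
    assume sl: "sturm_liouville Q u f"
    then have ud: "\<And>x. x \<in> {0..pi} \<Longrightarrow> (u has_vector_derivative ddx u x) (at x within {0..pi})"
      unfolding sturm_liouville_def by blast
    obtain w where w: "integrable leb_0pi w"
      "\<forall>x\<in>{0..pi}. ddx u x = ddx u 0 + (LINT t|lebesgue_on {0<..<x}. w t)"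
      "AE x in leb_0pi. - w x + Q x * u x = f x"
      using sl unfolding sturm_liouville_def by blast
    have dd: "ddx u x = ddx u 0 + integral {0..x} h" if x: "x \<in> {0..pi}" for x
    proof -
      have sub: "{0<..<x} \<subseteq> {0<..<pi}" using x by auto
      have "(LINT t|lebesgue_on {0<..<x}. w t) = (LINT t|lebesgue_on {0<..<x}. h t)"
      proof (rule integral_cong_AE)
        show "w \<in> borel_measurable (lebesgue_on {0<..<x})"
          by (rule measurable_restrict_mono[OF borel_measurable_integrable[OF w(1)] sub])
        show "h \<in> borel_measurable (lebesgue_on {0<..<x})"
          using main(3)[OF ud x] by (rule borel_measurable_integrable)
        have "AE t in lebesgue_on {0<..<x}. - w t + Q t * u t = f t"
          by (rule AE_lebesgue_on_subset[OF w(3) sub]) auto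
        then show "AE t in lebesgue_on {0<..<x}. w t = h t"
          by (rule eventually_mono) (simp add: h_def algebra_simps)
      qed
      then have "(LINT t|lebesgue_on {0<..<x}. w t) = integral {0..x} h"
        using main(4)[OF ud x] by (rule trans)
      then show ?thesis
        by (rule subst[where P="\<lambda>v. ddx u x = ddx u 0 + v"]) (rule bspec[OF w(2) x])
    qed
    show "ode_sol Q u (ddx u) f"
      unfolding ode_sol_def
    proof (intro conjI ballI)
      show "(u has_vector_derivative ddx u x) (at x within {0..pi})" if "x \<in> {0..pi}" for x
        by (rule ud[OF that])
      have "continuous_on {0..pi} (\<lambda>x. ddx u 0 + integral {0..x} h)"
        by (intro continuous_on_add continuous_on_const indefinite_integral_props(1) main ud)
      then show "continuous_on {0..pi} (ddx u)"
        by (rule continuous_on_eq) (simp add: dd[symmetric])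
      fix x assume x: "x \<in> {0<..<pi}"
      have "((\<lambda>x. ddx u 0 + integral {0..x} h) has_vector_derivative 0 + h x) (at x)"
        by (intro has_vector_derivative_add has_vector_derivative_const
            indefinite_integral_props(2) main ud x)
      then have "(ddx u has_vector_derivative 0 + h x) (at x)"
        by (rule has_vector_derivative_transform_within_open[where S="{0<..<pi}"])
          (use x in \<open>auto simp: dd[symmetric]\<close>)
      then show "(ddx u has_vector_derivative Q x * u x - f x) (at x)" by (simp add: h_def)
    qed
  next
    assume o: "ode_sol Q u (ddx u) f"
    then have ud: "\<And>x. x \<in> {0..pi} \<Longrightarrow> (u has_vector_derivative ddx u x) (at x within {0..pi})"
      unfolding ode_sol_def by blast
    show "sturm_liouville Q u f"
      unfolding sturm_liouville_def
    proof (intro conjI exI[of _ h] ballI)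
      show "(u has_vector_derivative ddx u x) (at x within {0..pi})" if "x \<in> {0..pi}" for x
        by (rule ud[OF that])
      show "integrable leb_0pi h" by (rule main(3)[OF ud]) auto
      show "ddx u x = ddx u 0 + (LINT t|lebesgue_on {0<..<x}. h t)" if x: "x \<in> {0..pi}" for x
        using integral_unique[OF ode_sol_ftc(1)[OF o f x]] main(4)[OF ud x]
        by (simp add: h_def[abs_def])
      show "AE x in leb_0pi. - h x + Q x * u x = f x" by (simp add: h_def)
    qed
  qed
qed

lemma ode_sol_imp_sturm_liouville:
  assumes "ode_sol Q u p f" "continuous_on {0..pi} f"
  shows "sturm_liouville Q u f"
proof -
  have "ode_sol Q u (ddx u) f"
    by (rule ode_sol_cong[OF assms(1)]) (auto simp: ode_sol_ddx[OF assms(1)])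
  then show ?thesis using sturm_liouville_iff_ode_sol[OF assms(2)] by blast
qed

lemma sturm_liouville_shift:
  assumes g: "continuous_on {0..pi} g" and u: "sturm_liouville Q u (\<lambda>x. l * u x + g x)"
  shows "ode_sol (\<lambda>x. Q x - l) u (ddx u) g"
proof -
  have "continuous_on {0..pi} u"
    unfolding continuous_on_eq_continuous_within
    using has_vector_derivative_continuous u unfolding sturm_liouville_def by blast
  then have "continuous_on {0..pi} (\<lambda>x. l * u x + g x)"
    by (intro continuous_on_add continuous_on_mult continuous_on_const g)
  from sturm_liouville_iff_ode_sol[OF this] u show ?thesis
    unfolding ode_sol_shift by blast
qed

lemma Lagrange_identity:
  assumes u: "ode_sol (\<lambda>x. Q x - l) u p g" and y: "ode_sol (\<lambda>x. Q x - n) y r (\<lambda>x. 0)"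
    and g: "continuous_on {0..pi} g"
  shows "(l - n) * integral {0..pi} (\<lambda>x. u x * y x) + integral {0..pi} (\<lambda>x. g x * y x)
    = (u pi * r pi - p pi * y pi) - (u 0 * r 0 - p 0 * y 0)"
proof -
  note cu = ode_sol_continuous[OF u] and cy = ode_sol_continuous[OF y]
  have "((\<lambda>x. (l - n) * (u x * y x) + g x * y x) has_integral
      (u pi * r pi - p pi * y pi) - (u 0 * r 0 - p 0 * y 0)) {0..pi}"
  proof (rule fundamental_theorem_of_calculus_interior)
    show "continuous_on {0..pi} (\<lambda>x. u x * r x - p x * y x)"
      by (intro continuous_on_diff continuous_on_mult cu cy)
    fix x assume x: "x \<in> {0<..<pi}"
    have "((\<lambda>x. u x * r x - p x * y x) has_vector_derivative
       (u x * ((Q x - n) * y x - 0) + p x * r x)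
       - (p x * r x + ((Q x - l) * u x - g x) * y x)) (at x)"
      by (rule has_vector_derivative_diff has_vector_derivative_mult
          ode_sol_derivs[OF u x] ode_sol_derivs[OF y x])+
    then show "((\<lambda>x. u x * r x - p x * y x) has_vector_derivative
        (l - n) * (u x * y x) + g x * y x) (at x)"
      by (simp add: algebra_simps)
  qed auto
  moreover have "((\<lambda>x. (l - n) * (u x * y x) + g x * y x) has_integral
      (l - n) * integral {0..pi} (\<lambda>x. u x * y x) + integral {0..pi} (\<lambda>x. g x * y x)) {0..pi}"
    by (intro has_integral_add has_integral_mult_right integrable_integral
        integrable_continuous_real continuous_on_mult cu cy g)
  ultimately show ?thesis by (rule has_integral_unique[rotated])
qed

lemma initial_value_problem_exists:
  "\<exists>u. sturm_liouville Q u (\<lambda>x. \<mu>\<^sup>2 * u x) \<and> u 0 = a \<and> ddx u 0 = b"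
proof -
  obtain u p where u: "ode_sol (\<lambda>x. Q x - \<mu>\<^sup>2) u p (\<lambda>x. 0)" "u 0 = a" "p 0 = b"
    using potential.ode_sol_exists[OF potential_shift, of "\<lambda>x. 0" "\<mu>\<^sup>2" a b] by auto
  have "sturm_liouville Q u (\<lambda>x. \<mu>\<^sup>2 * u x)"
    using ode_sol_imp_sturm_liouville[of u p "\<lambda>x. \<mu>\<^sup>2 * u x"] u(1) ode_sol_continuous[OF u(1)]
    unfolding ode_sol_shift by (simp add: continuous_on_mult)
  moreover have "ddx u 0 = b" using ode_sol_ddx[OF u(1), of 0] u(3) by simp
  ultimately show ?thesis using u(2) by blast
qed

lemma sol_c_props:
  "ode_sol (\<lambda>x. Q x - \<mu>\<^sup>2) (sol_c Q \<mu>) (ddx (sol_c Q \<mu>)) (\<lambda>x. 0)"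
  "sol_c Q \<mu> 0 = 1" "ddx (sol_c Q \<mu>) 0 = 0"
proof -
  note * = someI_ex[OF initial_value_problem_exists[of \<mu> 1 0], folded sol_c_def]
  show "ode_sol (\<lambda>x. Q x - \<mu>\<^sup>2) (sol_c Q \<mu>) (ddx (sol_c Q \<mu>)) (\<lambda>x. 0)"
    by (rule sturm_liouville_shift) (use * in simp_all)
  show "sol_c Q \<mu> 0 = 1" "ddx (sol_c Q \<mu>) 0 = 0" using * by simp_all
qed

lemma sol_s_props:
  "ode_sol (\<lambda>x. Q x - \<mu>\<^sup>2) (sol_s Q \<mu>) (ddx (sol_s Q \<mu>)) (\<lambda>x. 0)"
  "sol_s Q \<mu> 0 = 0" "ddx (sol_s Q \<mu>) 0 = 1"
proof -
  note * = someI_ex[OF initial_value_problem_exists[of \<mu> 0 1], folded sol_s_def]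
  show "ode_sol (\<lambda>x. Q x - \<mu>\<^sup>2) (sol_s Q \<mu>) (ddx (sol_s Q \<mu>)) (\<lambda>x. 0)"
    by (rule sturm_liouville_shift) (use * in simp_all)
  show "sol_s Q \<mu> 0 = 0" "ddx (sol_s Q \<mu>) 0 = 1" using * by simp_all
qed

lemma Wronskian_sol_c_sol_s:
  "sol_c Q \<mu> pi * ddx (sol_s Q \<mu>) pi - ddx (sol_c Q \<mu>) pi * sol_s Q \<mu> pi = 1"
  using Lagrange_identity[OF sol_c_props(1)[of \<mu>] sol_s_props(1)[of \<mu>]]
    sol_c_props(2,3)[of \<mu>] sol_s_props(2,3)[of \<mu>] by simp

definition cs_sol :: "complex \<Rightarrow> complex \<Rightarrow> complex \<Rightarrow> real \<Rightarrow> complex"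
  where "cs_sol \<mu> a b x = a * sol_c Q \<mu> x + b * sol_s Q \<mu> x"

definition cs_der :: "complex \<Rightarrow> complex \<Rightarrow> complex \<Rightarrow> real \<Rightarrow> complex"
  where "cs_der \<mu> a b x = a * ddx (sol_c Q \<mu>) x + b * ddx (sol_s Q \<mu>) x"

lemma cs_sol_ode: "ode_sol (\<lambda>x. Q x - \<mu>\<^sup>2) (cs_sol \<mu> a b) (cs_der \<mu> a b) (\<lambda>x. 0)"
  using ode_sol_lincomb[OF sol_c_props(1)[of \<mu>] sol_s_props(1)[of \<mu>], of a b]
  by (simp add: cs_sol_def[abs_def] cs_der_def[abs_def])

lemma cs_sol_0 [simp]: "cs_sol \<mu> a b 0 = a" "cs_der \<mu> a b 0 = b"
  using sol_c_props(2,3)[of \<mu>] sol_s_props(2,3)[of \<mu>] by (simp_all add: cs_sol_def cs_der_def)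

lemma eq_cs_sol:
  assumes "ode_sol (\<lambda>x. Q x - \<mu>\<^sup>2) u p (\<lambda>x. 0)" "x \<in> {0..pi}"
  shows "u x = cs_sol \<mu> (u 0) (p 0) x" "p x = cs_der \<mu> (u 0) (p 0) x"
  using potential.ode_sol_unique[OF potential_shift assms(1) cs_sol_ode[of \<mu> "u 0" "p 0"] _ _ assms(2)]
  by simp_all

end

lemma has_field_derivative_of_quotient_bound:
  fixes f :: "complex \<Rightarrow> complex"
  assumes "\<And>h. h \<noteq> 0 \<Longrightarrow> cmod h \<le> 1 \<Longrightarrow> cmod ((f (z + h) - f z) / h - D) \<le> C * cmod h"
  shows "(f has_field_derivative D) (at z)"
  unfolding DERIV_def LIM_def
proof (intro allI impI)
  fix r :: real assume r: "0 < r"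
  define s where "s = min 1 (r / (\<bar>C\<bar> + 1))"
  have "0 < s" using r by (simp add: s_def)
  moreover have "dist ((f (z + h) - f z) / h) D < r" if "h \<noteq> 0 \<and> dist h 0 < s" for h
  proof -
    have h: "cmod h < s" "h \<noteq> 0" using that by auto
    then have "cmod ((f (z + h) - f z) / h - D) \<le> C * cmod h"
      using assms[of h] by (simp add: s_def)
    also have "\<dots> \<le> \<bar>C\<bar> * cmod h" by (intro mult_right_mono) auto
    also have "\<dots> < (\<bar>C\<bar> + 1) * cmod h" using h(2) by (intro mult_strict_right_mono) auto
    also have "\<dots> \<le> (\<bar>C\<bar> + 1) * (r / (\<bar>C\<bar> + 1))"
      using h(1) by (intro mult_left_mono) (auto simp: s_def)
    also have "\<dots> = r" using abs_ge_zero[of C] by (simp add: add_nonneg_eq_0_iff)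
    finally show ?thesis by (simp add: dist_norm)
  qed
  ultimately show "\<exists>s>0. \<forall>h. h \<noteq> 0 \<and> dist h 0 < s \<longrightarrow> dist ((f (z + h) - f z) / h) D < r"
    by blast
qed

context potential
begin

text \<open>
  The difference quotient solves the equation at \<open>n\<close> with right-hand side \<open>y (n + h)\<close>, and its candidate limit
  \<open>Y\<close> solves it with right-hand side \<open>y n\<close>. The first fact bounds \<open>y (n + h) - y n\<close> by \<open>O(h)\<close>, and the
  difference of the two equations then bounds the error by \<open>O(h)\<close>.
\<close>

lemma ode_sol_difference_quotient:
  fixes y p :: "complex \<Rightarrow> real \<Rightarrow> complex"
  assumes sol: "\<And>n. ode_sol (\<lambda>x. Q x - n) (y n) (p n) (\<lambda>x. 0)"
    and init: "\<And>n. y n 0 = a" "\<And>n. p n 0 = b"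
  shows "\<exists>Y P C. continuous_on {0..pi} Y \<and>
    (\<forall>h x. h \<noteq> 0 \<and> cmod h \<le> 1 \<and> x \<in> {0..pi} \<longrightarrow>
      cmod ((y (n + h) x - y n x) / h - Y x) \<le> C * cmod h \<and>
      cmod ((p (n + h) x - p n x) / h - P x) \<le> C * cmod h)"
proof -
  interpret s: potential "\<lambda>x. Q x - n" by (rule potential_shift)
  note cy = ode_sol_continuous(1)[OF sol]
  define L where "L = mass pi + pi * (cmod n + 1)"
  have L: "potential.mass (\<lambda>x. Q x - n') pi \<le> L" if "cmod (n' - n) \<le> 1" for n'
  proof -
    have "cmod n' \<le> cmod n + 1" using that norm_triangle_sub[of n' n] by linarith
    then have "pi * cmod n' \<le> pi * (cmod n + 1)" by (intro mult_left_mono) auto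
    then show ?thesis using mass_shift_le[of n'] unfolding L_def by linarith
  qed
  define C1 where "C1 = (cmod a + pi * cmod b) * exp (pi * L)"
  have y_le: "cmod (y n' x) \<le> C1" if "cmod (n' - n) \<le> 1" "x \<in> {0..pi}" for n' x
  proof -
    interpret s': potential "\<lambda>x. Q x - n'" by (rule potential_shift)
    have "cmod (y n' x) \<le> (cmod a + pi * cmod b) * exp (pi * s'.mass pi)"
      using s'.ode_sol_bound(1)[OF sol[of n'], of 0 x] that(2) init by simp
    also have "\<dots> \<le> C1" unfolding C1_def using L[OF that(1)]
      by (intro mult_left_mono) auto
    finally show ?thesis .
  qed
  have C1_0: "0 \<le> C1" unfolding C1_def by simp
  have smass: "0 \<le> s.mass pi" "s.mass pi \<le> L" using s.mass_nonneg[of pi] L[of n] by auto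
  have bound0: "cmod (u x) \<le> pi\<^sup>2 * G * exp (pi * L)"
    "cmod (r x) \<le> (pi + L * (pi\<^sup>2 * exp (pi * L))) * G"
    if "ode_sol (\<lambda>x. Q x - n) u r g" "u 0 = 0" "r 0 = 0" "continuous_on {0..pi} g"
      "\<And>x. x \<in> {0..pi} \<Longrightarrow> cmod (g x) \<le> G" "x \<in> {0..pi}" for u r g G x
  proof -
    have G0: "0 \<le> G" using order_trans[OF norm_ge_zero that(5)[of 0]] by simp
    have e: "pi\<^sup>2 * G * exp (pi * s.mass pi) \<le> pi\<^sup>2 * G * exp (pi * L)"
      using smass G0 by (intro mult_left_mono) auto
    show "cmod (u x) \<le> pi\<^sup>2 * G * exp (pi * L)"
      using order_trans[OF s.ode_sol_bound(1)[OF that(1,4,5,6)]] that(2,3) e by simp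
    have "cmod (r x) \<le> pi * G + s.mass pi * (pi\<^sup>2 * G * exp (pi * s.mass pi))"
      using s.ode_sol_bound(2)[OF that(1,4,5,6)] that(2,3) by simp
    also have "s.mass pi * (pi\<^sup>2 * G * exp (pi * s.mass pi)) \<le> L * (pi\<^sup>2 * G * exp (pi * L))"
      using smass e G0 by (intro mult_mono) auto
    finally show "cmod (r x) \<le> (pi + L * (pi\<^sup>2 * exp (pi * L))) * G"
      by (simp add: algebra_simps)
  qed
  obtain Y P where Y: "ode_sol (\<lambda>x. Q x - n) Y P (y n)" "Y 0 = 0" "P 0 = 0"
    using s.ode_sol_exists[OF cy] by blast
  define C2 where "C2 = pi\<^sup>2 * C1 * exp (pi * L)"
  have "0 \<le> C2" using C1_0 by (simp add: C2_def)
  define C where "C = max (pi\<^sup>2 * C2 * exp (pi * L)) ((pi + L * (pi\<^sup>2 * exp (pi * L))) * C2)"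
  show ?thesis
  proof (intro exI conjI allI impI)
    show "continuous_on {0..pi} Y" using ode_sol_continuous(1)[OF Y(1)] .
    fix h x assume "h \<noteq> 0 \<and> cmod h \<le> 1 \<and> x \<in> {0..pi}"
    then have h: "h \<noteq> 0" "cmod h \<le> 1" and x: "x \<in> {0..pi}" by auto
    have "ode_sol (\<lambda>x. Q x - n) (y (n + h)) (p (n + h)) (\<lambda>x. h * y (n + h) x)"
      by (rule ode_sol_cong[OF sol[of "n + h"]]) (auto simp: algebra_simps)
    from ode_sol_lincomb[OF this sol[of n], of "1/h" "-1/h"]
    have D: "ode_sol (\<lambda>x. Q x - n) (\<lambda>x. (y (n + h) x - y n x) / h)
        (\<lambda>x. (p (n + h) x - p n x) / h) (y (n + h))"
      by (rule ode_sol_cong) (use h(1) in \<open>auto simp: field_simps\<close>)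
    have diff: "cmod (y (n + h) t - y n t) \<le> C2 * cmod h" if "t \<in> {0..pi}" for t
      using bound0(1)[OF D _ _ cy y_le that] h init
      by (simp add: C2_def norm_divide divide_le_eq)
    have E: "ode_sol (\<lambda>x. Q x - n) (\<lambda>x. (y (n + h) x - y n x) / h - Y x)
        (\<lambda>x. (p (n + h) x - p n x) / h - P x) (\<lambda>x. y (n + h) x - y n x)"
      using ode_sol_lincomb[OF D Y(1), of 1 "-1"] by simp
    note b = bound0[OF E _ _ continuous_on_diff[OF cy cy] diff x]
    have "cmod ((y (n + h) x - y n x) / h - Y x) \<le> pi\<^sup>2 * (C2 * cmod h) * exp (pi * L)"
      using b(1) init Y by simp
    also have "\<dots> = (pi\<^sup>2 * C2 * exp (pi * L)) * cmod h" by simp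
    also have "\<dots> \<le> C * cmod h" unfolding C_def by (intro mult_right_mono) auto
    finally show "cmod ((y (n + h) x - y n x) / h - Y x) \<le> C * cmod h" .
    have "cmod ((p (n + h) x - p n x) / h - P x)
        \<le> (pi + L * (pi\<^sup>2 * exp (pi * L))) * (C2 * cmod h)"
      using b(2) init Y by simp
    also have "\<dots> = ((pi + L * (pi\<^sup>2 * exp (pi * L))) * C2) * cmod h" by simp
    also have "\<dots> \<le> C * cmod h" unfolding C_def by (intro mult_right_mono) auto
    finally show "cmod ((p (n + h) x - p n x) / h - P x) \<le> C * cmod h" .
  qed
qed

lemma ode_sol_holomorphic:
  fixes y p :: "complex \<Rightarrow> real \<Rightarrow> complex"
  assumes sol: "\<And>n. ode_sol (\<lambda>x. Q x - n) (y n) (p n) (\<lambda>x. 0)"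
    and init: "\<And>n. y n 0 = a" "\<And>n. p n 0 = b"
  shows "x \<in> {0..pi} \<Longrightarrow> (\<lambda>n. y n x) holomorphic_on UNIV"
    and "x \<in> {0..pi} \<Longrightarrow> (\<lambda>n. p n x) holomorphic_on UNIV"
    and "continuous_on {0..pi} g \<Longrightarrow>
      (\<lambda>n. integral {0..pi} (\<lambda>x. g x * y n x)) holomorphic_on UNIV"
proof -
  have *: "\<exists>Y P C. continuous_on {0..pi} Y \<and>
    (\<forall>h x. h \<noteq> 0 \<and> cmod h \<le> 1 \<and> x \<in> {0..pi} \<longrightarrow>
      cmod ((y (n + h) x - y n x) / h - Y x) \<le> C * cmod h \<and>
      cmod ((p (n + h) x - p n x) / h - P x) \<le> C * cmod h)" for n
    by (rule ode_sol_difference_quotient[OF sol init])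
  show "(\<lambda>n. y n x) holomorphic_on UNIV" if x: "x \<in> {0..pi}"
  proof (rule holomorphic_onI)
    fix n
    obtain Y P C where "\<And>h x. h \<noteq> 0 \<Longrightarrow> cmod h \<le> 1 \<Longrightarrow> x \<in> {0..pi} \<Longrightarrow>
      cmod ((y (n + h) x - y n x) / h - Y x) \<le> C * cmod h" using *[of n] by blast
    then have "((\<lambda>n. y n x) has_field_derivative Y x) (at n)"
      by (rule has_field_derivative_of_quotient_bound[of _ _ _ C]) (use x in simp_all)
    then show "(\<lambda>n. y n x) field_differentiable at n within UNIV"
      by (auto simp: field_differentiable_def)
  qed
  show "(\<lambda>n. p n x) holomorphic_on UNIV" if x: "x \<in> {0..pi}"
  proof (rule holomorphic_onI)
    fix n
    obtain Y P C where "\<And>h x. h \<noteq> 0 \<Longrightarrow> cmod h \<le> 1 \<Longrightarrow> x \<in> {0..pi} \<Longrightarrow>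
      cmod ((p (n + h) x - p n x) / h - P x) \<le> C * cmod h" using *[of n] by blast
    then have "((\<lambda>n. p n x) has_field_derivative P x) (at n)"
      by (rule has_field_derivative_of_quotient_bound[of _ _ _ C]) (use x in simp_all)
    then show "(\<lambda>n. p n x) field_differentiable at n within UNIV"
      by (auto simp: field_differentiable_def)
  qed
  show "(\<lambda>n. integral {0..pi} (\<lambda>x. g x * y n x)) holomorphic_on UNIV"
    if g: "continuous_on {0..pi} g"
  proof (rule holomorphic_onI)
    fix n
    obtain Y P C where Y: "continuous_on {0..pi} Y" "\<And>h x. h \<noteq> 0 \<Longrightarrow> cmod h \<le> 1 \<Longrightarrow> x \<in> {0..pi} \<Longrightarrow>
      cmod ((y (n + h) x - y n x) / h - Y x) \<le> C * cmod h" using *[of n] by blast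
    obtain B where B: "\<forall>v\<in>g ` {0..pi}. cmod v \<le> B"
      using compact_imp_bounded[OF compact_continuous_image[OF g compact_Icc]]
      unfolding bounded_iff by blast
    note cy = ode_sol_continuous(1)[OF sol]
    have "((\<lambda>n. integral {0..pi} (\<lambda>x. g x * y n x)) has_field_derivative
        integral {0..pi} (\<lambda>x. g x * Y x)) (at n)"
    proof (rule has_field_derivative_of_quotient_bound[of _ _ _ "B * C * pi"])
      fix h :: complex assume h: "h \<noteq> 0" "cmod h \<le> 1"
      have int: "(\<lambda>x. g x * v x) integrable_on {0..pi}" if "continuous_on {0..pi} v" for v
        by (intro integrable_continuous_real continuous_on_mult g that)
      have "(integral {0..pi} (\<lambda>x. g x * y (n + h) x) - integral {0..pi} (\<lambda>x. g x * y n x)) / h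
          - integral {0..pi} (\<lambda>x. g x * Y x)
        = integral {0..pi} (\<lambda>x. (1 / h) * (g x * y (n + h) x - g x * y n x) - g x * Y x)"
      proof -
        have "((\<lambda>x. (1 / h) * (g x * y (n + h) x - g x * y n x) - g x * Y x) has_integral
          (1 / h) * (integral {0..pi} (\<lambda>x. g x * y (n + h) x) - integral {0..pi} (\<lambda>x. g x * y n x))
          - integral {0..pi} (\<lambda>x. g x * Y x)) {0..pi}"
          by (intro has_integral_diff has_integral_mult_right integrable_integral int cy Y)
        then show ?thesis by (simp add: integral_unique)
      qed
      also have "\<dots> = integral {0..pi} (\<lambda>x. g x * ((y (n + h) x - y n x) / h - Y x))"
        by (simp add: algebra_simps diff_divide_distrib)
      also have "cmod \<dots> \<le> (B * (C * cmod h)) * (pi - 0)"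
      proof (rule integral_bound)
        show "continuous_on {0..pi} (\<lambda>x. g x * ((y (n + h) x - y n x) / h - Y x))"
          by (intro continuous_on_mult continuous_on_diff continuous_on_divide continuous_on_const
              g cy Y) (use h in auto)
        show "cmod (g x * ((y (n + h) x - y n x) / h - Y x)) \<le> B * (C * cmod h)"
          if "x \<in> {0..pi}" for x
          unfolding norm_mult
          using that Y(2)[OF h that] B order_trans[OF norm_ge_zero, of "g x" B] by (intro mult_mono) auto
      qed auto
      finally show "cmod ((integral {0..pi} (\<lambda>x. g x * y (n + h) x) - integral {0..pi} (\<lambda>x. g x * y n x)) / h
          - integral {0..pi} (\<lambda>x. g x * Y x)) \<le> B * C * pi * cmod h"
        by (simp add: mult_ac)
    qed
    then show "(\<lambda>n. integral {0..pi} (\<lambda>x. g x * y n x)) field_differentiable at n within UNIV"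
      by (auto simp: field_differentiable_def)
  qed
qed

end

section \<open>Asymptotics in the spectral parameter\<close>

lemma norm_cos_sin_le_exp:
  fixes w :: complex
  shows "cmod (cos w) \<le> exp \<bar>Im w\<bar>" "cmod (sin w) \<le> exp \<bar>Im w\<bar>"
proof -
  have 1: "cmod (exp (\<i> * w)) \<le> exp \<bar>Im w\<bar>" "cmod (exp (- (\<i> * w))) \<le> exp \<bar>Im w\<bar>"
    by (auto simp: norm_exp_eq_Re)
  have "cmod (exp (\<i> * w) + exp (- (\<i> * w))) \<le> 2 * exp \<bar>Im w\<bar>"
    using norm_triangle_ineq[of "exp (\<i> * w)" "exp (- (\<i> * w))"] 1 by linarith
  then show "cmod (cos w) \<le> exp \<bar>Im w\<bar>"
    unfolding cos_exp_eq by (simp add: norm_divide)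
  have "cmod (exp (\<i> * w) - exp (- (\<i> * w))) \<le> 2 * exp \<bar>Im w\<bar>"
    using norm_triangle_ineq4[of "exp (\<i> * w)" "exp (- (\<i> * w))"] 1 by linarith
  then show "cmod (sin w) \<le> exp \<bar>Im w\<bar>"
    unfolding sin_exp_eq by (simp add: norm_divide norm_mult)
qed

context potential
begin

text \<open>
  The equation with \<open>Q = 0\<close> is solved explicitly, and \<open>Q y\<close> is treated as its right-hand side: the integrands are
  the derivatives in \<open>t\<close> of \<open>cos (z (x - t)) y + sin (z (x - t)) p / z\<close> and of
  \<open>cos (z (x - t)) p - z sin (z (x - t)) y\<close>.
\<close>

lemma ode_sol_variation_of_constants:
  assumes y: "ode_sol (\<lambda>x. Q x - z\<^sup>2) y p (\<lambda>x. 0)" and z: "z \<noteq> 0" and x: "x \<in> {0..pi}"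
  shows "((\<lambda>t. sin (z * of_real (x - t)) / z * (Q t * y t)) has_integral
      y x - (y 0 * cos (z * of_real x) + p 0 * sin (z * of_real x) / z)) {0..x}" (is ?th1)
    and "((\<lambda>t. cos (z * of_real (x - t)) * (Q t * y t)) has_integral
      p x - (p 0 * cos (z * of_real x) - y 0 * z * sin (z * of_real x))) {0..x}" (is ?th2)
proof -
  define C where "C t = cos (z * (of_real x - of_real t))" for t :: real
  define S where "S t = sin (z * (of_real x - of_real t))" for t :: real
  have Cd: "(C has_vector_derivative z * S t) (at t)" for t
    unfolding C_def[abs_def] S_def
    by (rule has_vector_derivative_real_field) (auto intro!: derivative_eq_intros)
  have Sd: "(S has_vector_derivative - z * C t) (at t)" for t
    unfolding S_def[abs_def] C_def
    by (rule has_vector_derivative_real_field) (auto intro!: derivative_eq_intros)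
  have cont: "continuous_on {0..x} C" "continuous_on {0..x} S"
    unfolding C_def[abs_def] S_def[abs_def] by (intro continuous_intros)+
  have cy: "continuous_on {0..x} y" "continuous_on {0..x} p"
    using x by (auto intro: continuous_on_subset[OF ode_sol_continuous(1)[OF y]]
        continuous_on_subset[OF ode_sol_continuous(2)[OF y]])
  have "((\<lambda>t. S t / z * (Q t * y t)) has_integral
      (C x * y x + 1 / z * (S x * p x)) - (C 0 * y 0 + 1 / z * (S 0 * p 0))) {0..x}"
  proof (rule fundamental_theorem_of_calculus_interior)
    show "0 \<le> x" using x by simp
    show "continuous_on {0..x} (\<lambda>t. C t * y t + 1 / z * (S t * p t))"
      by (intro continuous_on_add continuous_on_mult continuous_on_const cont cy)
    fix t assume "t \<in> {0<..<x}"
    then have t: "t \<in> {0<..<pi}" using x by auto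
    have "((\<lambda>t. C t * y t + 1 / z * (S t * p t)) has_vector_derivative
      (C t * p t + z * S t * y t) + 1 / z * (S t * ((Q t - z\<^sup>2) * y t - 0) + - z * C t * p t)) (at t)"
      by (intro has_vector_derivative_add has_vector_derivative_mult_right
          has_vector_derivative_mult Cd Sd ode_sol_derivs[OF y t])
    then show "((\<lambda>t. C t * y t + 1 / z * (S t * p t)) has_vector_derivative
        S t / z * (Q t * y t)) (at t)"
      using z by (simp add: field_simps power2_eq_square)
  qed
  then show ?th1 unfolding C_def S_def by (simp add: algebra_simps)
  have "((\<lambda>t. C t * (Q t * y t)) has_integral
      (C x * p x - z * (S x * y x)) - (C 0 * p 0 - z * (S 0 * y 0))) {0..x}"
  proof (rule fundamental_theorem_of_calculus_interior)
    show "0 \<le> x" using x by simp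
    show "continuous_on {0..x} (\<lambda>t. C t * p t - z * (S t * y t))"
      by (intro continuous_on_diff continuous_on_mult continuous_on_const cont cy)
    fix t assume "t \<in> {0<..<x}"
    then have t: "t \<in> {0<..<pi}" using x by auto
    have "((\<lambda>t. C t * p t - z * (S t * y t)) has_vector_derivative
      (C t * ((Q t - z\<^sup>2) * y t - 0) + z * S t * p t) - z * (S t * p t + - z * C t * y t)) (at t)"
      by (intro has_vector_derivative_diff has_vector_derivative_mult_right
          has_vector_derivative_mult Cd Sd ode_sol_derivs[OF y t])
    then show "((\<lambda>t. C t * p t - z * (S t * y t)) has_vector_derivative C t * (Q t * y t)) (at t)"
      by (simp add: algebra_simps power2_eq_square)
  qed
  then show ?th2 unfolding C_def S_def by (simp add: algebra_simps)
qed

text \<open>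
  The constant in the \<open>O(1/z)\<close> by which solutions differ from those of the equation without potential.
\<close>

definition pert :: real where "pert = 2 * mass pi * exp (mass pi)"

lemma pert_nonneg: "0 \<le> pert" unfolding pert_def using mass_nonneg[of pi] by simp

text \<open>
  Gronwall's lemma for \<open>|y x| exp (- |Im z| x)\<close>, in which the growth of the kernels is cancelled; the result is
  inserted once more into the variation of constants formula.
\<close>

lemma ode_sol_asymptotics:
  assumes y: "ode_sol (\<lambda>x. Q x - z\<^sup>2) y p (\<lambda>x. 0)" and z: "1 \<le> cmod z" and x: "x \<in> {0..pi}"
    and A: "cmod (y 0) \<le> A" "cmod (p 0) \<le> A * cmod z"
  shows "cmod (y x - (y 0 * cos (z * of_real x) + p 0 * sin (z * of_real x) / z))
      \<le> pert * A * exp (\<bar>Im z\<bar> * x) / cmod z" (is ?th1)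
    and "cmod (p x - (p 0 * cos (z * of_real x) - y 0 * z * sin (z * of_real x)))
      \<le> pert * A * exp (\<bar>Im z\<bar> * x)" (is ?th2)
proof -
  have z0: "z \<noteq> 0" using z by auto
  have A0: "0 \<le> A" using order_trans[OF norm_ge_zero A(1)] .
  define s where "s = \<bar>Im z\<bar>"
  define n where "n t = cmod (y t) * exp (- s * t)" for t
  have nc: "continuous_on {0..pi} n"
    unfolding n_def by (intro continuous_intros ode_sol_continuous(1)[OF y])
  have ni: "(\<lambda>t. cmod (Q t) * n t) integrable_on {0..x}" if "x \<in> {0..pi}" for x
    by (rule integrable_sub[OF norm_Q_times_int[OF nc] that])
  have trig: "cmod (cos (z * of_real t)) \<le> exp (s * t)" "cmod (sin (z * of_real t)) \<le> exp (s * t)"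
    if "0 \<le> t" for t
    using norm_cos_sin_le_exp[of "z * of_real t"] that by (auto simp: s_def abs_mult)
  have est: "cmod I \<le> c * exp (s * x) * integral {0..x} (\<lambda>t. cmod (Q t) * n t)"
    if I: "((\<lambda>t. k t * (Q t * y t)) has_integral I) {0..x}" and x: "x \<in> {0..pi}"
      and k: "\<And>t. t \<in> {0..x} \<Longrightarrow> cmod (k t) \<le> c * exp (s * (x - t))" for I k c x
  proof -
    have "cmod (integral {0..x} (\<lambda>t. k t * (Q t * y t)))
      \<le> integral {0..x} (\<lambda>t. c * exp (s * x) * (cmod (Q t) * n t))"
    proof (rule integral_norm_bound_integral)
      show "(\<lambda>t. k t * (Q t * y t)) integrable_on {0..x}" using I by blast
      show "(\<lambda>t. c * exp (s * x) * (cmod (Q t) * n t)) integrable_on {0..x}"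
        by (rule integrable_on_mult_right[OF ni[OF x]])
      fix t assume t: "t \<in> {0..x}"
      have "cmod (k t * (Q t * y t)) \<le> (c * exp (s * (x - t))) * (cmod (Q t) * cmod (y t))"
        unfolding norm_mult by (intro mult_right_mono k t) auto
      also have "\<dots> = c * exp (s * x) * (cmod (Q t) * n t)"
        by (simp add: n_def exp_diff exp_minus right_diff_distrib field_simps)
      finally show "cmod (k t * (Q t * y t)) \<le> c * exp (s * x) * (cmod (Q t) * n t)" .
    qed
    then show ?thesis using integral_unique[OF I] by simp
  qed
  have kz: "cmod (sin (z * of_real (x - t)) / z) \<le> 1 / cmod z * exp (s * (x - t))"
    if "t \<in> {0..x}" for x t
    using trig(2)[of "x - t"] that z0 by (simp add: norm_divide divide_right_mono)
  have n_le: "n x \<le> 2 * A * exp (mass pi)" if x: "x \<in> {0..pi}" for x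
  proof -
    have le: "n x \<le> 2 * A + 1 * integral {0..x} (\<lambda>t. cmod (Q t) * n t)" if x: "x \<in> {0..pi}" for x
    proof -
      define J where "J = integral {0..x} (\<lambda>t. cmod (Q t) * n t)"
      have J0: "0 \<le> J" unfolding J_def
        by (rule integral_nonneg[OF ni[OF x]]) (simp add: n_def)
      have "cmod (y 0 * cos (z * of_real x)) \<le> A * exp (s * x)"
        unfolding norm_mult using trig(1) x A A0 by (intro mult_mono) auto
      moreover have "cmod (p 0 * sin (z * of_real x) / z) \<le> A * exp (s * x)"
      proof -
        have "cmod (p 0) * cmod (sin (z * of_real x)) \<le> (A * cmod z) * exp (s * x)"
          using trig(2) x A A0 by (intro mult_mono) auto
        then show ?thesis using z0 by (simp add: norm_mult norm_divide field_simps)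
      qed
      moreover have "cmod (y x - (y 0 * cos (z * of_real x) + p 0 * sin (z * of_real x) / z))
        \<le> exp (s * x) * J"
      proof -
        have "cmod (y x - (y 0 * cos (z * of_real x) + p 0 * sin (z * of_real x) / z))
           \<le> 1 / cmod z * exp (s * x) * J"
          unfolding J_def
          by (rule est[OF ode_sol_variation_of_constants(1)[OF y z0 x] x kz])
        also have "\<dots> \<le> 1 * exp (s * x) * J"
          using z z0 J0 by (intro mult_right_mono) (auto simp: pos_divide_le_eq)
        finally show ?thesis by simp
      qed
      ultimately have "cmod (y x) \<le> exp (s * x) * (2 * A + J)"
        using norm_triangle_ineq[of "y 0 * cos (z * of_real x)" "p 0 * sin (z * of_real x) / z"]
          norm_triangle_sub[of "y x" "y 0 * cos (z * of_real x) + p 0 * sin (z * of_real x) / z"]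
        by (simp add: algebra_simps)
      then have "cmod (y x) * exp (- s * x) \<le> exp (s * x) * (2 * A + J) * exp (- s * x)"
        by (intro mult_right_mono) auto
      also have "\<dots> = 2 * A + J" by (simp add: exp_minus field_simps)
      finally show ?thesis by (simp add: n_def J_def)
    qed
    have "n x \<le> 2 * A * exp (1 * mass x)"
      by (rule Gronwall[OF nc _ _ le x]) (auto simp: n_def)
    also have "\<dots> \<le> 2 * A * exp (mass pi)"
      using mass_mono[of x pi] x A0 by (intro mult_left_mono) auto
    finally show ?thesis .
  qed
  have J_le: "integral {0..x} (\<lambda>t. cmod (Q t) * n t) \<le> pert * A"
  proof -
    have "integral {0..x} (\<lambda>t. cmod (Q t) * n t) \<le> integral {0..x} (\<lambda>t. cmod (Q t) * (2 * A * exp (mass pi)))"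
      using x n_le by (intro integral_le ni x mult_left_mono integrable_sub[OF norm_Q_times_int]) auto
    also have "\<dots> = mass x * (2 * A * exp (mass pi))" by (simp add: mass_def)
    also have "\<dots> \<le> mass pi * (2 * A * exp (mass pi))"
      using mass_mono[of x pi] x A0 by (intro mult_right_mono) auto
    finally show ?thesis by (simp add: pert_def mult_ac)
  qed
  have "cmod (y x - (y 0 * cos (z * of_real x) + p 0 * sin (z * of_real x) / z))
    \<le> 1 / cmod z * exp (s * x) * integral {0..x} (\<lambda>t. cmod (Q t) * n t)"
    by (rule est[OF ode_sol_variation_of_constants(1)[OF y z0 x] x kz])
  also have "\<dots> \<le> 1 / cmod z * exp (s * x) * (pert * A)"
    using J_le by (intro mult_left_mono) auto
  finally show ?th1 by (simp add: s_def mult_ac)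
  have "cmod (p x - (p 0 * cos (z * of_real x) - y 0 * z * sin (z * of_real x)))
    \<le> 1 * exp (s * x) * integral {0..x} (\<lambda>t. cmod (Q t) * n t)"
  proof (rule est[OF ode_sol_variation_of_constants(2)[OF y z0 x] x])
    show "cmod (cos (z * of_real (x - t))) \<le> 1 * exp (s * (x - t))" if "t \<in> {0..x}" for t
      using trig(1)[of "x - t"] that by simp
  qed
  also have "\<dots> \<le> 1 * exp (s * x) * (pert * A)"
    using J_le by (intro mult_left_mono) auto
  finally show ?th2 by (simp add: s_def mult_ac)
qed

end

text \<open>
  With \<open>w = phase \<theta> z\<close>, the functions \<open>cos (w - z x)\<close> and \<open>sin (w - z x)\<close> are even and odd about the midpoint
  of the interval when \<open>\<theta> = 0\<close>, and odd and even when \<open>\<theta> = 1\<close>. This treats both values of \<open>\<theta>\<close> at once.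
\<close>

definition phase :: "nat \<Rightarrow> complex \<Rightarrow> complex"
  where "phase \<theta> z = (z + of_nat \<theta>) * of_real (pi / 2)"

lemma phase_at_pi:
  assumes "\<theta> \<in> {0, 1}"
  shows "(-1) ^ \<theta> * cos (phase \<theta> z - z * of_real pi) = cos (phase \<theta> z)"
    and "(-1) ^ \<theta> * sin (phase \<theta> z - z * of_real pi) = - sin (phase \<theta> z)"
proof -
  have *: "phase \<theta> z - z * of_real pi = of_nat \<theta> * of_real pi - phase \<theta> z"
    by (simp add: phase_def field_simps)
  have "\<theta> = 0 \<or> \<theta> = 1" using assms by auto
  then show "(-1) ^ \<theta> * cos (phase \<theta> z - z * of_real pi) = cos (phase \<theta> z)"
    "(-1) ^ \<theta> * sin (phase \<theta> z - z * of_real pi) = - sin (phase \<theta> z)"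
    unfolding * by (auto simp: cos_diff sin_diff cos_of_real sin_of_real)
qed

context potential
begin

text \<open>
  The solution with the initial data of \<open>cos (phase \<theta> z - z x)\<close>, together with its derivative \<open>solC'\<close>; in the same way,
  \<open>solS\<close> has the initial data of \<open>- sin (phase \<theta> z - z x)\<close>.
\<close>

definition solC :: "nat \<Rightarrow> complex \<Rightarrow> real \<Rightarrow> complex"
  where "solC \<theta> z = cs_sol z (cos (phase \<theta> z)) (z * sin (phase \<theta> z))"
definition solC' :: "nat \<Rightarrow> complex \<Rightarrow> real \<Rightarrow> complex"
  where "solC' \<theta> z = cs_der z (cos (phase \<theta> z)) (z * sin (phase \<theta> z))"
definition solS :: "nat \<Rightarrow> complex \<Rightarrow> real \<Rightarrow> complex"
  where "solS \<theta> z = cs_sol z (- sin (phase \<theta> z)) (z * cos (phase \<theta> z))"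
definition solS' :: "nat \<Rightarrow> complex \<Rightarrow> real \<Rightarrow> complex"
  where "solS' \<theta> z = cs_der z (- sin (phase \<theta> z)) (z * cos (phase \<theta> z))"

lemma solC_solS_asymptotics:
  assumes z: "1 \<le> cmod z" and x: "x \<in> {0..pi}"
  defines "E \<equiv> exp (2 * pi * \<bar>Im z\<bar>)"
  shows "cmod (solC \<theta> z x - cos (phase \<theta> z - z * of_real x)) \<le> pert * E / cmod z"
    and "cmod (solC' \<theta> z x - z * sin (phase \<theta> z - z * of_real x)) \<le> pert * E"
    and "cmod (solS \<theta> z x + sin (phase \<theta> z - z * of_real x)) \<le> pert * E / cmod z"
    and "cmod (solS' \<theta> z x - z * cos (phase \<theta> z - z * of_real x)) \<le> pert * E"
proof -
  define w where "w = phase \<theta> z"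
  define A where "A = exp (pi / 2 * \<bar>Im z\<bar>)"
  have z0: "z \<noteq> 0" using z by auto
  have "Im w = Im z * (pi / 2)" by (simp add: w_def phase_def)
  then have "\<bar>Im w\<bar> = \<bar>Im z * (pi / 2)\<bar>" by (rule arg_cong)
  then have "\<bar>Im w\<bar> = pi / 2 * \<bar>Im z\<bar>" unfolding abs_mult by simp
  then have wA: "cmod (cos w) \<le> A" "cmod (sin w) \<le> A"
    using norm_cos_sin_le_exp[of w] unfolding A_def by metis+
  then have wAz: "cmod (z * cos w) \<le> A * cmod z" "cmod (z * sin w) \<le> A * cmod z"
    unfolding norm_mult by (simp_all add: mult.commute[of A] mult_left_mono)
  have AE: "pert * A * exp (\<bar>Im z\<bar> * x) \<le> pert * E"
  proof -
    have "A * exp (\<bar>Im z\<bar> * x) \<le> A * exp (\<bar>Im z\<bar> * pi)"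
      using x by (intro mult_left_mono) (auto simp: A_def intro: mult_left_mono)
    also have "\<dots> = exp (3/2 * (pi * \<bar>Im z\<bar>))" unfolding A_def by (simp flip: exp_add) 
    also have "\<dots> \<le> E" unfolding E_def by simp
    finally show ?thesis using pert_nonneg by (simp add: mult.assoc mult_left_mono)
  qed
  then have AEz: "pert * A * exp (\<bar>Im z\<bar> * x) / cmod z \<le> pert * E / cmod z"
    by (rule divide_right_mono) simp
  note Y = ode_sol_asymptotics[OF cs_sol_ode[of z "cos w" "z * sin w"] z x, unfolded cs_sol_0, OF wA(1) wAz(2)]
  note V = ode_sol_asymptotics[OF cs_sol_ode[of z "- sin w" "z * cos w"] z x, unfolded cs_sol_0 norm_minus_cancel, OF wA(2) wAz(1)]
  have c: "cos w * cos (z * of_real x) + z * sin w * sin (z * of_real x) / z = cos (w - z * of_real x)"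
    "z * sin w * cos (z * of_real x) - cos w * z * sin (z * of_real x) = z * sin (w - z * of_real x)"
    "- sin w * cos (z * of_real x) + z * cos w * sin (z * of_real x) / z = - sin (w - z * of_real x)"
    "z * cos w * cos (z * of_real x) - - sin w * z * sin (z * of_real x) = z * cos (w - z * of_real x)"
    using z0 by (simp_all add: cos_diff sin_diff algebra_simps)
  show "cmod (solC \<theta> z x - cos (phase \<theta> z - z * of_real x)) \<le> pert * E / cmod z"
    using order_trans[OF Y(1) AEz] unfolding c solC_def w_def[symmetric] .
  show "cmod (solC' \<theta> z x - z * sin (phase \<theta> z - z * of_real x)) \<le> pert * E"
    using order_trans[OF Y(2) AE] unfolding c solC'_def w_def[symmetric] .
  show "cmod (solS \<theta> z x + sin (phase \<theta> z - z * of_real x)) \<le> pert * E / cmod z"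
    using order_trans[OF V(1) AEz] unfolding c solS_def w_def[symmetric] by simp
  show "cmod (solS' \<theta> z x - z * cos (phase \<theta> z - z * of_real x)) \<le> pert * E"
    using order_trans[OF V(2) AE] unfolding c solS'_def w_def[symmetric] .
qed

lemma solC_solS_bounds:
  assumes z: "1 \<le> cmod z" and x: "x \<in> {0..pi}"
  shows "cmod (solC \<theta> z x) \<le> (1 + pert) * exp (2 * pi * \<bar>Im z\<bar>)"
    and "cmod (solS \<theta> z x) \<le> (1 + pert) * exp (2 * pi * \<bar>Im z\<bar>)"
proof -
  define E where "E = exp (2 * pi * \<bar>Im z\<bar>)"
  define w where "w = phase \<theta> z - z * of_real x"
  have "\<bar>Im w\<bar> = \<bar>Im z\<bar> * \<bar>pi / 2 - x\<bar>"
    by (simp add: w_def phase_def algebra_simps flip: abs_mult)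
  also have "\<dots> \<le> \<bar>Im z\<bar> * (2 * pi)" using x by (intro mult_left_mono) auto
  finally have "exp \<bar>Im w\<bar> \<le> E" by (simp add: E_def mult.commute)
  then have t: "cmod (cos w) \<le> E" "cmod (sin w) \<le> E"
    using norm_cos_sin_le_exp[of w] by auto
  have "pert * E / cmod z \<le> pert * E / 1"
    using z pert_nonneg by (intro divide_left_mono) (auto simp: E_def)
  then have d: "pert * E / cmod z \<le> pert * E" by simp
  show "cmod (solC \<theta> z x) \<le> (1 + pert) * exp (2 * pi * \<bar>Im z\<bar>)"
    using solC_solS_asymptotics(1)[OF z x, of \<theta>] t(1) d norm_triangle_sub[of "solC \<theta> z x" "cos w"]
    unfolding E_def[symmetric] w_def[symmetric] by (simp add: algebra_simps)
  show "cmod (solS \<theta> z x) \<le> (1 + pert) * exp (2 * pi * \<bar>Im z\<bar>)"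
    using solC_solS_asymptotics(3)[OF z x, of \<theta>] t(2) d norm_triangle_sub[of "solS \<theta> z x" "- sin w"]
    unfolding E_def[symmetric] w_def[symmetric] by (simp add: algebra_simps)
qed

end

text \<open>
  The adjoint boundary forms: if \<open>u\<close> satisfies the boundary conditions, then the boundary term
  \<open>[u y' - u' y]\<close> between \<open>0\<close> and \<open>\<pi>\<close> is \<open>u(0) * bc_der \<theta> y' + u'(0) * bc_val \<theta> y\<close>. Solutions on which both forms
  vanish are the eigenfunctions of the adjoint problem, up to complex conjugation.
\<close>

definition bc_der :: "nat \<Rightarrow> (real \<Rightarrow> complex) \<Rightarrow> complex"
  where "bc_der \<theta> r = (-1) ^ \<theta> * r pi - r 0"
definition bc_val :: "nat \<Rightarrow> (real \<Rightarrow> complex) \<Rightarrow> complex"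
  where "bc_val \<theta> y = (-1) ^ \<theta> * y pi + y 0"

section \<open>Boundary forms\<close>

context potential
begin

text \<open>
  The values without potential are \<open>- 2 z sin w\<close> and \<open>2 cos w\<close> for \<open>solC\<close>, and \<open>0\<close> for both forms of \<open>solS\<close>.
  That both vanish identically in \<open>z\<close> is the degeneracy of the problem.
\<close>

lemma solC_solS_boundary_forms:
  assumes th: "\<theta> \<in> {0, 1}" and z: "1 \<le> cmod z"
  defines "E \<equiv> exp (2 * pi * \<bar>Im z\<bar>)"
  shows "cmod (bc_der \<theta> (solC' \<theta> z) + 2 * z * sin (phase \<theta> z)) \<le> pert * E"
    and "cmod (bc_val \<theta> (solC \<theta> z) - 2 * cos (phase \<theta> z)) \<le> pert * E / cmod z"
    and "cmod (bc_der \<theta> (solS' \<theta> z)) \<le> pert * E"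
    and "cmod (bc_val \<theta> (solS \<theta> z)) \<le> pert * E / cmod z"
proof -
  have e: "cmod ((-1) ^ \<theta>) = 1" by (simp add: norm_power)
  have pi0: "pi \<in> {0..pi}" by simp
  have "bc_der \<theta> (solC' \<theta> z) + 2 * z * sin (phase \<theta> z)
    = (-1) ^ \<theta> * (solC' \<theta> z pi - z * sin (phase \<theta> z - z * of_real pi))"
    using phase_at_pi(2)[OF th, of z] by (simp add: bc_der_def solC'_def algebra_simps)
  then show "cmod (bc_der \<theta> (solC' \<theta> z) + 2 * z * sin (phase \<theta> z)) \<le> pert * E"
    using solC_solS_asymptotics(2)[OF z pi0, of \<theta>] by (simp add: norm_mult e E_def)
  have "bc_val \<theta> (solC \<theta> z) - 2 * cos (phase \<theta> z)
    = (-1) ^ \<theta> * (solC \<theta> z pi - cos (phase \<theta> z - z * of_real pi))"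
    using phase_at_pi(1)[OF th, of z] by (simp add: bc_val_def solC_def algebra_simps)
  then show "cmod (bc_val \<theta> (solC \<theta> z) - 2 * cos (phase \<theta> z)) \<le> pert * E / cmod z"
    using solC_solS_asymptotics(1)[OF z pi0, of \<theta>] by (simp add: norm_mult e E_def)
  have "bc_der \<theta> (solS' \<theta> z) = (-1) ^ \<theta> * (solS' \<theta> z pi - z * cos (phase \<theta> z - z * of_real pi))"
    using phase_at_pi(1)[OF th, of z] by (simp add: bc_der_def solS'_def algebra_simps)
  then show "cmod (bc_der \<theta> (solS' \<theta> z)) \<le> pert * E"
    using solC_solS_asymptotics(4)[OF z pi0, of \<theta>] by (simp add: norm_mult e E_def)
  have "bc_val \<theta> (solS \<theta> z) = (-1) ^ \<theta> * (solS \<theta> z pi + sin (phase \<theta> z - z * of_real pi))"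
    using phase_at_pi(2)[OF th, of z] by (simp add: bc_val_def solS_def algebra_simps)
  then show "cmod (bc_val \<theta> (solS \<theta> z)) \<le> pert * E / cmod z"
    using solC_solS_asymptotics(3)[OF z pi0, of \<theta>] by (simp add: norm_mult e E_def)
qed

end

section \<open>Polynomial interpolation\<close>

text \<open>
  Both sides are polynomials in \<open>t\<close> of degree below \<open>m\<close> that agree at the \<open>m\<close> nodes.
\<close>

lemma Lagrange_interpolation:
  fixes x :: "nat \<Rightarrow> 'a::field"
  assumes inj: "inj_on x {..<m}" and deg: "degree p < m"
  shows "poly p t = (\<Sum>j<m. poly p (x j) * (\<Prod>k\<in>{..<m} - {j}. (t - x k) / (x j - x k)))"
proof -
  define L where "L j = (\<Prod>k\<in>{..<m} - {j}. smult (1 / (x j - x k)) [:- x k, 1:])" for j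
  have poly_L: "poly (L j) s = (\<Prod>k\<in>{..<m} - {j}. (s - x k) / (x j - x k))" for j s
    unfolding L_def poly_prod by (intro prod.cong) (auto simp: diff_divide_distrib)
  have deg_L: "degree (L j) < m" if "j < m" for j
  proof -
    have "degree (L j) \<le> (\<Sum>k\<in>{..<m} - {j}. degree (smult (1 / (x j - x k)) [:- x k, 1:]))"
      unfolding L_def using degree_prod_sum_le[OF finite_Diff[OF finite_lessThan]]
      unfolding o_def .
    also have "\<dots> \<le> (\<Sum>k\<in>{..<m} - {j}. 1)"
      by (intro sum_mono) simp
    also have "\<dots> = m - 1" using that by simp
    finally show ?thesis using that by simp
  qed
  have "p = (\<Sum>j<m. smult (poly p (x j)) (L j))"
  proof (rule poly_eqI_degree[of "x ` {..<m}"])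
    fix s assume "s \<in> x ` {..<m}"
    then obtain i where i: "i < m" "s = x i" by auto
    have "poly (L j) (x i) = (if j = i then 1 else 0)" if "j < m" for j
    proof (cases "j = i")
      case True
      have "(x i - x k) / (x i - x k) = 1" if "k \<in> {..<m} - {i}" for k
        using that i inj by (auto simp: inj_on_def)
      then show ?thesis unfolding poly_L True by simp
    next
      case False
      then show ?thesis unfolding poly_L using i by (auto intro!: bexI[of _ i])
    qed
    then have "(\<Sum>j<m. poly p (x j) * poly (L j) (x i)) = (\<Sum>j<m. if j = i then poly p (x j) else 0)"
      by (intro sum.cong) auto
    then show "poly p s = poly (\<Sum>j<m. smult (poly p (x j)) (L j)) s"
      using i by (simp add: poly_sum)
  next
    have card: "card (x ` {..<m}) = m" using card_image[OF inj] by simp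
    then show "degree p < card (x ` {..<m})" using deg by simp
    show "degree (\<Sum>j<m. smult (poly p (x j)) (L j)) < card (x ` {..<m})"
      unfolding card using deg
      by (intro degree_sum_less order_le_less_trans[OF degree_smult_le] deg_L) auto
  qed
  then have "poly p t = poly (\<Sum>j<m. smult (poly p (x j)) (L j)) t" by (rule arg_cong)
  then show ?thesis by (simp add: poly_sum poly_L)
qed

text \<open>
  \<open>n\<^sup>n / n!\<close> is a term of the series of \<open>exp n\<close>, and \<open>exp 1 \<le> 3\<close>.
\<close>

lemma power_self_le_fact: "real n ^ n \<le> 3 ^ n * fact n"
proof -
  have "(\<Sum>i\<in>{n}. real n ^ i /\<^sub>R fact i) \<le> (\<Sum>i. real n ^ i /\<^sub>R fact i)"
    by (rule sum_le_suminf) (auto simp: summable_exp)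
  also have "\<dots> = exp (real n)" using exp_converges[of "real n"] by (simp add: sums_iff)
  also have "\<dots> = exp 1 ^ n" using exp_of_nat_mult[of n "1::real"] by simp
  also have "\<dots> \<le> 3 ^ n" by (intro power_mono exp_le) simp
  finally show ?thesis by (simp add: field_simps)
qed

lemma prod_abs_diff_eq_fact:
  assumes "j < m"
  shows "(\<Prod>k\<in>{..<m} - {j}. \<bar>real j - real k\<bar>) = fact j * fact (m - 1 - j)"
proof -
  have "{..<m} - {j} = {..<j} \<union> {j<..<m}" using assms by auto
  moreover have "(\<Prod>k\<in>{..<j} \<union> {j<..<m}. \<bar>real j - real k\<bar>)
    = (\<Prod>k<j. \<bar>real j - real k\<bar>) * (\<Prod>k\<in>{j<..<m}. \<bar>real j - real k\<bar>)"
    by (rule prod.union_disjoint) auto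
  ultimately have "(\<Prod>k\<in>{..<m} - {j}. \<bar>real j - real k\<bar>)
    = (\<Prod>k<j. \<bar>real j - real k\<bar>) * (\<Prod>k\<in>{j<..<m}. \<bar>real j - real k\<bar>)" by metis
  also have "(\<Prod>k<j. \<bar>real j - real k\<bar>) = fact j"
    unfolding fact_prod_rev of_nat_prod
    by (intro prod.cong) (auto simp: of_nat_diff)
  also have "(\<Prod>k\<in>{j<..<m}. \<bar>real j - real k\<bar>) = (\<Prod>i\<in>{0..<m - 1 - j}. real (Suc i))"
    by (rule prod.reindex_bij_witness[of _ "\<lambda>i. j + 1 + i" "\<lambda>k. k - j - 1"])
      (use assms in \<open>auto simp: of_nat_diff\<close>)
  also have "\<dots> = fact (m - 1 - j)" by (simp add: fact_prod_Suc)
  finally show ?thesis .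
qed

text \<open>
  The nodes are the squares of an arithmetic progression with step \<open>2\<close> and the evaluation point is a square too. Each
  quotient \<open>(t\<^sup>2 - z\<^sub>k\<^sup>2) / (z\<^sub>j\<^sup>2 - z\<^sub>k\<^sup>2)\<close> in the Lagrange basis splits: the factors with plus sign are comparable, and
  those with minus sign have product at most \<open>(B m)\<^sup>m\<^sup>-\<^sup>1 / (2\<^sup>m\<^sup>-\<^sup>1 j! (m - 1 - j)!)\<close>, which is
  exponential in \<open>m\<close>.
\<close>

lemma interpolation_bound:
  fixes p :: "complex poly" and l t :: complex and B N X :: real
  defines "z \<equiv> \<lambda>k::nat. N + 2 * real k"
  assumes deg: "degree p < m" and N: "1 \<le> N" and B: "1 \<le> B"
    and X: "\<And>k. k < m \<Longrightarrow> cmod (poly p (of_real (z k) ^ 2 - l)) \<le> X"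
    and t: "\<And>k. k < m \<Longrightarrow> cmod (t - of_real (z k)) \<le> B * m"
      "\<And>k. k < m \<Longrightarrow> cmod (t + of_real (z k)) \<le> 8 * N"
  shows "cmod (poly p (t\<^sup>2 - l)) \<le> (24 * B) ^ m * X"
proof -
  define x where "x k = complex_of_real (z k) ^ 2 - l" for k
  have m: "0 < m" using deg by simp
  have zdiff: "x j - x k = of_real ((z j - z k) * (z j + z k))" for j k
    by (simp add: x_def algebra_simps power2_eq_square)
  have zpos: "1 \<le> z k" for k using N by (simp add: z_def)
  have "inj x"
  proof (rule injI)
    fix j k assume "x j = x k"
    then have "complex_of_real ((z j - z k) * (z j + z k)) = 0" using zdiff[of j k] by (metis diff_self)
    then have "(z j - z k) * (z j + z k) = 0" by (simp only: of_real_eq_0_iff)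
    then have "z j = z k" using zpos[of j] zpos[of k] by simp
    then show "j = k" by (simp add: z_def)
  qed
  then have inj: "inj_on x {..<m}" by (rule inj_on_subset) simp
  have X0: "0 \<le> X" using order_trans[OF norm_ge_zero X[OF m]] .
  have trm: "cmod (\<Prod>k\<in>{..<m} - {j}. (t\<^sup>2 - l - x k) / (x j - x k)) \<le> (12 * B) ^ m"
    if j: "j < m" for j
  proof -
    have fac: "cmod ((t\<^sup>2 - l - x k) / (x j - x k)) \<le> 2 * B * m / \<bar>real j - real k\<bar>"
      if k: "k \<in> {..<m} - {j}" for k
    proof -
      have "t\<^sup>2 - l - x k = (t - of_real (z k)) * (t + of_real (z k))"
        by (simp add: x_def algebra_simps power2_eq_square)
      moreover have "cmod ((t - of_real (z k)) * (t + of_real (z k))) \<le> (B * m) * (8 * N)"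
        unfolding norm_mult using t[of k] k B by (intro mult_mono) auto
      ultimately have num: "cmod (t\<^sup>2 - l - x k) \<le> (B * m) * (8 * N)" by simp
      have "cmod (x j - x k) = \<bar>z j - z k\<bar> * \<bar>z j + z k\<bar>"
        unfolding zdiff norm_of_real abs_mult ..
      moreover have "\<bar>z j - z k\<bar> = 2 * \<bar>real j - real k\<bar>" by (simp add: z_def abs_if)
      moreover have "2 * \<bar>real j - real k\<bar> * (2 * N) \<le> 2 * \<bar>real j - real k\<bar> * \<bar>z j + z k\<bar>"
        by (intro mult_left_mono) (auto simp: z_def)
      ultimately have den: "2 * \<bar>real j - real k\<bar> * (2 * N) \<le> cmod (x j - x k)" by simp
      have pos: "0 < \<bar>real j - real k\<bar>" using k by auto
      have "cmod ((t\<^sup>2 - l - x k) / (x j - x k)) \<le> (B * m) * (8 * N) / (2 * \<bar>real j - real k\<bar> * (2 * N))"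
        unfolding norm_divide using num den pos N B by (intro frac_le) auto
      also have "\<dots> = 2 * B * m / \<bar>real j - real k\<bar>" using N pos by (simp add: field_simps)
      finally show ?thesis .
    qed
    have "cmod (\<Prod>k\<in>{..<m} - {j}. (t\<^sup>2 - l - x k) / (x j - x k))
      \<le> (\<Prod>k\<in>{..<m} - {j}. 2 * B * m / \<bar>real j - real k\<bar>)"
      unfolding prod_norm[symmetric] by (intro prod_mono conjI norm_ge_zero fac)
    also have "\<dots> = (2 * B * m) ^ (m - 1) / (fact j * fact (m - 1 - j))"
      using j by (simp add: prod_dividef prod_abs_diff_eq_fact)
    also have "\<dots> \<le> (2 * B * m) ^ (m - 1) * (2 ^ (m - 1) / fact (m - 1))"
    proof -
      have "fact j * fact (m - 1 - j) * ((m - 1) choose j) = (fact (m - 1) :: nat)"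
        using j by (intro binomial_fact_lemma) auto
      then have "(fact (m - 1) :: real) = fact j * fact (m - 1 - j) * real ((m - 1) choose j)"
        by (metis of_nat_fact of_nat_mult)
      also have "real ((m - 1) choose j) \<le> 2 ^ (m - 1)"
        using binomial_le_pow2[of "m - 1" j] by (metis of_nat_le_iff of_nat_numeral of_nat_power)
      finally have "fact (m - 1) \<le> fact j * fact (m - 1 - j) * (2::real) ^ (m - 1)"
        by (simp add: mult_left_mono)
      then have "1 / (fact j * fact (m - 1 - j)) \<le> (2::real) ^ (m - 1) / fact (m - 1)"
        by (simp add: field_simps)
      then have "(2 * B * m) ^ (m - 1) * (1 / (fact j * fact (m - 1 - j)))
          \<le> (2 * B * m) ^ (m - 1) * ((2::real) ^ (m - 1) / fact (m - 1))"
        using B by (intro mult_left_mono) auto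
      then show ?thesis by simp
    qed
    also have "\<dots> = (4 * B) ^ (m - 1) * (real m ^ (m - 1) / fact (m - 1))"
    proof -
      have "(4::real) ^ (m - 1) = 2 ^ (m - 1) * 2 ^ (m - 1)" by (simp flip: power_mult_distrib)
      then show ?thesis by (simp add: power_mult_distrib)
    qed
    also have "real m ^ (m - 1) / fact (m - 1) = real m ^ m / fact m"
      using m by (cases m) (simp_all add: field_simps del: of_nat_Suc)
    also have "(4 * B) ^ (m - 1) * (real m ^ m / fact m) \<le> (4 * B) ^ m * 3 ^ m"
    proof (intro mult_mono)
      show "(4 * B) ^ (m - 1) \<le> (4 * B) ^ m" using B by (intro power_increasing) auto
      show "real m ^ m / fact m \<le> 3 ^ m" using power_self_le_fact[of m] by (simp add: field_simps)
    qed (use B in auto)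
    also have "\<dots> = (4 * B * 3) ^ m" by (rule power_mult_distrib[symmetric])
    also have "4 * B * 3 = 12 * B" by simp
    finally show ?thesis .
  qed
  have "cmod (poly p (t\<^sup>2 - l))
    \<le> (\<Sum>j<m. cmod (poly p (x j) * (\<Prod>k\<in>{..<m} - {j}. (t\<^sup>2 - l - x k) / (x j - x k))))"
    unfolding Lagrange_interpolation[OF inj deg, of "t\<^sup>2 - l"] by (rule norm_sum)
  also have "\<dots> \<le> (\<Sum>j<m. X * (12 * B) ^ m)"
    unfolding norm_mult by (intro sum_mono mult_mono trm X[folded x_def] X0) auto
  also have "\<dots> = real m * ((12 * B) ^ m * X)" by simp
  also have "\<dots> \<le> 2 ^ m * ((12 * B) ^ m * X)"
    using B X0 by (intro mult_right_mono less_imp_le[OF of_nat_less_two_power]) simp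
  also have "\<dots> = (2 * (12 * B)) ^ m * X" unfolding power_mult_distrib[of 2] by (rule mult.assoc[symmetric])
  also have "2 * (12 * B) = 24 * B" by simp
  finally show ?thesis .
qed

section \<open>Chains of root functions and their polynomials of initial values\<close>

text \<open>
  A chain of \<open>m\<close> root functions; \<open>u i\<close> has order \<open>i\<close>, and \<open>p i\<close> is its derivative.
\<close>

definition chain :: "(real \<Rightarrow> complex) \<Rightarrow> nat \<Rightarrow> complex \<Rightarrow> nat \<Rightarrow>
    (nat \<Rightarrow> real \<Rightarrow> complex) \<Rightarrow> (nat \<Rightarrow> real \<Rightarrow> complex) \<Rightarrow> bool"
  where "chain Q \<theta> l m u p \<longleftrightarrow> (\<forall>i<m.
    ode_sol (\<lambda>x. Q x - l) (u i) (p i) (if i = 0 then (\<lambda>x. 0) else u (i - 1)) \<and>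
    u i pi = (-1) ^ \<theta> * u i 0 \<and> p i pi = - ((-1) ^ \<theta>) * p i 0)"

text \<open>
  The polynomial \<open>\<Sum>i<m. u i 0 * X\<^sup>i\<close>. The function \<open>\<Sum>i<m. (n - l)\<^sup>i u i\<close> solves the equation at \<open>n\<close> up to the remainder
  \<open>(n - l)\<^sup>m u (m - 1)\<close>; this polynomial, at \<open>n - l\<close>, gives its value at \<open>0\<close>, and the one of \<open>p\<close> its derivative.
\<close>

definition init_poly :: "nat \<Rightarrow> (nat \<Rightarrow> real \<Rightarrow> complex) \<Rightarrow> complex poly"
  where "init_poly m u = (\<Sum>i<m. monom (u i 0) i)"

lemma degree_init_poly: "0 < m \<Longrightarrow> degree (init_poly m u) < m"
  unfolding init_poly_def
  by (rule degree_sum_less) (auto intro: order_le_less_trans[OF degree_monom_le])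

lemma init_poly_Suc: "poly (init_poly (Suc m) u) x = poly (init_poly m u) x + u m 0 * x ^ m"
  by (simp add: init_poly_def poly_monom)

context potential
begin

lemma chain_step:
  assumes ch: "chain Q \<theta> l m u p" and i: "i < m"
    and y: "ode_sol (\<lambda>x. Q x - n) y r (\<lambda>x. 0)"
  shows "(l - n) * integral {0..pi} (\<lambda>x. u i x * y x)
      + (if i = 0 then 0 else integral {0..pi} (\<lambda>x. u (i - 1) x * y x))
    = u i 0 * bc_der \<theta> r + p i 0 * bc_val \<theta> y"
proof -
  have ui: "ode_sol (\<lambda>x. Q x - l) (u i) (p i) (if i = 0 then (\<lambda>x. 0) else u (i - 1))"
    and bc: "u i pi = (-1) ^ \<theta> * u i 0" "p i pi = - ((-1) ^ \<theta>) * p i 0"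
    using ch i unfolding chain_def by blast+
  have "continuous_on {0..pi} (if i = 0 then (\<lambda>x. 0) else u (i - 1))"
  proof (cases "i = 0")
    case False
    then have "i - 1 < m" using i by simp
    then show ?thesis using ch False ode_sol_continuous(1) unfolding chain_def by auto
  qed simp
  from Lagrange_identity[OF ui y this] show ?thesis
    by (simp add: bc bc_der_def bc_val_def algebra_simps split: if_splits)
qed

text \<open>
  The sum of the identities \<open>chain_step\<close> with weights \<open>(n - l)\<^sup>i\<close>: the pairings with the lower functions telescope.
\<close>

lemma chain_identity:
  assumes "chain Q \<theta> l m u p" "0 < m" and y: "ode_sol (\<lambda>x. Q x - n) y r (\<lambda>x. 0)"
  shows "- ((n - l) ^ m) * integral {0..pi} (\<lambda>x. u (m - 1) x * y x)
    = poly (init_poly m u) (n - l) * bc_der \<theta> r + poly (init_poly m p) (n - l) * bc_val \<theta> y"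
proof -
  define G where "G i = integral {0..pi} (\<lambda>x. u i x * y x)" for i
  have "- ((n - l) ^ Suc h) * G h
    = poly (init_poly (Suc h) u) (n - l) * bc_der \<theta> r + poly (init_poly (Suc h) p) (n - l) * bc_val \<theta> y"
    if "h < m" for h
    using that
  proof (induction h)
    case 0
    show ?case using chain_step[OF assms(1) 0 y]
      by (simp add: G_def init_poly_def algebra_simps monom_0)
  next
    case (Suc h)
    have "(l - n) * G (Suc h) + G h = u (Suc h) 0 * bc_der \<theta> r + p (Suc h) 0 * bc_val \<theta> y"
      using chain_step[OF assms(1) Suc.prems y] by (simp add: G_def)
    then have "(l - n) * G (Suc h) = u (Suc h) 0 * bc_der \<theta> r + p (Suc h) 0 * bc_val \<theta> y - G h"
      by (simp add: eq_diff_eq)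
    then have "(n - l) ^ Suc h * ((l - n) * G (Suc h))
      = (n - l) ^ Suc h * (u (Suc h) 0 * bc_der \<theta> r + p (Suc h) 0 * bc_val \<theta> y - G h)"
      by (rule arg_cong)
    moreover have "- ((n - l) ^ Suc (Suc h)) * G (Suc h) = (n - l) ^ Suc h * ((l - n) * G (Suc h))"
      by (simp add: algebra_simps)
    moreover have "- ((n - l) ^ Suc h) * G h
        = poly (init_poly (Suc h) u) (n - l) * bc_der \<theta> r + poly (init_poly (Suc h) p) (n - l) * bc_val \<theta> y"
      using Suc by simp
    ultimately show ?case
      unfolding init_poly_Suc[of "Suc h"] by (simp add: algebra_simps)
  qed
  from this[of "m - 1"] show ?thesis using assms(2) by (simp add: G_def)
qed

lemma solC_ode: "ode_sol (\<lambda>x. Q x - z\<^sup>2) (solC \<theta> z) (solC' \<theta> z) (\<lambda>x. 0)"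
  unfolding solC_def solC'_def by (rule cs_sol_ode)

lemma solS_ode: "ode_sol (\<lambda>x. Q x - z\<^sup>2) (solS \<theta> z) (solS' \<theta> z) (\<lambda>x. 0)"
  unfolding solS_def solS'_def by (rule cs_sol_ode)

lemma trig_phase_odd:
  assumes "odd (l + \<theta>)"
  shows "cos (phase \<theta> (of_nat l)) = 0" "cmod (sin (phase \<theta> (of_nat l))) = 1"
proof -
  obtain k where k: "l + \<theta> = 2 * k + 1" using assms oddE by blast
  have "phase \<theta> (of_nat l) = of_nat (l + \<theta>) * of_real (pi / 2)" by (simp add: phase_def)
  also have "\<dots> = of_real (real k * pi + pi / 2)" unfolding k by (simp add: algebra_simps)
  finally have w: "phase \<theta> (of_nat l) = of_real (real k * pi + pi / 2)" .
  show "cos (phase \<theta> (of_nat l)) = 0" unfolding w cos_of_real cos_add by simp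
  show "cmod (sin (phase \<theta> (of_nat l))) = 1"
    unfolding w sin_of_real sin_add norm_of_real by (simp add: cos_npi2 power_abs)
qed

lemma trig_phase_even:
  assumes "even (l + \<theta>)"
  shows "sin (phase \<theta> (of_nat l)) = 0" "cmod (cos (phase \<theta> (of_nat l))) = 1"
proof -
  obtain k where k: "l + \<theta> = 2 * k" using assms evenE by blast
  have "phase \<theta> (of_nat l) = of_nat (l + \<theta>) * of_real (pi / 2)" by (simp add: phase_def)
  also have "\<dots> = of_real (real k * pi)" unfolding k by (simp add: algebra_simps)
  finally have w: "phase \<theta> (of_nat l) = of_real (real k * pi)" .
  show "sin (phase \<theta> (of_nat l)) = 0" unfolding w sin_of_real by simp
  show "cmod (cos (phase \<theta> (of_nat l))) = 1"
    unfolding w cos_of_real norm_of_real by (simp add: power_abs)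
qed

text \<open>
  At an integer \<open>l\<close>, one of \<open>sin\<close> and \<open>cos\<close> of the phase is \<open>0\<close> and the other \<open>\<plusminus>1\<close>, so the identity for \<open>solC\<close> determines one of
  the two polynomials up to the error of the asymptotics. The factor \<open>N\<close> balances \<open>P\<close> against \<open>R\<close>, whose forms have
  the sizes \<open>z\<close> and \<open>1\<close>.
\<close>

lemma init_poly_at_integer:
  assumes th: "\<theta> \<in> {0, 1}" and l: "1 \<le> N" "N \<le> l" and eq: "cmod (P * bc_der \<theta> (solC' \<theta> (of_nat l))
      + R * bc_val \<theta> (solC \<theta> (of_nat l))) \<le> T"
    and X: "real N * cmod P \<le> X" "cmod R \<le> X"
  shows "odd (l + \<theta>) \<Longrightarrow> real N * cmod P \<le> T + pert * X / real N"
    and "even (l + \<theta>) \<Longrightarrow> cmod R \<le> T + pert * X / real N"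
proof -
  define A where "A = bc_der \<theta> (solC' \<theta> (of_nat l))"
  define B where "B = bc_val \<theta> (solC \<theta> (of_nat l))"
  define s where "s = sin (phase \<theta> (of_nat l))"
  define c where "c = cos (phase \<theta> (of_nat l))"
  have l1: "1 \<le> cmod (of_nat l)" using l by simp
  have A: "cmod (A + 2 * of_nat l * s) \<le> pert" and B: "cmod (B - 2 * c) \<le> pert / real l"
    using solC_solS_boundary_forms(1,2)[OF th l1] by (simp_all add: A_def B_def s_def c_def)
  have N: "1 \<le> real N" "real N \<le> real l" using l by auto
  have P: "pert * cmod P \<le> pert * X / real N"
    using X(1) N pert_nonneg mult_left_mono[of "cmod P" "X / real N" pert]
    by (simp add: field_simps)
  have X0: "0 \<le> X" by (rule order_trans[OF norm_ge_zero X(2)])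
  have R: "pert / real l * cmod R \<le> pert * X / real N"
  proof -
    have "pert / real l * cmod R \<le> pert / real N * X"
      using N pert_nonneg X(2) by (intro mult_mono divide_left_mono) auto
    then show ?thesis by simp
  qed
  have main: "cmod (P * (2 * of_nat l * s) - R * (2 * c)) \<le> T + 2 * (pert * X / real N)"
  proof -
    have "P * (2 * of_nat l * s) - R * (2 * c)
      = P * (A + 2 * of_nat l * s) + R * (B - 2 * c) - (P * A + R * B)"
      by (simp add: algebra_simps)
    also have "cmod \<dots> \<le> cmod P * cmod (A + 2 * of_nat l * s) + cmod R * cmod (B - 2 * c)
        + cmod (P * A + R * B)"
      using norm_triangle_ineq4[of "P * (A + 2 * of_nat l * s) + R * (B - 2 * c)" "P * A + R * B"]
        norm_triangle_ineq[of "P * (A + 2 * of_nat l * s)" "R * (B - 2 * c)"]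
      unfolding norm_mult by linarith
    also have "\<dots> \<le> cmod P * pert + cmod R * (pert / real l) + T"
      using A B eq by (intro add_mono mult_left_mono) (auto simp: A_def B_def)
    finally show ?thesis using P R by (simp add: mult.commute)
  qed
  have D0: "0 \<le> pert * X / real N" using pert_nonneg X0 by simp
  have T0: "0 \<le> T" by (rule order_trans[OF norm_ge_zero eq])
  show "real N * cmod P \<le> T + pert * X / real N" if "odd (l + \<theta>)"
  proof -
    have "2 * (real N * cmod P) \<le> 2 * (real l * cmod P)"
      using N by (intro mult_left_mono mult_right_mono) auto
    also have "\<dots> = cmod (P * (2 * of_nat l * s) - R * (2 * c))"
      using trig_phase_odd[OF that] by (simp add: norm_mult s_def c_def)
    finally show ?thesis using main T0 by simp
  qed
  show "cmod R \<le> T + pert * X / real N" if "even (l + \<theta>)"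
  proof -
    have "2 * cmod R = cmod (P * (2 * of_nat l * s) - R * (2 * c))"
      using trig_phase_even[OF that] by (simp add: norm_mult s_def c_def)
    then show ?thesis using main T0 by simp
  qed
qed

text \<open>
  Let \<open>X\<close> be the largest of the balanced values of both polynomials at the \<open>2 m\<close> integers from \<open>N\<close> on. Half of these values
  are bounded directly, by \<open>T + O(X / N)\<close>. Interpolation bounds the other half by \<open>\<Lambda>\<close> times this, so
  \<open>X \<le> \<Lambda> T + X / 2\<close> by the hypothesis on \<open>N\<close>, and a second interpolation reaches the points \<open>z\<close>. No information on the
  lower functions of the chain enters.
\<close>

lemma init_poly_bound:
  fixes N m :: nat and \<mu> :: complex and M :: real
  assumes th: "\<theta> \<in> {0, 1}" and ch: "chain Q \<theta> (\<mu>\<^sup>2) m u p" and m: "1 \<le> m" and M: "0 \<le> M"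
    and N: "cmod (\<mu> - of_nat N) \<le> M + 1" "2 * m + M + 1 \<le> real N"
      "2 * (24 * (M + 4)) ^ m * pert \<le> real N"
  defines "\<Lambda> \<equiv> (24 * (M + 4)) ^ m"
    and "T \<equiv> ((M + 3) * m * (4 * N)) ^ m * ((1 + pert) * integral {0..pi} (\<lambda>x. cmod (u (m - 1) x)))"
  assumes z: "cmod (z - \<mu>) \<le> m"
  shows "real N * cmod (poly (init_poly m u) (z\<^sup>2 - \<mu>\<^sup>2)) \<le> 2 * \<Lambda>\<^sup>2 * T"
    and "cmod (poly (init_poly m p) (z\<^sup>2 - \<mu>\<^sup>2)) \<le> 2 * \<Lambda>\<^sup>2 * T"
proof -
  define P where "P l = poly (init_poly m u) ((of_nat l)\<^sup>2 - \<mu>\<^sup>2)" for l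
  define R where "R l = poly (init_poly m p) ((of_nat l)\<^sup>2 - \<mu>\<^sup>2)" for l
  define J where "J = {N..<N + 2 * m}"
  have J: "finite J" "J \<noteq> {}" using m by (auto simp: J_def)
  have m1: "1 \<le> real m" using m by simp
  have N1: "1 \<le> N" "1 \<le> real N" "real m \<le> real N" using N(2) M m1 by linarith+
  have dist: "cmod (of_nat l - \<mu>) \<le> (M + 3) * m" "cmod (of_nat l + \<mu>) \<le> 4 * real N"
    if l: "l \<in> J" for l
  proof -
    have ln: "cmod (of_nat l - of_nat N :: complex) \<le> 2 * m"
    proof -
      have "(of_nat l - of_nat N :: complex) = of_nat (l - N)" using l by (simp add: J_def of_nat_diff)
      also have "cmod \<dots> = real (l - N)" by (rule norm_of_nat)
      also have "\<dots> \<le> 2 * m" using l by (simp add: J_def)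
      finally show ?thesis .
    qed
    have "cmod (of_nat l - \<mu>) \<le> cmod (of_nat l - of_nat N :: complex) + cmod (\<mu> - of_nat N)"
      using norm_triangle_ineq4[of "of_nat l - of_nat N" "\<mu> - of_nat N"] by simp
    also have "\<dots> \<le> 2 * m + (M + 1)" using ln N(1) by linarith
    also have "\<dots> \<le> 2 * m + (M + 1) * m" using M m1 by simp
    finally show "cmod (of_nat l - \<mu>) \<le> (M + 3) * m" by (simp add: algebra_simps)
    have "cmod (of_nat l + \<mu>) \<le> cmod (of_nat l) + (cmod (of_nat N) + cmod (\<mu> - of_nat N))"
      using norm_triangle_ineq[of "of_nat l" \<mu>] norm_triangle_sub[of \<mu> "of_nat N"] by linarith
    also have "\<dots> \<le> (real N + 2 * m) + (real N + (M + 1))" using l N(1) by (simp add: J_def)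
    finally show "cmod (of_nat l + \<mu>) \<le> 4 * real N" using N(2) m1 by linarith
  qed
  have lowP: "degree (init_poly m u) < m" "degree (init_poly m p) < m"
    using m by (auto intro: degree_init_poly)
  have uc: "continuous_on {0..pi} (u (m - 1))"
  proof -
    have "m - 1 < m" using m by simp
    then show ?thesis using ch ode_sol_continuous(1) unfolding chain_def by blast
  qed
  have eq: "cmod (P l * bc_der \<theta> (solC' \<theta> (of_nat l)) + R l * bc_val \<theta> (solC \<theta> (of_nat l))) \<le> T"
    if l: "l \<in> J" for l
  proof -
    have l1: "1 \<le> cmod (of_nat l)" using l N1 by (simp add: J_def)
    have "cmod (integral {0..pi} (\<lambda>x. u (m - 1) x * solC \<theta> (of_nat l) x))
      \<le> integral {0..pi} (\<lambda>x. (1 + pert) * cmod (u (m - 1) x))"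
    proof (rule integral_norm_bound_integral)
      show "(\<lambda>x. u (m - 1) x * solC \<theta> (of_nat l) x) integrable_on {0..pi}"
        by (intro integrable_continuous_real continuous_on_mult uc ode_sol_continuous(1)[OF solC_ode])
      show "(\<lambda>x. (1 + pert) * cmod (u (m - 1) x)) integrable_on {0..pi}"
        by (intro integrable_continuous_real continuous_on_mult continuous_on_const continuous_on_norm uc)
      fix x :: real assume "x \<in> {0..pi}"
      then have "cmod (solC \<theta> (of_nat l) x) \<le> 1 + pert" using solC_solS_bounds(1)[OF l1, of x \<theta>] by simp
      then show "cmod (u (m - 1) x * solC \<theta> (of_nat l) x) \<le> (1 + pert) * cmod (u (m - 1) x)"
        unfolding norm_mult by (subst mult.commute) (intro mult_right_mono norm_ge_zero)
    qed
    then have G: "cmod (integral {0..pi} (\<lambda>x. u (m - 1) x * solC \<theta> (of_nat l) x))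
      \<le> (1 + pert) * integral {0..pi} (\<lambda>x. cmod (u (m - 1) x))" by simp
    have "cmod (((of_nat l)\<^sup>2 - \<mu>\<^sup>2) ^ m) = (cmod (of_nat l - \<mu>) * cmod (of_nat l + \<mu>)) ^ m"
      by (simp add: norm_power algebra_simps power2_eq_square flip: norm_mult)
    also have "\<dots> \<le> ((M + 3) * m * (4 * N)) ^ m"
      using dist[OF l] M by (intro power_mono mult_mono) auto
    finally have "cmod (((of_nat l)\<^sup>2 - \<mu>\<^sup>2) ^ m)
      * cmod (integral {0..pi} (\<lambda>x. u (m - 1) x * solC \<theta> (of_nat l) x)) \<le> T"
      unfolding T_def using G M by (intro mult_mono) auto
    moreover have "- (((of_nat l)\<^sup>2 - \<mu>\<^sup>2) ^ m) * integral {0..pi} (\<lambda>x. u (m - 1) x * solC \<theta> (of_nat l) x)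
        = P l * bc_der \<theta> (solC' \<theta> (of_nat l)) + R l * bc_val \<theta> (solC \<theta> (of_nat l))"
      unfolding P_def R_def using m by (intro chain_identity[OF ch _ solC_ode]) simp
    ultimately show ?thesis by (metis norm_minus_cancel norm_mult)
  qed
  define X where "X = Max ((\<lambda>l. max (real N * cmod (P l)) (cmod (R l))) ` J)"
  have X: "real N * cmod (P l) \<le> X" "cmod (R l) \<le> X" if "l \<in> J" for l
  proof -
    have "max (real N * cmod (P l)) (cmod (R l)) \<le> X"
      unfolding X_def using J that by (intro Max_ge) auto
    then show "real N * cmod (P l) \<le> X" "cmod (R l) \<le> X" by auto
  qed
  have X0: "0 \<le> X"
    using X(2)[of N] order_trans[OF norm_ge_zero] m by (fastforce simp: J_def)
  define T' where "T' = T + pert * X / real N"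
  have est: "odd (l + \<theta>) \<Longrightarrow> real N * cmod (P l) \<le> T'" "even (l + \<theta>) \<Longrightarrow> cmod (R l) \<le> T'"
    if l: "l \<in> J" for l
    unfolding T'_def
    using init_poly_at_integer[OF th N1(1) _ eq[OF l] X[OF l]] l by (auto simp: J_def)
  \<comment> \<open>The nodes for \<open>P\<close> start at \<open>a\<close>, those for \<open>R\<close> at \<open>b\<close>; both have step \<open>2\<close>.\<close>
  define a where "a = (if odd (N + \<theta>) then N else N + 1)"
  define b where "b = (if odd (N + \<theta>) then N + 1 else N)"
  have ab: "a \<in> {N, N + 1}" "b \<in> {N, N + 1}" "\<And>k. odd (a + 2 * k + \<theta>)" "\<And>k. even (b + 2 * k + \<theta>)"
    by (auto simp: a_def b_def)
  have inJ: "c + 2 * k \<in> J" if "c \<in> {N, N + 1}" "k < m" for c k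
    using that by (auto simp: J_def)
  have extP: "real N * cmod (poly (init_poly m u) (t\<^sup>2 - \<mu>\<^sup>2)) \<le> \<Lambda> * B"
    if t: "\<And>l. l \<in> J \<Longrightarrow> cmod (t - of_nat l) \<le> (M + 4) * m" "\<And>l. l \<in> J \<Longrightarrow> cmod (t + of_nat l) \<le> 8 * real N"
      and B: "\<And>k. k < m \<Longrightarrow> real N * cmod (P (a + 2 * k)) \<le> B" for t B
  proof -
    have aN: "real N \<le> real a" using ab by auto
    have "cmod (poly (init_poly m u) (t\<^sup>2 - \<mu>\<^sup>2)) \<le> (24 * (M + 4)) ^ m * (B / real N)"
    proof (rule interpolation_bound[OF lowP(1), where N = "real a"])
      fix k assume k: "k < m"
      note j = inJ[OF ab(1) k]
      have c: "complex_of_real (real a + 2 * real k) = of_nat (a + 2 * k)" by simp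
      show "cmod (poly (init_poly m u) ((complex_of_real (real a + 2 * real k))\<^sup>2 - \<mu>\<^sup>2)) \<le> B / real N"
        unfolding c using B[OF k] N1 by (simp add: P_def field_simps)
      show "cmod (t - complex_of_real (real a + 2 * real k)) \<le> (M + 4) * m"
        unfolding c by (rule t(1)[OF j])
      show "cmod (t + complex_of_real (real a + 2 * real k)) \<le> 8 * real a"
        unfolding c using t(2)[OF j] aN by linarith
    qed (use aN N1 M in auto)
    then show ?thesis using N1 unfolding \<Lambda>_def by (simp add: field_simps)
  qed
  have extR: "cmod (poly (init_poly m p) (t\<^sup>2 - \<mu>\<^sup>2)) \<le> \<Lambda> * B"
    if t: "\<And>l. l \<in> J \<Longrightarrow> cmod (t - of_nat l) \<le> (M + 4) * m" "\<And>l. l \<in> J \<Longrightarrow> cmod (t + of_nat l) \<le> 8 * real N"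
      and B: "\<And>k. k < m \<Longrightarrow> cmod (R (b + 2 * k)) \<le> B" for t B
  proof -
    have bN: "real N \<le> real b" using ab by auto
    show ?thesis unfolding \<Lambda>_def
    proof (rule interpolation_bound[OF lowP(2), where N = "real b"])
      fix k assume k: "k < m"
      note j = inJ[OF ab(2) k]
      have c: "complex_of_real (real b + 2 * real k) = of_nat (b + 2 * k)" by simp
      show "cmod (poly (init_poly m p) ((complex_of_real (real b + 2 * real k))\<^sup>2 - \<mu>\<^sup>2)) \<le> B"
        unfolding c using B[OF k] by (simp add: R_def)
      show "cmod (t - complex_of_real (real b + 2 * real k)) \<le> (M + 4) * m"
        unfolding c by (rule t(1)[OF j])
      show "cmod (t + complex_of_real (real b + 2 * real k)) \<le> 8 * real b"
        unfolding c using t(2)[OF j] bN by linarith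
    qed (use bN N1 M in auto)
  qed
  have JJ: "cmod (of_nat i - of_nat l :: complex) \<le> (M + 4) * m"
    "cmod (of_nat i + of_nat l :: complex) \<le> 8 * real N" if "i \<in> J" "l \<in> J" for i l
  proof -
    have "cmod (of_nat i - of_nat l :: complex) = \<bar>real i - real l\<bar>"
      by (metis norm_of_real of_real_diff of_real_of_nat_eq)
    also have "\<dots> \<le> 2 * m" using that by (auto simp: J_def)
    also have "\<dots> \<le> (M + 4) * m" using M mult_right_mono[of 2 "M + 4" "real m"] by simp
    finally show "cmod (of_nat i - of_nat l :: complex) \<le> (M + 4) * m" .
    have "cmod (of_nat i + of_nat l :: complex) = real (i + l)"
      by (metis norm_of_nat of_nat_add)
    also have "\<dots> \<le> 8 * real N" using that N(2) M by (auto simp: J_def)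
    finally show "cmod (of_nat i + of_nat l :: complex) \<le> 8 * real N" .
  qed
  have "X \<le> \<Lambda> * T'"
    unfolding X_def
  proof (rule Max.boundedI)
    fix v assume "v \<in> (\<lambda>l. max (real N * cmod (P l)) (cmod (R l))) ` J"
    then obtain l where l: "l \<in> J" "v = max (real N * cmod (P l)) (cmod (R l))" by blast
    have "real N * cmod (P l) \<le> \<Lambda> * T'"
      unfolding P_def using est(1)[OF inJ[OF ab(1)] ab(3)] by (intro extP JJ l(1)) auto
    moreover have "cmod (R l) \<le> \<Lambda> * T'"
      unfolding R_def using est(2)[OF inJ[OF ab(2)] ab(4)] by (intro extR JJ l(1)) auto
    ultimately show "v \<le> \<Lambda> * T'" using l(2) by simp
  qed (use J in auto)
  moreover have "\<Lambda> * (pert * X / real N) \<le> X / 2"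
  proof -
    have "2 * \<Lambda> * pert * X \<le> real N * X"
      using N(3) X0 unfolding \<Lambda>_def by (intro mult_right_mono) auto
    then show ?thesis using N1 by (simp add: field_simps)
  qed
  moreover have "\<Lambda> * T' = \<Lambda> * T + \<Lambda> * (pert * X / real N)"
    unfolding T'_def by (rule distrib_left)
  ultimately have XT: "X \<le> 2 * \<Lambda> * T" by linarith
  have L0: "0 \<le> \<Lambda>" using M by (simp add: \<Lambda>_def)
  have zJ: "cmod (z - of_nat l) \<le> (M + 4) * m" "cmod (z + of_nat l) \<le> 8 * real N" if l: "l \<in> J" for l
  proof -
    show "cmod (z - of_nat l) \<le> (M + 4) * m"
      using norm_triangle_ineq4[of "z - \<mu>" "of_nat l - \<mu>"] z dist(1)[OF l] by (simp add: algebra_simps)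
    show "cmod (z + of_nat l) \<le> 8 * real N"
      using norm_triangle_ineq[of "z - \<mu>" "of_nat l + \<mu>"] z dist(2)[OF l] N1 by (simp add: algebra_simps)
  qed
  have LX: "\<Lambda> * X \<le> 2 * \<Lambda>\<^sup>2 * T"
    using mult_left_mono[OF XT L0] by (simp add: power2_eq_square mult_ac)
  show "real N * cmod (poly (init_poly m u) (z\<^sup>2 - \<mu>\<^sup>2)) \<le> 2 * \<Lambda>\<^sup>2 * T"
    by (rule order_trans[OF extP[OF zJ X(1)[OF inJ[OF ab(1)]]] LX])
  show "cmod (poly (init_poly m p) (z\<^sup>2 - \<mu>\<^sup>2)) \<le> 2 * \<Lambda>\<^sup>2 * T"
    by (rule order_trans[OF extR[OF zJ X(2)[OF inJ[OF ab(2)]]] LX])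
qed

end

section \<open>The pairing of a chain with the adjoint eigenfunction\<close>

context potential
begin

text \<open>
  The fundamental system depends on \<open>z\<close> only through \<open>z\<^sup>2\<close>. The square root turns it into a family indexed by the spectral
  parameter, to which \<open>ode_sol_holomorphic\<close> applies.
\<close>

lemma sol_csqrt [simp]:
  "sol_c Q (csqrt (z\<^sup>2)) = sol_c Q z" "sol_s Q (csqrt (z\<^sup>2)) = sol_s Q z"
  by (simp_all add: sol_c_def sol_s_def)

lemma sol_c_csqrt_ode:
  "ode_sol (\<lambda>x. Q x - n) (sol_c Q (csqrt n)) (ddx (sol_c Q (csqrt n))) (\<lambda>x. 0)"
  "ode_sol (\<lambda>x. Q x - n) (sol_s Q (csqrt n)) (ddx (sol_s Q (csqrt n))) (\<lambda>x. 0)"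
  using sol_c_props(1)[of "csqrt n"] sol_s_props(1)[of "csqrt n"] by simp_all

lemmas sol_c_hol = ode_sol_holomorphic[OF sol_c_csqrt_ode(1) sol_c_props(2,3)]
lemmas sol_s_hol = ode_sol_holomorphic[OF sol_c_csqrt_ode(2) sol_s_props(2,3)]

lemma holomorphic_square:
  assumes "f holomorphic_on UNIV"
  shows "(\<lambda>z::complex. f (z\<^sup>2)) holomorphic_on UNIV"
proof -
  have "(f \<circ> (\<lambda>z. z\<^sup>2)) holomorphic_on UNIV"
    by (rule holomorphic_on_compose_gen[OF _ assms]) (auto intro!: holomorphic_intros)
  then show ?thesis by (simp add: o_def)
qed

lemma char_det_holomorphic: "char_det Q holomorphic_on UNIV"
proof -
  have "(\<lambda>z. sol_c Q (csqrt (z\<^sup>2)) pi - ddx (sol_s Q (csqrt (z\<^sup>2))) pi) holomorphic_on UNIV"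
    by (intro holomorphic_on_diff holomorphic_square[OF sol_c_hol(1)] holomorphic_square[OF sol_s_hol(2)]) auto
  then show ?thesis by (simp add: char_det_def[abs_def])
qed

lemma pairing_holomorphic:
  assumes g: "continuous_on {0..pi} g" and ab: "a holomorphic_on UNIV" "b holomorphic_on UNIV"
  shows "(\<lambda>z. integral {0..pi} (\<lambda>x. g x * cs_sol z (a z) (b z) x)) holomorphic_on UNIV"
proof -
  have "(\<lambda>z. a z * integral {0..pi} (\<lambda>x. g x * sol_c Q (csqrt (z\<^sup>2)) x)
      + b z * integral {0..pi} (\<lambda>x. g x * sol_s Q (csqrt (z\<^sup>2)) x)) holomorphic_on UNIV"
    by (intro holomorphic_on_add holomorphic_on_mult ab holomorphic_square[OF sol_c_hol(3)[OF g]]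
        holomorphic_square[OF sol_s_hol(3)[OF g]])
  moreover have "integral {0..pi} (\<lambda>x. g x * cs_sol z (a z) (b z) x)
    = a z * integral {0..pi} (\<lambda>x. g x * sol_c Q (csqrt (z\<^sup>2)) x)
      + b z * integral {0..pi} (\<lambda>x. g x * sol_s Q (csqrt (z\<^sup>2)) x)" for z
  proof -
    have "((\<lambda>x. a z * (g x * sol_c Q z x) + b z * (g x * sol_s Q z x)) has_integral
      a z * integral {0..pi} (\<lambda>x. g x * sol_c Q z x) + b z * integral {0..pi} (\<lambda>x. g x * sol_s Q z x)) {0..pi}"
      by (intro has_integral_add has_integral_mult_right integrable_integral
          integrable_continuous_real continuous_on_mult g
          ode_sol_continuous(1)[OF sol_c_props(1)] ode_sol_continuous(1)[OF sol_s_props(1)])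
    moreover have "a z * (g x * sol_c Q z x) + b z * (g x * sol_s Q z x) = g x * cs_sol z (a z) (b z) x" for x
      by (simp add: cs_sol_def algebra_simps)
    ultimately show ?thesis by (simp add: integral_unique)
  qed
  ultimately show ?thesis by simp
qed

text \<open>
  The candidates for the adjoint eigenfunction. The coefficient \<open>\<kappa>\<close> will be chosen at one point and kept while \<open>z\<close> varies, so
  that pairings are holomorphic in \<open>z\<close>.
\<close>

definition solA :: "nat \<Rightarrow> complex \<Rightarrow> complex \<Rightarrow> real \<Rightarrow> complex"
  where "solA \<theta> \<kappa> z x = solS \<theta> z x + \<kappa> * solC \<theta> z x"
definition solA' :: "nat \<Rightarrow> complex \<Rightarrow> complex \<Rightarrow> real \<Rightarrow> complex"
  where "solA' \<theta> \<kappa> z x = solS' \<theta> z x + \<kappa> * solC' \<theta> z x"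

lemma solA_ode: "ode_sol (\<lambda>x. Q x - z\<^sup>2) (solA \<theta> \<kappa> z) (solA' \<theta> \<kappa> z) (\<lambda>x. 0)"
  using ode_sol_lincomb[OF solS_ode[of z \<theta>] solC_ode[of z \<theta>], of 1 \<kappa>]
  by (simp add: solA_def[abs_def] solA'_def[abs_def])

lemma solA_pairing_holomorphic:
  assumes g: "continuous_on {0..pi} g"
  shows "(\<lambda>z. integral {0..pi} (\<lambda>x. g x * solA \<theta> \<kappa> z x)) holomorphic_on UNIV"
proof -
  define a where "a z = - sin (phase \<theta> z) + \<kappa> * cos (phase \<theta> z)" for z
  define b where "b z = z * cos (phase \<theta> z) + \<kappa> * (z * sin (phase \<theta> z))" for z
  have "solA \<theta> \<kappa> z = cs_sol z (a z) (b z)" for z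
    unfolding solA_def[abs_def] solS_def solC_def cs_sol_def[abs_def] a_def b_def
    by (simp add: algebra_simps fun_eq_iff)
  moreover have "a holomorphic_on UNIV" "b holomorphic_on UNIV"
    unfolding a_def[abs_def] b_def[abs_def] phase_def by (auto intro!: holomorphic_intros)
  ultimately show ?thesis using pairing_holomorphic[OF g] by simp
qed

text \<open>
  The main terms of the forms of \<open>solC\<close> are multiplied by \<open>\<kappa> = O(1/\<mu>)\<close> and so become as small as the errors for \<open>solS\<close>.
\<close>

lemma solA_boundary_forms:
  assumes th: "\<theta> \<in> {0, 1}" and z: "1 \<le> cmod z" "cmod \<mu> \<le> 2 * cmod z" "cmod z \<le> 2 * cmod \<mu>"
    "1 \<le> cmod \<mu>" and k: "cmod \<kappa> \<le> D' / cmod \<mu>" and D': "0 \<le> D'"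
  defines "E \<equiv> exp (2 * pi * \<bar>Im z\<bar>)"
  shows "cmod (bc_der \<theta> (solA' \<theta> \<kappa> z)) \<le> (pert + D' * (4 + pert)) * E"
    and "cmod (bc_val \<theta> (solA \<theta> \<kappa> z)) \<le> (2 * pert + D' * (2 + pert)) * E / cmod \<mu>"
proof -
  note bf = solC_solS_boundary_forms[OF th z(1), folded E_def]
  have mu: "0 < cmod \<mu>" "\<mu> \<noteq> 0" using z(4) by auto
  have z0: "0 < cmod z" using z(1) by linarith
  have E0: "0 < E" by (simp add: E_def)
  have "\<bar>Im (phase \<theta> z)\<bar> = \<bar>Im z\<bar> * (pi / 2)" by (simp add: phase_def abs_mult)
  also have "\<dots> \<le> 2 * pi * \<bar>Im z\<bar>" by simp
  finally have "exp \<bar>Im (phase \<theta> z)\<bar> \<le> E" by (simp add: E_def)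
  then have t: "cmod (cos (phase \<theta> z)) \<le> E" "cmod (sin (phase \<theta> z)) \<le> E"
    using norm_cos_sin_le_exp[of "phase \<theta> z"] by auto
  have "cmod (bc_der \<theta> (solC' \<theta> z)) \<le> cmod (2 * z * sin (phase \<theta> z)) + pert * E"
    using norm_triangle_ineq4[of "bc_der \<theta> (solC' \<theta> z) + 2 * z * sin (phase \<theta> z)" "2 * z * sin (phase \<theta> z)"] bf(1)
    by simp
  also have "cmod (2 * z * sin (phase \<theta> z)) \<le> (4 * cmod \<mu>) * E"
    unfolding norm_mult by (rule mult_mono) (use t z(3) in auto)
  also have "pert * E \<le> cmod \<mu> * (pert * E)"
    using z(4) pert_nonneg E0 mult_right_mono[of 1 "cmod \<mu>" "pert * E"] by simp
  finally have A: "cmod (bc_der \<theta> (solC' \<theta> z)) \<le> cmod \<mu> * ((4 + pert) * E)"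
    by (simp add: algebra_simps)
  have kA: "cmod (\<kappa> * bc_der \<theta> (solC' \<theta> z)) \<le> D' / cmod \<mu> * (cmod \<mu> * ((4 + pert) * E))"
    unfolding norm_mult using k A D' by (intro mult_mono) auto
  have "cmod (bc_der \<theta> (solA' \<theta> \<kappa> z)) = cmod (bc_der \<theta> (solS' \<theta> z) + \<kappa> * bc_der \<theta> (solC' \<theta> z))"
    by (simp add: bc_der_def solA'_def algebra_simps)
  also have "\<dots> \<le> pert * E + D' / cmod \<mu> * (cmod \<mu> * ((4 + pert) * E))"
    using norm_triangle_ineq[of "bc_der \<theta> (solS' \<theta> z)" "\<kappa> * bc_der \<theta> (solC' \<theta> z)"] bf(3) kA by linarith
  also have "\<dots> = (pert + D' * (4 + pert)) * E" using mu by (simp add: algebra_simps)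
  finally show "cmod (bc_der \<theta> (solA' \<theta> \<kappa> z)) \<le> (pert + D' * (4 + pert)) * E" .
  have Ez: "pert * E / cmod z \<le> 2 * pert * E / cmod \<mu>"
  proof -
    have "pert * E / cmod z \<le> pert * E / (cmod \<mu> / 2)"
      using z mu z0 pert_nonneg E0 by (intro divide_left_mono mult_pos_pos) auto
    then show ?thesis by (simp add: mult_ac)
  qed
  have "cmod (bc_val \<theta> (solC \<theta> z)) \<le> cmod (2 * cos (phase \<theta> z)) + pert * E / cmod z"
    using norm_triangle_sub[of "bc_val \<theta> (solC \<theta> z)" "2 * cos (phase \<theta> z)"] bf(2) by linarith
  also have "pert * E / cmod z \<le> pert * E / 1"
    using z z0 pert_nonneg E0 by (intro divide_left_mono mult_pos_pos) auto
  finally have B: "cmod (bc_val \<theta> (solC \<theta> z)) \<le> (2 + pert) * E"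
    using t(1) by (simp add: norm_mult algebra_simps)
  have kB: "cmod (\<kappa> * bc_val \<theta> (solC \<theta> z)) \<le> D' / cmod \<mu> * ((2 + pert) * E)"
    unfolding norm_mult using k B D' by (intro mult_mono) auto
  have "cmod (bc_val \<theta> (solA \<theta> \<kappa> z)) = cmod (bc_val \<theta> (solS \<theta> z) + \<kappa> * bc_val \<theta> (solC \<theta> z))"
    by (simp add: bc_val_def solA_def algebra_simps)
  also have "\<dots> \<le> 2 * pert * E / cmod \<mu> + D' / cmod \<mu> * ((2 + pert) * E)"
    using norm_triangle_ineq[of "bc_val \<theta> (solS \<theta> z)" "\<kappa> * bc_val \<theta> (solC \<theta> z)"] bf(4) kB Ez by linarith
  also have "\<dots> = (2 * pert + D' * (2 + pert)) * E / cmod \<mu>"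
    by (simp add: add_divide_distrib algebra_simps)
  finally show "cmod (bc_val \<theta> (solA \<theta> \<kappa> z)) \<le> (2 * pert + D' * (2 + pert)) * E / cmod \<mu>" .
qed

definition circle_const :: "real \<Rightarrow> real"
  where "circle_const D' = (pert + D' * (4 + pert)) + 2 * (2 * pert + D' * (2 + pert))"

text \<open>
  Collects the factors of the estimate below: two interpolations, the quotient of the distances \<open>(M + 3) m * 4 N\<close> and
  \<open>m N / 2\<close> in the two uses of the identity, the size of \<open>solC\<close>, the boundary forms on the circle, and the growth of
  solutions there.
\<close>

definition chain_const :: "real \<Rightarrow> real \<Rightarrow> real"
  where "chain_const M D' = 4 * (24 * (M + 4))\<^sup>2 * (8 * (M + 3)) * (1 + pert) * (1 + circle_const D') * exp (2 * pi * (M + 1))"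

text \<open>
  On the circle \<open>|z - \<mu>| = m\<close> the identity for chains expresses the pairing \<open>F z\<close> by the polynomials of initial values,
  bounded by \<open>init_poly_bound\<close>, and by boundary forms that are smaller by \<open>1/\<mu>\<close> than those used to bound these polynomials. The
  division by \<open>(z\<^sup>2 - \<mu>\<^sup>2)\<^sup>m\<close> cancels the factor \<open>(m N)\<^sup>m\<close> of that bound up to an exponential in \<open>m\<close>, and the maximum
  principle carries the result to the centre.
\<close>

lemma chain_top_pairing_estimate:
  fixes \<mu> \<kappa> :: complex and m :: nat and M D' :: real
  assumes th: "\<theta> \<in> {0, 1}" and ch: "chain Q \<theta> (\<mu>\<^sup>2) m u p" and m: "1 \<le> m" and M: "0 \<le> M"
    and mu: "\<bar>Im \<mu>\<bar> \<le> M" "0 \<le> Re \<mu>"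
      "2 * m + 2 * M + 2 + 2 * (24 * (M + 4)) ^ m * pert \<le> cmod \<mu>"
    and k: "cmod \<kappa> \<le> D' / cmod \<mu>" and D': "0 \<le> D'"
  shows "cmod (integral {0..pi} (\<lambda>x. u (m - 1) x * solA \<theta> \<kappa> \<mu> x))
    \<le> chain_const M D' ^ m / cmod \<mu> * integral {0..pi} (\<lambda>x. cmod (u (m - 1) x))"
proof -
  define U where "U = integral {0..pi} (\<lambda>x. cmod (u (m - 1) x))"
  define \<Lambda> where "\<Lambda> = (24 * (M + 4)) ^ m"
  \<comment> \<open>the first of the integers used as nodes\<close>
  define N where "N = nat \<lceil>Re \<mu>\<rceil>"
  define S where "S = 2 * \<Lambda>\<^sup>2 * (((M + 3) * m * (4 * N)) ^ m * ((1 + pert) * U))"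
  define E1 where "E1 = exp (2 * pi * (M + 1))"
  have m1: "1 \<le> real m" using m by simp
  have uc: "continuous_on {0..pi} (u (m - 1))"
  proof -
    have "m - 1 < m" using m by simp
    then show ?thesis using ch ode_sol_continuous(1) unfolding chain_def by blast
  qed
  have U0: "0 \<le> U" unfolding U_def
    by (rule integral_nonneg[OF integrable_continuous_real[OF continuous_on_norm[OF uc]]]) simp
  have L0: "0 \<le> \<Lambda>" using M by (simp add: \<Lambda>_def)
  have LD: "0 \<le> 2 * \<Lambda> * pert" using L0 pert_nonneg by simp
  have big: "2 * m + 2 * M + 2 + 2 * \<Lambda> * pert \<le> cmod \<mu>" using mu(3) by (simp add: \<Lambda>_def)
  have N: "Re \<mu> \<le> real N" "real N \<le> Re \<mu> + 1"
    unfolding N_def using mu(2) by (auto simp: of_nat_nat)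
  have mu_le: "cmod \<mu> \<le> Re \<mu> + M" using cmod_le[of \<mu>] mu by simp
  have Re_le: "Re \<mu> \<le> cmod \<mu>" by (rule complex_Re_le_cmod)
  have N1: "cmod (\<mu> - of_nat N) \<le> M + 1"
    using cmod_le[of "\<mu> - of_nat N"] N mu by simp
  have N2: "2 * m + M + 1 \<le> real N" using N mu_le big LD by linarith
  have N3: "2 * (24 * (M + 4)) ^ m * pert \<le> real N"
    using N mu_le big M unfolding \<Lambda>_def[symmetric] by linarith
  have mu1: "2 \<le> cmod \<mu>" "2 * real m \<le> cmod \<mu>" using big LD M m1 by linarith+
  have Npos: "0 < real N" using N2 M by linarith
  have NM: "real N \<le> 2 * cmod \<mu>" "cmod \<mu> \<le> 2 * real N" using N Re_le mu_le mu1 N2 M by linarith+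
  have S0: "0 \<le> S" unfolding S_def using U0 pert_nonneg M by (intro mult_nonneg_nonneg) auto
  have C0: "0 \<le> circle_const D'" unfolding circle_const_def using pert_nonneg D' by simp
  define F where "F z = integral {0..pi} (\<lambda>x. u (m - 1) x * solA \<theta> \<kappa> z x)" for z
  define K where "K = S * (circle_const D' * E1 ^ m / N) / (m * N / 2) ^ m"
  have frontier: "cmod (F z) \<le> K" if z: "cmod (z - \<mu>) = m" for z
  proof -
    define E where "E = exp (2 * pi * \<bar>Im z\<bar>)"
    have zmu: "cmod \<mu> \<le> cmod z + m" "cmod z \<le> cmod \<mu> + m"
      using norm_triangle_sub[of \<mu> z] norm_triangle_sub[of z \<mu>] z by (auto simp: norm_minus_commute)
    have z1: "1 \<le> cmod z" "cmod \<mu> \<le> 2 * cmod z" "cmod z \<le> 2 * cmod \<mu>"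
      using zmu mu1 by linarith+
    have "\<bar>Im z\<bar> \<le> M + m"
      using abs_Im_le_cmod[of "z - \<mu>"] z mu(1) by simp
    also have "\<dots> \<le> m * (M + 1)" using M m1 mult_right_mono[of 1 "real m" M] by (simp add: algebra_simps)
    finally have "2 * pi * \<bar>Im z\<bar> \<le> m * (2 * pi * (M + 1))"
      using mult_left_mono[of "\<bar>Im z\<bar>" "m * (M + 1)" "2 * pi"] by (simp add: mult_ac)
    then have EE: "E \<le> E1 ^ m" unfolding E_def E1_def exp_of_nat_mult[symmetric] by simp
    have E0: "0 < E" by (simp add: E_def)
    define a where "a = pert + D' * (4 + pert)"
    define b where "b = 2 * pert + D' * (2 + pert)"
    have ab: "0 \<le> a" "0 \<le> b" using pert_nonneg D' by (auto simp: a_def b_def)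
    have A: "cmod (bc_der \<theta> (solA' \<theta> \<kappa> z)) \<le> a * E" and B: "cmod (bc_val \<theta> (solA \<theta> \<kappa> z)) \<le> b * E / cmod \<mu>"
      unfolding a_def b_def E_def
      using solA_boundary_forms[OF th z1 _ k D'] mu1 by auto
    have "b * E / cmod \<mu> \<le> b * E / (N / 2)"
      using ab E0 NM Npos mu1 by (intro divide_left_mono mult_pos_pos) auto
    then have B': "cmod (bc_val \<theta> (solA \<theta> \<kappa> z)) \<le> 2 * b * E / N" using B by (simp add: mult_ac)
    define P where "P = poly (init_poly m u) (z\<^sup>2 - \<mu>\<^sup>2)"
    define R where "R = poly (init_poly m p) (z\<^sup>2 - \<mu>\<^sup>2)"
    have zm: "cmod (z - \<mu>) \<le> m" using z by simp
    note tb = init_poly_bound[OF th ch m M N1 N2 N3 zm]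
    have P: "cmod P \<le> S / N" and R: "cmod R \<le> S"
      using tb Npos unfolding P_def R_def S_def \<Lambda>_def U_def by (auto simp: field_simps)
    have "- ((z\<^sup>2 - \<mu>\<^sup>2) ^ m) * F z = P * bc_der \<theta> (solA' \<theta> \<kappa> z) + R * bc_val \<theta> (solA \<theta> \<kappa> z)"
      unfolding P_def R_def F_def using m by (intro chain_identity[OF ch _ solA_ode]) simp
    then have "cmod ((z\<^sup>2 - \<mu>\<^sup>2) ^ m) * cmod (F z) = cmod (P * bc_der \<theta> (solA' \<theta> \<kappa> z) + R * bc_val \<theta> (solA \<theta> \<kappa> z))"
      by (metis norm_minus_cancel norm_mult)
    also have "\<dots> \<le> S / N * (a * E) + S * (2 * b * E / N)"
      by (intro norm_triangle_le add_mono order_trans[OF norm_mult_ineq] mult_mono P R A B' S0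
          divide_nonneg_nonneg) auto
    also have "\<dots> = S * (circle_const D' * E / N)" 
      by (simp add: circle_const_def a_def b_def add_divide_distrib algebra_simps)
    also have "\<dots> \<le> S * (circle_const D' * E1 ^ m / N)"
      using S0 C0 EE Npos by (intro mult_left_mono divide_right_mono) auto
    finally have up: "cmod ((z\<^sup>2 - \<mu>\<^sup>2) ^ m) * cmod (F z) \<le> S * (circle_const D' * E1 ^ m / N)" .
    have "cmod \<mu> \<le> cmod (z + \<mu>)"
    proof -
      have "2 * cmod \<mu> = cmod (2 * \<mu>)" by (simp add: norm_mult)
      also have "\<dots> \<le> cmod (z + \<mu>) + cmod (z - \<mu>)"
        using norm_triangle_ineq4[of "z + \<mu>" "z - \<mu>"] by simp
      finally show ?thesis using z mu1 by linarith
    qed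
    then have "N / 2 \<le> cmod (z + \<mu>)" using NM by linarith
    moreover have "cmod ((z\<^sup>2 - \<mu>\<^sup>2) ^ m) = (m * cmod (z + \<mu>)) ^ m"
    proof -
      have "z\<^sup>2 - \<mu>\<^sup>2 = (z - \<mu>) * (z + \<mu>)" by (simp add: algebra_simps power2_eq_square)
      then show ?thesis using z by (simp add: norm_power norm_mult)
    qed
    ultimately have low: "(m * N / 2) ^ m \<le> cmod ((z\<^sup>2 - \<mu>\<^sup>2) ^ m)"
      using m1 mult_left_mono[of "N / 2" "cmod (z + \<mu>)" "real m"] by (auto intro!: power_mono)
    have "(m * N / 2) ^ m * cmod (F z) \<le> S * (circle_const D' * E1 ^ m / N)"
      by (rule order_trans[OF mult_right_mono[OF low norm_ge_zero] up])
    moreover have pos: "0 < (m * N / 2) ^ m" using m1 Npos by (intro zero_less_power) simp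
    ultimately show ?thesis unfolding K_def pos_le_divide_eq[OF pos] by (subst mult.commute)
  qed
  have Fhol: "F holomorphic_on UNIV" unfolding F_def by (rule solA_pairing_holomorphic[OF uc])
  have "cmod (F \<mu>) \<le> K"
  proof (rule maximum_modulus_frontier[where f = F and \<xi> = \<mu> and S = "ball \<mu> (real m)"])
    show "F holomorphic_on interior (ball \<mu> (real m))" using Fhol holomorphic_on_subset by blast
    show "continuous_on (closure (ball \<mu> (real m))) F"
      using holomorphic_on_imp_continuous_on[OF Fhol] continuous_on_subset by blast
    show "cmod (F z) \<le> K" if "z \<in> frontier (ball \<mu> (real m))" for z
      using that m1 by (intro frontier) (simp add: frontier_ball dist_norm norm_minus_commute)
  qed (use m1 in auto)
  also have "K \<le> chain_const M D' ^ m / cmod \<mu> * U"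
  proof -
    define X where "X = (m * N / 2) ^ m"
    have X: "0 < X" unfolding X_def using m1 Npos by (intro zero_less_power) simp
    have mN: "(M + 3) * m * (4 * N) = 8 * (M + 3) * (m * N / 2)" by simp
    have mNX: "((M + 3) * m * (4 * N)) ^ m = (8 * (M + 3)) ^ m * X"
      unfolding X_def mN by (rule power_mult_distrib)
    have "K = 2 * \<Lambda>\<^sup>2 * (((8 * (M + 3)) ^ m * X) * ((1 + pert) * U)) * (circle_const D' * E1 ^ m / N) / X"
      unfolding K_def S_def mNX X_def[symmetric] ..
    also have "\<dots> = 2 * \<Lambda>\<^sup>2 * (8 * (M + 3)) ^ m * (1 + pert) * circle_const D' * E1 ^ m * U * (1 / N)"
      using X by (simp add: mult_ac)
    also have "\<dots> \<le> 2 * \<Lambda>\<^sup>2 * (8 * (M + 3)) ^ m * (1 + pert) * circle_const D' * E1 ^ m * U * (2 / cmod \<mu>)"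
    proof (rule mult_left_mono)
      have "2 / (2 * real N) \<le> 2 / cmod \<mu>"
        using NM Npos mu1 by (intro divide_left_mono mult_pos_pos) auto
      then show "1 / real N \<le> 2 / cmod \<mu>" by simp
      show "0 \<le> 2 * \<Lambda>\<^sup>2 * (8 * (M + 3)) ^ m * (1 + pert) * circle_const D' * E1 ^ m * U"
        using M pert_nonneg C0 U0 by (intro mult_nonneg_nonneg) (auto simp: E1_def)
    qed
    also have "\<dots> = 4 * \<Lambda>\<^sup>2 * (8 * (M + 3)) ^ m * (1 + pert) * circle_const D' * E1 ^ m * (U / cmod \<mu>)"
      by simp
    also have "\<dots> \<le> (4 ^ m * ((24 * (M + 4))\<^sup>2) ^ m * (8 * (M + 3)) ^ m * (1 + pert) ^ m * (1 + circle_const D') ^ m * E1 ^ m)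
        * (U / cmod \<mu>)"
    proof -
      have pw: "x \<le> x ^ m" if "1 \<le> x" for x :: real
        using power_increasing[OF m that] by simp
      have "\<Lambda>\<^sup>2 = ((24 * (M + 4))\<^sup>2) ^ m" by (simp add: \<Lambda>_def mult.commute flip: power_mult)
      moreover have "circle_const D' \<le> (1 + circle_const D') ^ m" using pw[of "1 + circle_const D'"] C0 by linarith
      ultimately show ?thesis
        using M C0 pert_nonneg U0 mu1 pw[of 4] pw[of "1 + pert"]
        by (intro mult_right_mono mult_mono mult_nonneg_nonneg) (auto simp: E1_def)
    qed
    also have "\<dots> = chain_const M D' ^ m / cmod \<mu> * U"
      by (simp add: chain_const_def E1_def power_mult_distrib)
    finally show ?thesis .
  qed
  finally show ?thesis by (simp add: F_def U_def)
qed

end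

context potential
begin

text \<open>
  The determinant of the two forms on \<open>solS\<close> and \<open>solC\<close> is a multiple of the characteristic determinant, so it suffices to
  make one form vanish. The one whose main term on \<open>solC\<close> is not small is chosen, which also bounds \<open>\<kappa>\<close>.
\<close>

lemma adjoint_eigenfunction_exists:
  assumes th: "\<theta> \<in> {0, 1}" and det: "char_det Q \<mu> = 0" and M: "\<bar>Im \<mu>\<bar> \<le> M"
    and big: "1 \<le> cmod \<mu>" "2 * pert * exp (2 * pi * M) \<le> cmod \<mu>"
  shows "\<exists>\<kappa>. cmod \<kappa> \<le> 2 * pert * exp (2 * pi * M) / cmod \<mu> \<and>
    bc_der \<theta> (solA' \<theta> \<kappa> \<mu>) = 0 \<and> bc_val \<theta> (solA \<theta> \<kappa> \<mu>) = 0"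
proof -
  define E where "E = exp (2 * pi * M)"
  define AV where "AV = bc_der \<theta> (solS' \<theta> \<mu>)"
  define AY where "AY = bc_der \<theta> (solC' \<theta> \<mu>)"
  define BV where "BV = bc_val \<theta> (solS \<theta> \<mu>)"
  define BY where "BY = bc_val \<theta> (solC \<theta> \<mu>)"
  have mu: "0 < cmod \<mu>" using big(1) by linarith
  have EE: "pert * exp (2 * pi * \<bar>Im \<mu>\<bar>) \<le> pert * E"
    unfolding E_def using M pert_nonneg by (intro mult_left_mono) auto
  then have EEz: "pert * exp (2 * pi * \<bar>Im \<mu>\<bar>) / cmod \<mu> \<le> pert * E / cmod \<mu>"
    by (rule divide_right_mono) simp
  note bf = solC_solS_boundary_forms[OF th big(1)]
  have b: "cmod (AY + 2 * \<mu> * sin (phase \<theta> \<mu>)) \<le> pert * E" "cmod (BY - 2 * cos (phase \<theta> \<mu>)) \<le> pert * E / cmod \<mu>"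
    "cmod AV \<le> pert * E" "cmod BV \<le> pert * E / cmod \<mu>"
    unfolding AY_def BY_def AV_def BV_def
    by (rule order_trans[OF bf(1) EE] order_trans[OF bf(2) EEz]
        order_trans[OF bf(3) EE] order_trans[OF bf(4) EEz])+
  have half: "pert * E / cmod \<mu> \<le> 1 / 2"
    using big mu by (simp add: E_def field_simps)
  define Dt where "Dt = bc_der \<theta> (ddx (sol_c Q \<mu>)) * bc_val \<theta> (sol_s Q \<mu>)
      - bc_der \<theta> (ddx (sol_s Q \<mu>)) * bc_val \<theta> (sol_c Q \<mu>)"
  have e2: "(-1) ^ \<theta> * (-1) ^ \<theta> = (1 :: complex)"
    by (simp flip: power_add mult_2)
  have "Dt = ((-1) ^ \<theta> * (-1) ^ \<theta>) * (ddx (sol_c Q \<mu>) pi * sol_s Q \<mu> pi - ddx (sol_s Q \<mu>) pi * sol_c Q \<mu> pi)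
    + (-1) ^ \<theta> * (sol_c Q \<mu> pi - ddx (sol_s Q \<mu>) pi) + 1"
    unfolding Dt_def bc_der_def bc_val_def using sol_c_props(2,3)[of \<mu>] sol_s_props(2,3)[of \<mu>]
    by (simp add: algebra_simps)
  also have "\<dots> = 0"
    unfolding e2 using Wronskian_sol_c_sol_s[of \<mu>] det by (simp add: char_det_def algebra_simps)
  finally have "Dt = 0" .
  moreover have "AV * BY - AY * BV = (- sin (phase \<theta> \<mu>) * (\<mu> * sin (phase \<theta> \<mu>)) - \<mu> * cos (phase \<theta> \<mu>) * cos (phase \<theta> \<mu>)) * Dt"
    unfolding AV_def BY_def AY_def BV_def Dt_def bc_der_def bc_val_def solS_def solS'_def solC_def solC'_def
      cs_sol_def cs_der_def by (simp add: algebra_simps)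
  ultimately have det0: "AV * BY = AY * BV" by simp
  have lin: "bc_der \<theta> (solA' \<theta> \<kappa> \<mu>) = AV + \<kappa> * AY" "bc_val \<theta> (solA \<theta> \<kappa> \<mu>) = BV + \<kappa> * BY" for \<kappa>
    by (simp_all add: bc_der_def bc_val_def solA_def solA'_def AV_def AY_def BV_def BY_def algebra_simps)
  \<comment> \<open>Both cannot be small as their squares add up to \<open>1\<close>.\<close>
  have "1/2 \<le> cmod (sin (phase \<theta> \<mu>)) \<or> 1/2 \<le> cmod (cos (phase \<theta> \<mu>))"
  proof (rule ccontr)
    assume "\<not> ?thesis"
    then have "cmod (sin (phase \<theta> \<mu>)) ^ 2 \<le> (1/2)^2" "cmod (cos (phase \<theta> \<mu>)) ^ 2 \<le> (1/2)^2"
      by (intro power_mono; simp)+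
    moreover have "1 \<le> cmod (sin (phase \<theta> \<mu>)) ^ 2 + cmod (cos (phase \<theta> \<mu>)) ^ 2"
      using norm_triangle_ineq[of "sin (phase \<theta> \<mu>) ^ 2" "cos (phase \<theta> \<mu>) ^ 2"] by (simp add: norm_power)
    ultimately show False by (simp add: power2_eq_square)
  qed
  then show ?thesis
  proof
    assume "1/2 \<le> cmod (sin (phase \<theta> \<mu>))"
    then have "cmod \<mu> \<le> cmod (2 * \<mu> * sin (phase \<theta> \<mu>))"
      using mu by (simp add: norm_mult)
    then have AY: "cmod \<mu> / 2 \<le> cmod AY"
      using norm_triangle_ineq4[of "AY + 2 * \<mu> * sin (phase \<theta> \<mu>)" AY] b(1) big(2) by (simp add: E_def)
    then have AY0: "AY \<noteq> 0" using mu by auto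
    have "cmod (- AV / AY) \<le> pert * E / (cmod \<mu> / 2)"
      unfolding norm_divide norm_minus_cancel
      using b(3) AY mu pert_nonneg by (intro frac_le) (auto simp: E_def)
    then have "cmod (- AV / AY) \<le> 2 * pert * E / cmod \<mu>" by (simp add: mult_ac)
    moreover have "AV + (- AV / AY) * AY = 0" "BV + (- AV / AY) * BY = 0"
      using AY0 det0 by (simp_all add: field_simps)
    ultimately show ?thesis unfolding lin E_def by blast
  next
    assume "1/2 \<le> cmod (cos (phase \<theta> \<mu>))"
    then have "1 \<le> cmod (2 * cos (phase \<theta> \<mu>))" by (simp add: norm_mult)
    then have BY: "1 / 2 \<le> cmod BY"
      using norm_triangle_sub[of "2 * cos (phase \<theta> \<mu>)" BY] b(2) half
        norm_minus_commute[of BY "2 * cos (phase \<theta> \<mu>)"] by linarith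
    then have BY0: "BY \<noteq> 0" by auto
    have "cmod (- BV / BY) \<le> pert * E / cmod \<mu> / (1 / 2)"
      unfolding norm_divide norm_minus_cancel
      using b(4) BY mu pert_nonneg by (intro frac_le) (auto simp: E_def)
    then have "cmod (- BV / BY) \<le> 2 * pert * E / cmod \<mu>" by (simp add: mult_ac)
    moreover have "AV + (- BV / BY) * AY = 0" "BV + (- BV / BY) * BY = 0"
      using BY0 det0 by (simp_all add: field_simps)
    ultimately show ?thesis unfolding lin E_def by blast
  qed
qed

lemma solA_sup_bound:
  assumes M: "\<bar>Im \<mu>\<bar> \<le> M" and big: "1 \<le> cmod \<mu>" and k: "cmod \<kappa> \<le> D' / cmod \<mu>" "0 \<le> D'"
    and x: "x \<in> {0..pi}"
  shows "cmod (solA \<theta> \<kappa> \<mu> x) \<le> (1 + D') * ((1 + pert) * exp (2 * pi * M))"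
proof -
  have E: "(1 + pert) * exp (2 * pi * \<bar>Im \<mu>\<bar>) \<le> (1 + pert) * exp (2 * pi * M)"
    using M pert_nonneg by (intro mult_left_mono) auto
  have "D' / cmod \<mu> \<le> D' / 1" using big k by (intro divide_left_mono) auto
  then have "cmod (\<kappa> * solC \<theta> \<mu> x) \<le> D' * ((1 + pert) * exp (2 * pi * M))"
    unfolding norm_mult
    using k order_trans[OF solC_solS_bounds(1)[OF big x] E] by (intro mult_mono) auto
  then show ?thesis
    using order_trans[OF solC_solS_bounds(2)[OF big x] E, of \<theta>] norm_triangle_ineq[of "solS \<theta> \<mu> x" "\<kappa> * solC \<theta> \<mu> x"]
    unfolding solA_def by (simp add: algebra_simps)
qed

lemma abs_sin_Re_le: "\<bar>sin (Re w)\<bar> \<le> cmod (sin w)"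
proof -
  define c where "c = (exp (Im w) + exp (- Im w)) / 2"
  have c: "1 \<le> c" using cosh_real_ge_1[of "Im w"] by (simp add: cosh_def c_def)
  have "\<bar>sin (Re w)\<bar> * 1 \<le> \<bar>sin (Re w)\<bar> * \<bar>c\<bar>" using c by (intro mult_left_mono) auto
  also have "\<dots> = \<bar>Re (sin w)\<bar>" by (simp add: Re_sin c_def abs_mult)
  finally have "\<bar>sin (Re w)\<bar> \<le> \<bar>Re (sin w)\<bar>" by simp
  then show ?thesis using abs_Re_le_cmod[of "sin w"] by linarith
qed

lemma integral_sin_square_ge:
  assumes "1 \<le> b"
  shows "1 \<le> integral {0..pi} (\<lambda>x. sin (a - b * x) ^ 2)"
proof -
  define F where "F x = x / 2 + sin (2 * (a - b * x)) / (4 * b)" for x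
  have "((\<lambda>x. sin (a - b * x) ^ 2) has_integral F pi - F 0) {0..pi}"
  proof (rule fundamental_theorem_of_calculus)
    fix x :: real assume "x \<in> {0..pi}"
    have "cos (2 * (a - b * x)) = 1 - 2 * sin (a - b * x) ^ 2"
      using cos_double_sin[of "a - b * x"] by simp
    then have sq: "1 / 2 + cos (2 * (a - b * x)) * (2 * (- b)) / (4 * b) = sin (a - b * x) ^ 2"
      using assms by (simp add: diff_divide_distrib)
    have "(F has_real_derivative 1 / 2 + cos (2 * (a - b * x)) * (2 * (- b)) / (4 * b)) (at x)"
      unfolding F_def by (auto intro!: derivative_eq_intros)
    then have "(F has_real_derivative sin (a - b * x) ^ 2) (at x)" unfolding sq .
    then show "(F has_vector_derivative sin (a - b * x) ^ 2) (at x within {0..pi})"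
      by (simp add: has_real_derivative_iff_has_vector_derivative has_vector_derivative_at_within)
  qed simp
  then have "integral {0..pi} (\<lambda>x. sin (a - b * x) ^ 2) = F pi - F 0" by (rule integral_unique)
  moreover have s: "\<bar>sin t / (4 * b)\<bar> \<le> 1 / 4" for t
  proof -
    have "\<bar>sin t\<bar> / (4 * b) \<le> 1 / (4 * 1)"
      using assms by (intro frac_le) auto
    then show ?thesis using assms by simp
  qed
  ultimately show ?thesis
    using s[of "2 * (a - b * pi)"] s[of "2 * (a - b * 0)"] pi_gt3 unfolding F_def by linarith
qed

text \<open>
  Up to an error of at most \<open>1/4\<close>, the function is \<open>- sin (phase \<theta> \<mu> - \<mu> x)\<close>, whose modulus is at least that of the sine of
  the real part.
\<close>

lemma solA_norm_lower_bound:
  assumes M: "\<bar>Im \<mu>\<bar> \<le> M" "1 \<le> Re \<mu>" and k: "cmod \<kappa> \<le> D' / cmod \<mu>" "0 \<le> D'"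
    and big: "4 * ((pert + D' * (1 + pert)) * exp (2 * pi * M)) \<le> cmod \<mu>"
  shows "1 / 4 \<le> integral {0..pi} (\<lambda>x. cmod (solA \<theta> \<kappa> \<mu> x) ^ 2)"
proof -
  define d where "d = (pert + D' * (1 + pert)) * exp (2 * pi * M)"
  have mu: "1 \<le> cmod \<mu>" using M(2) complex_Re_le_cmod[of \<mu>] by linarith
  have mu0: "0 < cmod \<mu>" using mu by linarith
  define a where "a = (Re \<mu> + \<theta>) * (pi / 2)"
  have pt: "sin (a - Re \<mu> * x) ^ 2 / 2 - 1/16 \<le> cmod (solA \<theta> \<kappa> \<mu> x) ^ 2" if x: "x \<in> {0..pi}" for x
  proof -
    define w where "w = phase \<theta> \<mu> - \<mu> * of_real x"
    have rw: "Re w = a - Re \<mu> * x" by (simp add: w_def phase_def a_def)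
    have 1: "cmod (solS \<theta> \<mu> x + sin w) \<le> pert * exp (2 * pi * M) / cmod \<mu>"
    proof -
      have "pert * exp (2 * pi * \<bar>Im \<mu>\<bar>) / cmod \<mu> \<le> pert * exp (2 * pi * M) / cmod \<mu>"
        using M pert_nonneg by (intro divide_right_mono mult_left_mono) auto
      then show ?thesis using solC_solS_asymptotics(3)[OF mu x, of \<theta>] unfolding w_def by linarith
    qed
    have "(1 + pert) * exp (2 * pi * \<bar>Im \<mu>\<bar>) \<le> (1 + pert) * exp (2 * pi * M)"
      using M pert_nonneg by (intro mult_left_mono) auto
    then have "cmod (\<kappa> * solC \<theta> \<mu> x) \<le> D' / cmod \<mu> * ((1 + pert) * exp (2 * pi * M))"
      unfolding norm_mult using k order_trans[OF solC_solS_bounds(1)[OF mu x, of \<theta>]] by (intro mult_mono) auto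
    then have "cmod (solA \<theta> \<kappa> \<mu> x + sin w) \<le> pert * exp (2 * pi * M) / cmod \<mu> + D' / cmod \<mu> * ((1 + pert) * exp (2 * pi * M))"
      unfolding solA_def using 1 norm_triangle_ineq[of "solS \<theta> \<mu> x + sin w" "\<kappa> * solC \<theta> \<mu> x"]
      by (simp add: algebra_simps)
    also have "\<dots> = d / cmod \<mu>" by (simp add: d_def add_divide_distrib algebra_simps)
    also have "\<dots> \<le> 1 / 4" using big mu0 by (simp add: d_def field_simps)
    finally have e: "cmod (solA \<theta> \<kappa> \<mu> x + sin w) \<le> 1 / 4" .
    define v where "v = cmod (solA \<theta> \<kappa> \<mu> x)"
    have "\<bar>sin (Re w)\<bar> \<le> v + 1 / 4"
      using abs_sin_Re_le[of w] e norm_triangle_ineq4[of "solA \<theta> \<kappa> \<mu> x + sin w" "solA \<theta> \<kappa> \<mu> x"]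
      by (simp add: v_def)
    then have "\<bar>sin (Re w)\<bar> ^ 2 \<le> (v + 1 / 4) ^ 2" by (intro power_mono) auto
    also have "\<dots> \<le> 2 * v ^ 2 + 1 / 8"
      using zero_le_power2[of "v - 1 / 4"] by (simp add: power2_eq_square algebra_simps)
    finally show ?thesis unfolding rw v_def[symmetric] by (simp add: power2_abs)
  qed
  have c1: "(\<lambda>x. sin (a - Re \<mu> * x) ^ 2) integrable_on {0..pi}"
    by (intro integrable_continuous_real continuous_intros)
  have "1 / 4 \<le> 1 / 2 - pi / 16" using pi_less_4 by simp
  also have "\<dots> \<le> integral {0..pi} (\<lambda>x. sin (a - Re \<mu> * x) ^ 2) / 2 - pi / 16"
    using integral_sin_square_ge[OF M(2), of a] by simp
  also have "\<dots> = integral {0..pi} (\<lambda>x. sin (a - Re \<mu> * x) ^ 2 / 2 - 1/16)"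
    using c1 by (subst integral_diff) auto
  also have "\<dots> \<le> integral {0..pi} (\<lambda>x. cmod (solA \<theta> \<kappa> \<mu> x) ^ 2)"
    using pt c1 ode_sol_continuous(1)[OF solA_ode[of \<mu> \<theta> \<kappa>]]
    by (intro integral_le integrable_diff integrable_continuous_real continuous_intros) auto
  finally show ?thesis .
qed

text \<open>
  If both forms vanish on \<open>y\<close>, then \<open>(l - n) G\<^sub>i + G\<^sub>i\<^sub>-\<^sub>1 = 0\<close> for the pairings \<open>G\<^sub>i\<close> of the chain with \<open>y\<close>. For \<open>l \<noteq> n\<close> all
  vanish by induction; for \<open>l = n\<close> all but the last one.
\<close>

lemma chain_pairing_zero:
  assumes ch: "chain Q \<theta> l m u p" and y: "ode_sol (\<lambda>x. Q x - n) y r (\<lambda>x. 0)"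
    and bc: "bc_der \<theta> r = 0" "bc_val \<theta> y = 0" and i: "i < m" and c: "l \<noteq> n \<or> Suc i < m"
  shows "integral {0..pi} (\<lambda>x. u i x * y x) = 0"
proof (cases "l = n")
  case True
  then have "Suc i < m" using c by simp
  from chain_step[OF ch this y] show ?thesis using True bc by simp
next
  case False
  show ?thesis using i
  proof (induction i)
    case 0
    then show ?case using chain_step[OF ch 0 y] False bc by simp
  next
    case (Suc i)
    then show ?case using chain_step[OF ch Suc.prems y] False bc by simp
  qed
qed

text \<open>
  The maximum with \<open>1\<close> keeps the eigenfunction even if the dimension of the root subspace were \<open>0\<close>.
\<close>

lemma canonical_system_chain:
  assumes "canonical_system Q \<theta> l u"
  shows "chain Q \<theta> l (max 1 (multiplicity_at Q \<theta> l)) u (\<lambda>i. ddx (u i))"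
proof -
  define m where "m = max 1 (multiplicity_at Q \<theta> l)"
  have L: "L_op Q \<theta> (u i) (\<lambda>x. l * u i x + (if i = 0 then (\<lambda>x. 0) else u (i - 1)) x)" if "i < m" for i
    using assms that unfolding canonical_system_def eigenfunction_def m_def
    by (cases "i = 0") auto
  have e2: "(-1) ^ \<theta> * ((-1) ^ \<theta> * z) = (z :: complex)" for z
    by (simp flip: mult.assoc power_add mult_2)
  have bc: "u i pi = (-1) ^ \<theta> * u i 0 \<and> ddx (u i) pi = - ((-1) ^ \<theta>) * ddx (u i) 0" if "i < m" for i
  proof -
    have "ddx (u i) 0 = - ((-1) ^ \<theta> * ddx (u i) pi)" "u i 0 = (-1) ^ \<theta> * u i pi"
      using L[OF that] unfolding L_op_def by (auto simp: eq_neg_iff_add_eq_0)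
    then show ?thesis using e2 by simp
  qed
  have ode: "ode_sol (\<lambda>x. Q x - l) (u i) (ddx (u i)) (if i = 0 then (\<lambda>x. 0) else u (i - 1))" if "i < m" for i
    using that
  proof (induction i)
    case 0
    show ?case using L[OF 0] unfolding L_op_def by (intro sturm_liouville_shift) auto
  next
    case (Suc i)
    have "continuous_on {0..pi} (u i)" using Suc ode_sol_continuous(1) by (meson Suc_lessD)
    then show ?case using L[OF Suc.prems] unfolding L_op_def by (intro sturm_liouville_shift) auto
  qed
  show ?thesis unfolding m_def[symmetric] chain_def using ode bc by blast
qed

end

section \<open>Multiplicities\<close>

context potential
begin

lemma root_ker_continuous:
  assumes "root_ker Q \<theta> l k u"
  shows "continuous_on {0..pi} u"
proof (cases k)
  case 0
  then have "\<And>x. x \<in> {0..pi} \<Longrightarrow> u x = 0" using assms by simp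
  then show ?thesis using continuous_on_eq[OF continuous_on_const, of "{0..pi}" 0 u] by simp
next
  case (Suc k')
  then obtain f where "sturm_liouville Q u (\<lambda>x. l * u x + f x)" using assms by (auto simp: L_op_def)
  then show ?thesis
    unfolding continuous_on_eq_continuous_within
    using has_vector_derivative_continuous unfolding sturm_liouville_def by blast
qed

lemma L_op_root:
  assumes "L_op Q \<theta> u (\<lambda>x. l * u x + f x)" "continuous_on {0..pi} f"
  shows "ode_sol (\<lambda>x. Q x - l) u (ddx u) f"
    and "u pi = (-1) ^ \<theta> * u 0" "ddx u pi = - ((-1) ^ \<theta>) * ddx u 0"
proof -
  show "ode_sol (\<lambda>x. Q x - l) u (ddx u) f"
    using assms unfolding L_op_def by (intro sturm_liouville_shift) auto
  have e2: "(-1) ^ \<theta> * ((-1) ^ \<theta> * z) = (z :: complex)" for z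
    by (simp flip: mult.assoc power_add mult_2)
  have "ddx u 0 = - ((-1) ^ \<theta> * ddx u pi)" "u 0 = (-1) ^ \<theta> * u pi"
    using assms(1) unfolding L_op_def by (auto simp: eq_neg_iff_add_eq_0)
  then show "u pi = (-1) ^ \<theta> * u 0" "ddx u pi = - ((-1) ^ \<theta>) * ddx u 0" using e2 by auto
qed

lemma root_ker_chain:
  assumes "root_ker Q \<theta> l k u" "\<not> root_ker Q \<theta> l (k - 1) u" "1 \<le> k"
  shows "\<exists>w p. chain Q \<theta> l k w p \<and> (\<exists>x\<in>{0..pi}. w 0 x \<noteq> 0) \<and> w (k - 1) = u"
  using assms
proof (induction k arbitrary: u)
  case 0
  then show ?case by simp
next
  case (Suc k)
  obtain f where f: "root_ker Q \<theta> l k f" "L_op Q \<theta> u (\<lambda>x. l * u x + f x)"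
    using Suc.prems(1) by auto
  note L = L_op_root[OF f(2) root_ker_continuous[OF f(1)]]
  show ?case
  proof (cases "k = 0")
    case True
    have f0: "\<And>x. x \<in> {0..pi} \<Longrightarrow> f x = 0" using f(1) True by simp
    have "ode_sol (\<lambda>x. Q x - l) u (ddx u) (\<lambda>x. 0)"
      by (rule ode_sol_cong[OF L(1)]) (auto simp: f0)
    then have "chain Q \<theta> l (Suc k) (\<lambda>_. u) (\<lambda>_. ddx u)"
      unfolding chain_def using True L(2,3) by auto
    moreover have "\<exists>x\<in>{0..pi}. u x \<noteq> 0" using Suc.prems(2) True by simp
    ultimately show ?thesis by blast
  next
    case False
    have "\<not> root_ker Q \<theta> l (k - 1) f"
    proof
      assume "root_ker Q \<theta> l (k - 1) f"
      then have "root_ker Q \<theta> l (Suc (k - 1)) u" using f(2) by auto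
      then show False using Suc.prems(2) False by simp
    qed
    then obtain w p where w: "chain Q \<theta> l k w p" "\<exists>x\<in>{0..pi}. w 0 x \<noteq> 0" "w (k - 1) = f"
      using Suc.IH[OF f(1)] False by auto
    have "chain Q \<theta> l (Suc k) (w(k := u)) (p(k := ddx u))"
      unfolding chain_def
    proof (intro allI impI)
      fix i assume "i < Suc k"
      then consider "i = k" | "i < k" by linarith
      then show "ode_sol (\<lambda>x. Q x - l) ((w(k := u)) i) ((p(k := ddx u)) i)
          (if i = 0 then (\<lambda>x. 0) else (w(k := u)) (i - 1)) \<and>
        (w(k := u)) i pi = (-1) ^ \<theta> * (w(k := u)) i 0 \<and>
        (p(k := ddx u)) i pi = - ((-1) ^ \<theta>) * (p(k := ddx u)) i 0"
      proof cases
        case 1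
        moreover have "k - 1 \<noteq> k" using False by linarith
        ultimately show ?thesis using False L w(3) by simp
      next
        case 2
        then have "ode_sol (\<lambda>x. Q x - l) (w i) (p i) (if i = 0 then (\<lambda>x. 0) else w (i - 1))"
          "w i pi = (-1) ^ \<theta> * w i 0" "p i pi = - ((-1) ^ \<theta>) * p i 0"
          using w(1) unfolding chain_def by blast+
        then show ?thesis using 2 by auto
      qed
    qed
    moreover have "\<exists>x\<in>{0..pi}. (w(k := u)) 0 x \<noteq> 0" "(w(k := u)) (Suc k - 1) = u"
      using w(2) False by auto
    ultimately show ?thesis by blast
  qed
qed

text \<open>
  The identity for chains is applied to the two families of solutions on which one adjoint form vanishes and the other is
  \<open>\<plusminus>char_det\<close>. As the pairing is entire, \<open>(z\<^sup>2 - \<mu>\<^sup>2)\<^sup>k\<close> divides the products of \<open>char_det\<close> with both polynomials of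
  initial values. At \<open>\<mu>\<close> these are the initial values of the first function, and one of them is not \<open>0\<close>.
\<close>

lemma chain_length_le_order:
  assumes ch: "chain Q \<theta> (\<mu>\<^sup>2) k w p" and k: "1 \<le> k" and nz: "\<exists>x\<in>{0..pi}. w 0 x \<noteq> 0"
    and th: "\<theta> \<in> {0, 1}" and mu: "\<mu> \<noteq> 0"
    and g: "0 < r" "g holomorphic_on ball \<mu> r" "g \<mu> \<noteq> 0"
      "\<And>z. z \<in> ball \<mu> r \<Longrightarrow> char_det Q z = (z - \<mu>) ^ n * g z"
  shows "k \<le> n"
proof (rule ccontr)
  assume "\<not> k \<le> n"
  then have kn: "n < k" by simp
  have w0: "ode_sol (\<lambda>x. Q x - \<mu>\<^sup>2) (w 0) (p 0) (\<lambda>x. 0)"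
  proof -
    have "0 < k" using k by simp
    then show ?thesis using ch unfolding chain_def by force
  qed
  have init: "w 0 0 \<noteq> 0 \<or> p 0 0 \<noteq> 0"
  proof (rule ccontr)
    assume "\<not> ?thesis"
    then have "w 0 x = 0" if "x \<in> {0..pi}" for x
      using eq_cs_sol(1)[OF w0 that] by (simp add: cs_sol_def)
    then show False using nz by blast
  qed
  have wc: "continuous_on {0..pi} (w (k - 1))"
  proof -
    have "k - 1 < k" using k by simp
    then show ?thesis using ch ode_sol_continuous(1) unfolding chain_def by blast
  qed
  \<comment> \<open>the values at \<open>\<pi>\<close> of the fundamental system\<close>
  define c where "c z = sol_c Q z pi" for z
  define c' where "c' z = ddx (sol_c Q z) pi" for z
  define s where "s z = sol_s Q z pi" for z
  define s' where "s' z = ddx (sol_s Q z) pi" for z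
  define e :: complex where "e = (-1) ^ \<theta>"
  have e2: "e * e = 1" unfolding e_def by (simp flip: power_add mult_2)
  have wr: "c z * s' z - c' z * s z = 1" for z
    unfolding c_def c'_def s_def s'_def by (rule Wronskian_sol_c_sol_s)
  have hol: "c holomorphic_on UNIV" "c' holomorphic_on UNIV" "s holomorphic_on UNIV" "s' holomorphic_on UNIV"
    using holomorphic_square[OF sol_c_hol(1), of pi] holomorphic_square[OF sol_c_hol(2), of pi]
      holomorphic_square[OF sol_s_hol(1), of pi] holomorphic_square[OF sol_s_hol(2), of pi]
    by (auto simp: c_def[abs_def] c'_def[abs_def] s_def[abs_def] s'_def[abs_def])
  have bf: "bc_der \<theta> (cs_der z a b) = a * (e * c' z) + b * (e * s' z - 1)"
    "bc_val \<theta> (cs_sol z a b) = a * (e * c z + 1) + b * (e * s z)" for z a b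
    unfolding bc_der_def bc_val_def e_def[symmetric] using cs_sol_0[of z a b]
    by (simp_all add: c_def c'_def s_def s'_def cs_sol_def cs_der_def algebra_simps)
  have det: "char_det Q z = c z - s' z" for z by (simp add: char_det_def c_def s'_def)
  have id: "- ((z\<^sup>2 - \<mu>\<^sup>2) ^ k) * integral {0..pi} (\<lambda>x. w (k - 1) x * cs_sol z a b x)
    = poly (init_poly k w) (z\<^sup>2 - \<mu>\<^sup>2) * bc_der \<theta> (cs_der z a b) + poly (init_poly k p) (z\<^sup>2 - \<mu>\<^sup>2) * bc_val \<theta> (cs_sol z a b)" for z a b
    using k by (intro chain_identity[OF ch _ cs_sol_ode]) simp
  have van: "P \<mu> = 0"
    if F: "continuous_on UNIV F" and P: "continuous_on UNIV P"
      and eq: "\<And>z. - ((z\<^sup>2 - \<mu>\<^sup>2) ^ k) * F z = P z * char_det Q z" for F P :: "complex \<Rightarrow> complex"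
  proof -
    \<comment> \<open>the identity \<open>eq\<close> divided by the common power of \<open>z - \<mu>\<close>\<close>
    define h where "h z = (z - \<mu>) ^ (k - n) * (z + \<mu>) ^ k * F z + P z * g z" for z
    have hc: "continuous_on (ball \<mu> r) h"
      unfolding h_def
      by (intro continuous_intros continuous_on_subset[OF F] continuous_on_subset[OF P]
          holomorphic_on_imp_continuous_on[OF g(2)]) auto
    have "h z = 0" if z: "z \<in> ball \<mu> r" "z \<noteq> \<mu>" for z
    proof -
      have fac: "z\<^sup>2 - \<mu>\<^sup>2 = (z - \<mu>) * (z + \<mu>)" by (simp add: algebra_simps power2_eq_square)
      have pw: "(z - \<mu>) ^ k = (z - \<mu>) ^ n * (z - \<mu>) ^ (k - n)"
        using kn by (simp flip: power_add)
      have "P z * char_det Q z + (z\<^sup>2 - \<mu>\<^sup>2) ^ k * F z = 0"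
        unfolding eq[symmetric] by simp
      then have "(z - \<mu>) ^ n * h z = 0"
        unfolding h_def fac power_mult_distrib pw g(4)[OF z(1)] by (simp add: algebra_simps)
      then show ?thesis using z(2) by simp
    qed
    note h0 = this
    have "isCont h \<mu>" using hc g(1) by (simp add: continuous_on_eq_continuous_at)
    then have h1: "(h \<longlongrightarrow> h \<mu>) (at \<mu>)" by (simp add: isCont_def)
    have "eventually (\<lambda>z. z \<in> ball \<mu> r \<and> z \<noteq> \<mu>) (at \<mu>)"
      unfolding eventually_at using g(1) by (intro exI[of _ r]) (simp add: dist_commute)
    then have "eventually (\<lambda>z. h z = 0) (at \<mu>)" by (rule eventually_mono) (use h0 in blast)
    then have "(h \<longlongrightarrow> 0) (at \<mu>)" by (rule tendsto_eventually)
    then have "h \<mu> = 0" by (rule LIM_unique[OF h1])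
    moreover have "(0::complex) ^ (k - n) = 0" using kn by simp
    ultimately show ?thesis using g(3) unfolding h_def by simp
  qed
  have cont_poly: "continuous_on UNIV (\<lambda>z. poly q (z\<^sup>2 - \<mu>\<^sup>2))" for q :: "complex poly"
    by (intro continuous_intros)
  \<comment> \<open>the solutions on which \<open>bc_der\<close> vanishes\<close>
  have "e * poly (init_poly k p) (\<mu>\<^sup>2 - \<mu>\<^sup>2) = 0"
  proof (rule van[where P = "\<lambda>z. e * poly (init_poly k p) (z\<^sup>2 - \<mu>\<^sup>2)"
      and F = "\<lambda>z. integral {0..pi} (\<lambda>x. w (k - 1) x * cs_sol z (1 - e * s' z) (e * c' z) x)"])
    show "continuous_on UNIV (\<lambda>z. integral {0..pi} (\<lambda>x. w (k - 1) x * cs_sol z (1 - e * s' z) (e * c' z) x))"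
      by (intro holomorphic_on_imp_continuous_on pairing_holomorphic[OF wc] holomorphic_intros hol)
    show "continuous_on UNIV (\<lambda>z. e * poly (init_poly k p) (z\<^sup>2 - \<mu>\<^sup>2))"
      by (intro continuous_on_mult continuous_on_const cont_poly)
    fix z
    have B: "(1 - e * s' z) * (e * c z + 1) + e * c' z * (e * s z) = e * char_det Q z"
    proof -
      have "(1 - e * s' z) * (e * c z + 1) + e * c' z * (e * s z)
        = e * (c z - s' z) + 1 - (e * e) * (c z * s' z - c' z * s z)" by (simp add: algebra_simps)
      then show ?thesis unfolding e2 wr det by simp
    qed
    have "bc_der \<theta> (cs_der z (1 - e * s' z) (e * c' z)) = 0"
      "bc_val \<theta> (cs_sol z (1 - e * s' z) (e * c' z)) = e * char_det Q z"
      unfolding bf B by (simp_all add: algebra_simps)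
    then show "- ((z\<^sup>2 - \<mu>\<^sup>2) ^ k) * integral {0..pi} (\<lambda>x. w (k - 1) x * cs_sol z (1 - e * s' z) (e * c' z) x)
      = e * poly (init_poly k p) (z\<^sup>2 - \<mu>\<^sup>2) * char_det Q z"
      unfolding id by simp
  qed
  \<comment> \<open>the solutions on which \<open>bc_val\<close> vanishes\<close>
  moreover have "- e * poly (init_poly k w) (\<mu>\<^sup>2 - \<mu>\<^sup>2) = 0"
  proof (rule van[where P = "\<lambda>z. - e * poly (init_poly k w) (z\<^sup>2 - \<mu>\<^sup>2)"
      and F = "\<lambda>z. integral {0..pi} (\<lambda>x. w (k - 1) x * cs_sol z (- e * s z) (e * c z + 1) x)"])
    show "continuous_on UNIV (\<lambda>z. integral {0..pi} (\<lambda>x. w (k - 1) x * cs_sol z (- e * s z) (e * c z + 1) x))"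
      by (intro holomorphic_on_imp_continuous_on pairing_holomorphic[OF wc] holomorphic_intros hol)
    show "continuous_on UNIV (\<lambda>z. - e * poly (init_poly k w) (z\<^sup>2 - \<mu>\<^sup>2))"
      by (intro continuous_on_mult continuous_on_const cont_poly)
    fix z
    have A: "- e * s z * (e * c' z) + (e * c z + 1) * (e * s' z - 1) = - e * char_det Q z"
    proof -
      have "- e * s z * (e * c' z) + (e * c z + 1) * (e * s' z - 1)
        = (e * e) * (c z * s' z - c' z * s z) - 1 - e * (c z - s' z)" by (simp add: algebra_simps)
      then show ?thesis unfolding e2 wr det by simp
    qed
    have "bc_der \<theta> (cs_der z (- e * s z) (e * c z + 1)) = - e * char_det Q z"
      "bc_val \<theta> (cs_sol z (- e * s z) (e * c z + 1)) = 0"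
      unfolding bf A by (simp_all add: algebra_simps)
    then show "- ((z\<^sup>2 - \<mu>\<^sup>2) ^ k) * integral {0..pi} (\<lambda>x. w (k - 1) x * cs_sol z (- e * s z) (e * c z + 1) x)
      = - e * poly (init_poly k w) (z\<^sup>2 - \<mu>\<^sup>2) * char_det Q z"
      unfolding id by simp
  qed
  moreover have "poly (init_poly k v) 0 = v 0 0" for v
    using k by (simp add: init_poly_def poly_sum poly_monom power_0_left if_distrib sum.delta cong: if_cong)
  moreover have "e \<noteq> 0" using e2 by auto
  ultimately show False using init by simp
qed

lemma L2_cong:
  assumes "f \<in> L2" "\<And>x. x \<in> {0<..<pi} \<Longrightarrow> f x = f' x"
  shows "f' \<in> L2"
proof -
  have "f \<in> borel_measurable leb_0pi \<longleftrightarrow> f' \<in> borel_measurable leb_0pi"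
    by (rule measurable_cong) (simp add: assms(2))
  moreover have "integrable leb_0pi (\<lambda>x. (cmod (f x))\<^sup>2) \<longleftrightarrow> integrable leb_0pi (\<lambda>x. (cmod (f' x))\<^sup>2)"
    by (rule Bochner_Integration.integrable_cong) (auto simp: assms(2))
  ultimately show ?thesis using assms(1) unfolding L2_def by simp
qed

lemma L_op_cong:
  assumes L: "L_op Q \<theta> u f" and f: "continuous_on {0..pi} f"
    and eq: "\<And>x. x \<in> {0..pi} \<Longrightarrow> u x = u' x" "\<And>x. x \<in> {0..pi} \<Longrightarrow> f x = f' x"
  shows "L_op Q \<theta> u' f'"
proof -
  have o: "ode_sol Q u (ddx u) f"
    using L sturm_liouville_iff_ode_sol[OF f] unfolding L_op_def by blast
  have o': "ode_sol Q u' (ddx u) f'"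
    by (rule ode_sol_cong[OF o]) (simp_all add: eq)
  have "continuous_on {0..pi} f'" by (rule continuous_on_eq[OF f eq(2)])
  then have "sturm_liouville Q u' f'" by (rule ode_sol_imp_sturm_liouville[OF o'])
  moreover have "ddx u' 0 = ddx u 0" "ddx u' pi = ddx u pi" using ode_sol_ddx[OF o'] by simp_all
  moreover have "u' 0 = u 0" "u' pi = u pi" using eq(1) by simp_all
  moreover have "f' \<in> L2" using L L2_cong[of f f'] eq(2) unfolding L_op_def by simp
  ultimately show ?thesis using L unfolding L_op_def by simp
qed

lemma ode_sol_sum:
  assumes "finite B" "\<And>b. b \<in> B \<Longrightarrow> ode_sol Q (w b) (p b) (g b)"
  shows "ode_sol Q (\<lambda>x. \<Sum>b\<in>B. a b * w b x) (\<lambda>x. \<Sum>b\<in>B. a b * p b x) (\<lambda>x. \<Sum>b\<in>B. a b * g b x)"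
  using assms
proof (induction B rule: finite_induct)
  case empty
  show ?case by (simp add: ode_sol_def)
next
  case (insert b B)
  show ?case
    using ode_sol_lincomb[of Q "w b" "p b" "g b", OF _ insert.IH, of "a b" 1] insert by simp
qed

end

lemma sum_fun_scale_apply: "(\<Sum>b\<in>B. fun_scale (a b) b) x = (\<Sum>b\<in>B. a b * b x)"
  by (induction B rule: infinite_finite_induct) (simp_all add: fun_scale_def)

context potential
begin

text \<open>
  Induction on \<open>k\<close>, without the boundary conditions: the spanning functions for \<open>k + 1\<close> are one solution \<open>w\<close> of
  \<open>(L - l) w = b\<close> for each \<open>b\<close> spanning for \<open>k\<close>, and the fundamental system. All are cut off outside of the interval.
\<close>

lemma root_ker_finite_span:
  "\<exists>B. finite B \<and> (\<forall>b\<in>B. continuous_on {0..pi} b \<and> (\<forall>x. x \<notin> {0..pi} \<longrightarrow> b x = 0)) \<and>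
    (\<forall>u. root_ker Q \<theta> l k u \<longrightarrow> (\<exists>a. \<forall>x\<in>{0..pi}. u x = (\<Sum>b\<in>B. a b * b x)))"
proof (induction k)
  case 0
  show ?case by (rule exI[of _ "{}"]) simp
next
  case (Suc k)
  interpret s: potential "\<lambda>x. Q x - l" by (rule potential_shift)
  obtain B where B_all: "finite B \<and> (\<forall>b\<in>B. continuous_on {0..pi} b \<and> (\<forall>x. x \<notin> {0..pi} \<longrightarrow> b x = 0)) \<and>
    (\<forall>u. root_ker Q \<theta> l k u \<longrightarrow> (\<exists>a. \<forall>x\<in>{0..pi}. u x = (\<Sum>b\<in>B. a b * b x)))"
    using Suc.IH ..
  then have B: "finite B" "\<And>b. b \<in> B \<Longrightarrow> continuous_on {0..pi} b" by simp_all
  have "\<exists>w. \<exists>p. ode_sol (\<lambda>x. Q x - l) w p b" if "b \<in> B" for b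
    using s.ode_sol_exists[OF B(2)[OF that], of 0 0] by blast
  then obtain w where "\<And>b. b \<in> B \<Longrightarrow> \<exists>p. ode_sol (\<lambda>x. Q x - l) (w b) p b" by metis
  then obtain p where w: "\<And>b. b \<in> B \<Longrightarrow> ode_sol (\<lambda>x. Q x - l) (w b) (p b) b" by metis
  define t where "t v x = (if x \<in> {0..pi} then v x else 0)" for v :: "real \<Rightarrow> complex" and x
  define c where "c = t (sol_c Q (csqrt l))"
  define s where "s = t (sol_s Q (csqrt l))"
  define B' where "B' = (\<lambda>b. t (w b)) ` B \<union> {c, s}"
  have tc: "continuous_on {0..pi} (t v)" if "continuous_on {0..pi} v" for v
    by (rule continuous_on_eq[OF that]) (simp add: t_def)
  interpret vs: vector_space fun_scale by (rule vector_space_fun_scale)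
  have fin: "finite B'" using B(1) by (simp add: B'_def)
  have rep: "\<exists>a. \<forall>x\<in>{0..pi}. u x = (\<Sum>b\<in>B'. a b * b x)" if u: "root_ker Q \<theta> l (Suc k) u" for u
  proof -
    obtain f where f: "root_ker Q \<theta> l k f" "L_op Q \<theta> u (\<lambda>x. l * u x + f x)" using u by auto
    have "\<exists>a. \<forall>x\<in>{0..pi}. f x = (\<Sum>b\<in>B. a b * b x)"
      by (rule mp[OF spec[OF conjunct2[OF conjunct2[OF B_all]]] f(1)])
    then obtain a where a_all: "\<forall>x\<in>{0..pi}. f x = (\<Sum>b\<in>B. a b * b x)" ..
    note a = bspec[OF a_all]
    note uo = L_op_root(1)[OF f(2) root_ker_continuous[OF f(1)]]
    have wsum: "ode_sol (\<lambda>x. Q x - l) (\<lambda>x. \<Sum>b\<in>B. a b * w b x) (\<lambda>x. \<Sum>b\<in>B. a b * p b x)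
        (\<lambda>x. \<Sum>b\<in>B. a b * b x)"
      by (rule s.ode_sol_sum[OF B(1) w])
    define d where "d x = u x - (\<Sum>b\<in>B. a b * w b x)" for x
    define d' where "d' x = ddx u x - (\<Sum>b\<in>B. a b * p b x)" for x
    have "ode_sol (\<lambda>x. Q x - l) d d' (\<lambda>x. f x - (\<Sum>b\<in>B. a b * b x))"
      using ode_sol_lincomb[OF uo wsum, of 1 "-1"]
      by (simp add: d_def[abs_def] d'_def[abs_def])
    then have "ode_sol (\<lambda>x. Q x - l) d d' (\<lambda>x. 0)"
      by (rule ode_sol_cong) (auto simp: a)
    then have dsol: "d x = d 0 * sol_c Q (csqrt l) x + d' 0 * sol_s Q (csqrt l) x" if "x \<in> {0..pi}" for x
      using eq_cs_sol(1)[of "csqrt l" d d' x] that by (simp add: cs_sol_def)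
    define v where "v = (\<Sum>b\<in>B. fun_scale (a b) (t (w b))) + fun_scale (d 0) c + fun_scale (d' 0) s"
    have vx: "v x = (\<Sum>b\<in>B. a b * t (w b) x) + d 0 * c x + d' 0 * s x" for x
    proof -
      have "(\<Sum>b\<in>B. fun_scale (a b) (t (w b))) x = (\<Sum>b\<in>B. a b * t (w b) x)"
        by (induction B rule: infinite_finite_induct) (simp_all add: fun_scale_def)
      then show ?thesis by (simp add: v_def fun_scale_def)
    qed
    have uv: "u x = v x" if x: "x \<in> {0..pi}" for x
    proof -
      have "u x = (\<Sum>b\<in>B. a b * w b x) + d x" by (simp add: d_def)
      then show ?thesis using dsol[OF x] x unfolding vx by (simp add: c_def s_def t_def)
    qed
    have "v \<in> vs.span B'"
      unfolding v_def
      by (intro vs.span_add vs.span_sum vs.span_scale vs.span_base) (auto simp: B'_def)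
    then obtain a' where "v = (\<Sum>b\<in>B'. fun_scale (a' b) b)"
      unfolding vs.span_finite[OF fin] by blast
    then have "v x = (\<Sum>b\<in>B'. a' b * b x)" for x by (simp add: sum_fun_scale_apply)
    then show ?thesis using uv by (intro exI[of _ a']) simp
  qed
  have B': "continuous_on {0..pi} b \<and> (\<forall>x. x \<notin> {0..pi} \<longrightarrow> b x = 0)" if "b \<in> B'" for b
  proof -
    have "continuous_on {0..pi} b"
      using that tc[OF ode_sol_continuous(1)[OF w]] tc[OF ode_sol_continuous(1)[OF sol_c_props(1)]]
        tc[OF ode_sol_continuous(1)[OF sol_s_props(1)]]
      by (auto simp: B'_def c_def s_def)
    moreover have "b x = 0" if "x \<notin> {0..pi}" for x
      using \<open>b \<in> B'\<close> that by (auto simp: B'_def c_def s_def t_def)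
    ultimately show ?thesis by blast
  qed
  show ?case
    by (rule exI[of _ B'], intro conjI[OF fin] conjI[OF ballI[OF B']] allI impI rep)
qed

text \<open>
  The dimension of a space that is not finite-dimensional is \<open>0\<close> by convention, so this includes that the root subspace has
  finite dimension. It has, because the kernels of the powers stop growing at the order of the zero.
\<close>

lemma multiplicity_pos:
  assumes th: "\<theta> \<in> {0, 1}" and mu: "\<mu> \<noteq> 0" "char_det Q \<mu> = 0" "\<exists>z. char_det Q z \<noteq> 0"
    and ef: "eigenfunction Q \<theta> (\<mu>\<^sup>2) u"
  shows "1 \<le> multiplicity_at Q \<theta> (\<mu>\<^sup>2)"
proof -
  interpret vs: vector_space fun_scale by (rule vector_space_fun_scale)
  have "\<not> char_det Q constant_on UNIV"
  proof
    assume "char_det Q constant_on UNIV"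
    then obtain y where "\<And>z. char_det Q z = y" unfolding constant_on_def by blast
    then show False using mu(2,3) by simp
  qed
  then obtain g r n where "0 < n" and g: "0 < r" "ball \<mu> r \<subseteq> UNIV" "g holomorphic_on ball \<mu> r"
      "\<And>z. z \<in> ball \<mu> r \<Longrightarrow> char_det Q z = (z - \<mu>) ^ n * g z"
      "\<And>z. z \<in> ball \<mu> r \<Longrightarrow> g z \<noteq> 0"
    by (rule holomorphic_factor_zero_nonconstant[OF char_det_holomorphic open_UNIV connected_UNIV UNIV_I mu(2)])
      (rule that; simp)
  have g\<mu>: "g \<mu> \<noteq> 0" using g(1,5) by simp
  have "\<exists>B. \<forall>k. finite (B k) \<and> (\<forall>b\<in>B k. continuous_on {0..pi} b \<and> (\<forall>x. x \<notin> {0..pi} \<longrightarrow> b x = 0)) \<and>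
    (\<forall>u. root_ker Q \<theta> (\<mu>\<^sup>2) k u \<longrightarrow> (\<exists>a. \<forall>x\<in>{0..pi}. u x = (\<Sum>b\<in>B k. a b * b x)))"
    by (rule choice, rule allI, rule root_ker_finite_span)
  then obtain B where B_all: "\<forall>k. finite (B k) \<and> (\<forall>b\<in>B k. continuous_on {0..pi} b \<and> (\<forall>x. x \<notin> {0..pi} \<longrightarrow> b x = 0)) \<and>
    (\<forall>u. root_ker Q \<theta> (\<mu>\<^sup>2) k u \<longrightarrow> (\<exists>a. \<forall>x\<in>{0..pi}. u x = (\<Sum>b\<in>B k. a b * b x)))" ..
  then have B: "finite (B k)" "b \<in> B k \<Longrightarrow> x \<notin> {0..pi} \<Longrightarrow> b x = 0" for k b x
    by simp_all
  have B3: "\<exists>a. \<forall>x\<in>{0..pi}. u x = (\<Sum>b\<in>B k. a b * b x)" if "root_ker Q \<theta> (\<mu>\<^sup>2) k u" for k u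
    using spec[OF B_all, of k] that by simp
  define T where "T = (\<Union>k\<le>n. B k)"
  have fin: "finite T" using B(1) by (simp add: T_def)
  have sub: "root_subspace Q \<theta> (\<mu>\<^sup>2) \<subseteq> vs.span T"
  proof
    fix v assume v: "v \<in> root_subspace Q \<theta> (\<mu>\<^sup>2)"
    then have v0: "\<And>x. x \<notin> {0..pi} \<Longrightarrow> v x = 0" unfolding root_subspace_def by blast
    have ex: "\<exists>k. root_ker Q \<theta> (\<mu>\<^sup>2) k v" using v unfolding root_subspace_def by blast
    define k where "k = (LEAST k. root_ker Q \<theta> (\<mu>\<^sup>2) k v)"
    have k: "root_ker Q \<theta> (\<mu>\<^sup>2) k v" unfolding k_def using ex by (rule LeastI_ex)
    have "k \<le> n"
    proof (cases "k = 0")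
      case False
      then have "\<not> root_ker Q \<theta> (\<mu>\<^sup>2) (k - 1) v"
        unfolding k_def by (intro not_less_Least) simp
      then obtain w p where "chain Q \<theta> (\<mu>\<^sup>2) k w p" "\<exists>x\<in>{0..pi}. w 0 x \<noteq> 0"
        using root_ker_chain[OF k] False by auto
      then show ?thesis
        using False by (intro chain_length_le_order[OF _ _ _ th mu(1) g(1,3) g\<mu> g(4)]) simp_all
    qed simp
    obtain a where a: "\<And>x. x \<in> {0..pi} \<Longrightarrow> v x = (\<Sum>b\<in>B k. a b * b x)" using B3[OF k] by blast
    have "v x = (\<Sum>b\<in>B k. a b * b x)" for x
    proof (cases "x \<in> {0..pi}")
      case False
      then have "(\<Sum>b\<in>B k. a b * b x) = 0" using B(2) by (intro sum.neutral) auto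
      then show ?thesis using v0[OF False] by simp
    qed (rule a)
    then have "v = (\<Sum>b\<in>B k. fun_scale (a b) b)" by (auto simp: fun_eq_iff sum_fun_scale_apply)
    moreover have "B k \<subseteq> T" using \<open>k \<le> n\<close> by (auto simp: T_def)
    then have "(\<Sum>b\<in>B k. fun_scale (a b) b) \<in> vs.span T"
      by (intro vs.span_sum vs.span_scale vs.span_base) blast
    ultimately show "v \<in> vs.span T" by simp
  qed
  define u0 where "u0 x = (if x \<in> {0..pi} then u x else 0)" for x
  have Lu: "L_op Q \<theta> u (\<lambda>x. \<mu>\<^sup>2 * u x)" and unz: "\<exists>x\<in>{0..pi}. u x \<noteq> 0"
    using ef unfolding eigenfunction_def by auto
  have "continuous_on {0..pi} (\<lambda>x. \<mu>\<^sup>2 * u x)"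
    using ode_sol_continuous(1)[OF L_op_root(1)[of \<theta> u "\<mu>\<^sup>2" "\<lambda>x. 0"]] Lu
    by (intro continuous_on_mult continuous_on_const) simp
  from L_op_cong[OF Lu this, of u0] have "L_op Q \<theta> u0 (\<lambda>x. \<mu>\<^sup>2 * u0 x + 0)"
    by (simp add: u0_def)
  then have "root_ker Q \<theta> (\<mu>\<^sup>2) (Suc 0) u0" by (auto intro!: exI[of _ "\<lambda>x. 0"])
  moreover have u0_outside: "u0 x = 0" if "x \<notin> {0..pi}" for x
    using that unfolding u0_def by auto
  ultimately have u0: "u0 \<in> root_subspace Q \<theta> (\<mu>\<^sup>2)"
    unfolding root_subspace_def by (intro CollectI conjI allI impI exI[of _ "Suc 0"])
  have u0nz: "u0 \<noteq> 0"
  proof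
    assume "u0 = 0"
    then have "u0 x = 0" for x by simp
    moreover obtain x where "x \<in> {0..pi}" "u x \<noteq> 0" using unz ..
    ultimately show False unfolding u0_def by metis
  qed
  obtain b where b: "b \<subseteq> root_subspace Q \<theta> (\<mu>\<^sup>2)" "vs.independent b"
    "root_subspace Q \<theta> (\<mu>\<^sup>2) \<subseteq> vs.span b" "card b = vs.dim (root_subspace Q \<theta> (\<mu>\<^sup>2))"
    by (rule vs.basis_exists)
  have "b \<subseteq> vs.span T" by (rule order_trans[OF b(1) sub])
  then have "finite b" by (rule conjunct1[OF vs.independent_span_bound[OF fin b(2)]])
  moreover have "b \<noteq> {}"
  proof
    assume "b = {}"
    then have "vs.span b = {0}" by (simp only: vs.span_empty)
    then show False using b(3) u0 u0nz by blast
  qed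
  ultimately have "1 \<le> card b" by (simp add: Suc_leI card_gt_0_iff)
  then show ?thesis unfolding multiplicity_at_def b(4) .
qed

end

section \<open>The principle of uniform boundedness\<close>

text \<open>
  For a vector \<open>d\<close> at which \<open>T\<close> nearly attains its norm, one of \<open>x + d\<close> and \<open>x - d\<close> will do, since \<open>2 T d\<close> is the difference of
  the values there.
\<close>

lemma bounded_linear_almost_attains_norm:
  fixes T :: "'a::real_normed_vector \<Rightarrow> 'b::real_normed_vector"
  assumes T: "bounded_linear T" and r: "0 < r"
  shows "\<exists>y. norm (y - x) \<le> r \<and> 2 / 3 * r * onorm T \<le> norm (T y)"
proof -
  interpret bounded_linear T by (rule T)
  have "\<exists>d. norm d \<le> r \<and> 2 / 3 * r * onorm T \<le> norm (T d)"
  proof (cases "onorm T = 0")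
    case True
    then show ?thesis using r by (intro exI[of _ 0]) simp
  next
    case False
    then have pos: "0 < onorm T" using onorm_pos_le[OF T] by linarith
    have "\<exists>v. 2 / 3 * onorm T * norm v < norm (T v)"
    proof (rule ccontr)
      assume "\<not> ?thesis"
      then have "onorm T \<le> 2 / 3 * onorm T" using pos by (intro onorm_bound) (auto simp: not_less)
      then show False using pos by simp
    qed
    then obtain v where v: "2 / 3 * onorm T * norm v < norm (T v)" by blast
    then have v0: "v \<noteq> 0" using zero by auto
    define d where "d = (r / norm v) *\<^sub>R v"
    have "norm d = r" using v0 r by (simp add: d_def)
    moreover have "norm (T d) = (r / norm v) * norm (T v)" using r by (simp add: d_def scaleR)
    moreover have "(r / norm v) * (2 / 3 * onorm T * norm v) \<le> (r / norm v) * norm (T v)"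
      using v r by (intro mult_left_mono) auto
    ultimately show ?thesis using v0 by (intro exI[of _ d]) (simp add: mult_ac)
  qed
  then obtain d where d: "norm d \<le> r" "2 / 3 * r * onorm T \<le> norm (T d)" by blast
  have "2 * norm (T d) \<le> norm (T (x + d)) + norm (T (x - d))"
    using norm_triangle_ineq4[of "T (x + d)" "T (x - d)"]
    by (simp add: add diff scaleR_2[symmetric])
  then have "norm (T d) \<le> norm (T (x + d)) \<or> norm (T d) \<le> norm (T (x - d))" by linarith
  then show ?thesis
    using d by (elim disjE) (intro exI[of _ "x + d"] exI[of _ "x - d"]; simp)+
qed

text \<open>
  If the norms were unbounded, operators of norm above \<open>4\<^sup>n\<close> would exist. Corrections of size \<open>3\<^sup>-\<^sup>n\<close>, each made so that
  the \<open>n\<close>-th operator is nearly as large as possible, lead to a limit at which the \<open>n\<close>-th operator still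
  exceeds a multiple of \<open>(4/3)\<^sup>n\<close>, since later corrections sum to at most half of the \<open>n\<close>-th.
\<close>

lemma uniform_boundedness_principle:
  fixes T :: "nat \<Rightarrow> 'a::{real_normed_vector,complete_space} \<Rightarrow> 'b::real_normed_vector"
  assumes T: "\<And>k. bounded_linear (T k)" and pt: "\<And>x. \<exists>B. \<forall>k. norm (T k x) \<le> B"
  shows "\<exists>K. \<forall>k. onorm (T k) \<le> K"
proof (rule ccontr)
  assume "\<not> ?thesis"
  then have "\<exists>k. 4 ^ n < onorm (T k)" for n :: nat by (meson not_less)
  then obtain k where k: "\<And>n. 4 ^ n < onorm (T (k n))" by metis
  define S where "S n = T (k n)" for n
  have "\<exists>x. \<forall>n. True \<and> (norm (x (Suc n) - x n) \<le> (1/3) ^ Suc n \<and>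
    2 / 3 * (1/3) ^ Suc n * onorm (S (Suc n)) \<le> norm (S (Suc n) (x (Suc n))))"
  proof (rule dependent_nat_choice)
    fix y n
    have "0 < (1/3 :: real) ^ Suc n" by simp
    from bounded_linear_almost_attains_norm[OF T this, of y "k (Suc n)"]
    show "\<exists>z. True \<and> (norm (z - y) \<le> (1/3) ^ Suc n \<and>
        2 / 3 * (1/3) ^ Suc n * onorm (S (Suc n)) \<le> norm (S (Suc n) z))"
      unfolding S_def by simp
  qed simp
  then obtain x where x: "\<And>n. norm (x (Suc n) - x n) \<le> (1/3) ^ Suc n"
    "\<And>n. 2 / 3 * (1/3) ^ Suc n * onorm (S (Suc n)) \<le> norm (S (Suc n) (x (Suc n)))" by blast
  have tail: "norm (x m - x n) \<le> ((1/3) ^ n - (1/3) ^ m) / 2" if "n \<le> m" for n m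
    using that
  proof (induction m rule: dec_induct)
    case (step m)
    have "norm (x (Suc m) - x n) \<le> norm (x (Suc m) - x m) + norm (x m - x n)"
      using norm_triangle_ineq[of "x (Suc m) - x m" "x m - x n"] by simp
    moreover define c where "c = (1/3 :: real) ^ Suc m"
    moreover have "(1/3 :: real) ^ m = 3 * c" by (simp add: c_def)
    ultimately show ?case using x(1)[of m] step.IH unfolding c_def[symmetric] by simp
  qed simp
  have tail': "norm (x m - x n) \<le> (1/3) ^ n / 2" if "n \<le> m" for n m
    by (rule order_trans[OF tail[OF that]]) (intro divide_right_mono, simp_all)
  have "Cauchy x"
  proof (rule CauchyI)
    fix e :: real assume "0 < e"
    then obtain N where N: "(1/3 :: real) ^ N < e"
      using real_arch_pow_inv[of e "1/3"] by auto
    have "norm (x m - x n) < e" if "N \<le> m" "N \<le> n" for m n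
    proof -
      have "norm (x m - x N) \<le> (1/3) ^ N / 2" "norm (x n - x N) \<le> (1/3) ^ N / 2"
        using tail'[OF that(1)] tail'[OF that(2)] .
      then show ?thesis using norm_triangle_ineq4[of "x m - x N" "x n - x N"] N by simp
    qed
    then show "\<exists>M. \<forall>m\<ge>M. \<forall>n\<ge>M. norm (x m - x n) < e" by blast
  qed
  then obtain y where y: "x \<longlonglongrightarrow> y" using Cauchy_convergent convergent_def by blast
  obtain B where B: "\<And>k. norm (T k y) \<le> B" using pt[of y] by blast
  have lim: "norm (y - x n) \<le> (1/3) ^ n / 2" for n
  proof (rule LIMSEQ_le_const2)
    show "(\<lambda>m. norm (x m - x n)) \<longlonglongrightarrow> norm (y - x n)" by (intro tendsto_intros y)
    show "\<exists>N. \<forall>m\<ge>N. norm (x m - x n) \<le> (1/3) ^ n / 2" using tail' by blast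
  qed
  have bnd: "1 / 6 * (4 / 3) ^ Suc n \<le> B" for n
  proof -
    interpret S: bounded_linear "S (Suc n)" unfolding S_def by (rule T)
    define c where "c = (1/3 :: real) ^ Suc n"
    have "norm (S (Suc n) (y - x (Suc n))) \<le> onorm (S (Suc n)) * norm (y - x (Suc n))"
      unfolding S_def by (rule onorm[OF T])
    also have "\<dots> \<le> onorm (S (Suc n)) * (c / 2)"
      using lim[of "Suc n"] onorm_pos_le[OF T] by (intro mult_left_mono) (auto simp: S_def c_def)
    finally have 1: "norm (S (Suc n) (y - x (Suc n))) \<le> onorm (S (Suc n)) * c / 2" by simp
    have "norm (S (Suc n) (x (Suc n))) \<le> norm (S (Suc n) y) + norm (S (Suc n) (y - x (Suc n)))"
      using norm_triangle_ineq4[of "S (Suc n) y" "S (Suc n) (y - x (Suc n))"] by (simp add: S.diff)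
    then have "2 / 3 * c * onorm (S (Suc n)) \<le> B + onorm (S (Suc n)) * c / 2"
      using x(2)[of n] 1 B[of "k (Suc n)"] by (simp add: S_def c_def)
    then have "1 / 6 * (c * onorm (S (Suc n))) \<le> B" by (simp add: field_simps)
    moreover have "c * 4 ^ Suc n \<le> c * onorm (S (Suc n))"
      using k[of "Suc n"] by (intro mult_left_mono) (auto simp: S_def c_def)
    moreover have "c * 4 ^ Suc n = (4 / 3) ^ Suc n" unfolding c_def by (simp add: field_simps)
    ultimately show ?thesis by linarith
  qed
  obtain n where "6 * B < (4/3 :: real) ^ n" using real_arch_pow[of "4/3" "6 * B"] by auto
  moreover have "(4/3 :: real) ^ n \<le> (4/3) ^ Suc n" by simp
  ultimately show False using bnd[of n] by linarith
qed

section \<open>Square integrable functions\<close>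

lemma leb_0pi_finite: "finite_measure leb_0pi"
  by (rule finite_measure_lebesgue_on) simp

lemma integrable_leb_0pi_const [simp]: "integrable leb_0pi (\<lambda>x. c :: real)"
  by (rule finite_measure.integrable_const[OF leb_0pi_finite])

lemma continuous_leb_0pi:
  fixes f :: "real \<Rightarrow> 'a::euclidean_space"
  assumes "continuous_on {0..pi} f"
  shows "integrable leb_0pi f" "(LINT x|leb_0pi. f x) = integral {0..pi} f" "f \<in> borel_measurable leb_0pi"
proof -
  have "f absolutely_integrable_on {0<..<pi}"
    by (rule set_integrable_subset[OF absolutely_integrable_continuous_real[OF assms]]) auto
  then show i: "integrable leb_0pi f" by (rule absolutely_integrable_imp_integrable) simp
  show "(LINT x|leb_0pi. f x) = integral {0..pi} f"
    by (simp add: lebesgue_integral_eq_integral[OF i] flip: integral_open_interval_real)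
  show "f \<in> borel_measurable leb_0pi" using i by simp
qed

text \<open>
  \<open>|f| \<le> t |f|\<^sup>2 / 2 + 1 / (2 t)\<close> is integrated and \<open>t\<close> chosen optimally; \<open>3\<close> is a convenient bound for \<open>(1 + \<pi>) / 2\<close>.
\<close>

lemma L2_integrable:
  assumes "f \<in> L2"
  shows "integrable leb_0pi f" "(LINT x|leb_0pi. cmod (f x)) \<le> 3 * L2_norm f"
proof -
  have m: "f \<in> borel_measurable leb_0pi" and sq: "integrable leb_0pi (\<lambda>x. (cmod (f x))\<^sup>2)"
    using assms by (auto simp: L2_def)
  have am_gm: "cmod (f x) \<le> t * (cmod (f x))\<^sup>2 / 2 + 1 / (2 * t)" if "0 < t" for t x
  proof -
    have "0 \<le> (t * cmod (f x) - 1)\<^sup>2 / (2 * t)" using that by simp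
    also have "\<dots> = t * (cmod (f x))\<^sup>2 / 2 + 1 / (2 * t) - cmod (f x)"
      using that by (simp add: field_simps power2_eq_square)
    finally show ?thesis by simp
  qed
  have dom: "integrable leb_0pi (\<lambda>x. t * (cmod (f x))\<^sup>2 / 2 + 1 / (2 * t))" for t
    using sq by simp
  show i: "integrable leb_0pi f"
    by (rule Bochner_Integration.integrable_bound[OF dom[of 1] m], rule AE_I2)
      (simp only: real_norm_def order_trans[OF am_gm[of 1] abs_ge_self] zero_less_one)
  have one: "(LINT x|leb_0pi. c) = c * pi" for c :: real
    using continuous_leb_0pi(2)[OF continuous_on_const, of c] by simp
  have le: "(LINT x|leb_0pi. cmod (f x)) \<le> t * (L2_norm f)\<^sup>2 / 2 + pi / (2 * t)" if "0 < t" for t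
  proof -
    have "(LINT x|leb_0pi. cmod (f x)) \<le> (LINT x|leb_0pi. t * (cmod (f x))\<^sup>2 / 2 + 1 / (2 * t))"
      by (rule integral_mono) (use i dom am_gm[OF that] in auto)
    also have "\<dots> = t * (LINT x|leb_0pi. (cmod (f x))\<^sup>2) / 2 + pi / (2 * t)"
      using sq one[of "1 / (2 * t)"] by simp
    finally show ?thesis by (simp add: L2_norm_def)
  qed
  show "(LINT x|leb_0pi. cmod (f x)) \<le> 3 * L2_norm f"
  proof (cases "L2_norm f = 0")
    case True
    have "(LINT x|leb_0pi. cmod (f x)) \<le> 0"
    proof (rule field_le_epsilon)
      fix e :: real assume "0 < e"
      then show "(LINT x|leb_0pi. cmod (f x)) \<le> 0 + e" using le[of "pi / e"] True by simp
    qed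
    then show ?thesis using True by simp
  next
    case False
    moreover have "0 \<le> L2_norm f" by (simp add: L2_norm_def)
    ultimately have N: "0 < L2_norm f" by linarith
    have "(LINT x|leb_0pi. cmod (f x)) \<le> L2_norm f / 2 + pi * L2_norm f / 2"
      using le[of "1 / L2_norm f"] N by (simp add: power2_eq_square)
    also have "pi * L2_norm f \<le> 4 * L2_norm f" using pi_less_4 N by (intro mult_right_mono) auto
    finally show ?thesis using N by simp
  qed
qed

text \<open>
  The triangle inequality up to a factor \<open>2\<close>, which suffices for boundedness arguments.
\<close>

lemma L2_lincomb:
  assumes "f \<in> L2" "g \<in> L2"
  shows "(\<lambda>x. f x + c * g x) \<in> L2"
    and "L2_norm (\<lambda>x. f x + c * g x) \<le> 2 * (L2_norm f + cmod c * L2_norm g)"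
proof -
  have f: "f \<in> borel_measurable leb_0pi" "integrable leb_0pi (\<lambda>x. (cmod (f x))\<^sup>2)"
    and g: "g \<in> borel_measurable leb_0pi" "integrable leb_0pi (\<lambda>x. (cmod (g x))\<^sup>2)"
    using assms by (auto simp: L2_def)
  have pt: "(cmod (f x + c * g x))\<^sup>2 \<le> 2 * (cmod (f x))\<^sup>2 + 2 * (cmod c)\<^sup>2 * (cmod (g x))\<^sup>2" for x
  proof -
    have "(cmod (f x + c * g x))\<^sup>2 \<le> (cmod (f x) + cmod c * cmod (g x))\<^sup>2"
      using norm_triangle_ineq[of "f x" "c * g x"] by (intro power_mono) (auto simp: norm_mult)
    also have "\<dots> \<le> 2 * (cmod (f x))\<^sup>2 + 2 * (cmod c * cmod (g x))\<^sup>2"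
      using sum_squares_bound[of "cmod (f x)" "cmod c * cmod (g x)"]
      by (simp add: power2_eq_square algebra_simps)
    finally show ?thesis by (simp add: power_mult_distrib)
  qed
  have dom: "integrable leb_0pi (\<lambda>x. 2 * (cmod (f x))\<^sup>2 + 2 * (cmod c)\<^sup>2 * (cmod (g x))\<^sup>2)"
    using f g by simp
  have m: "(\<lambda>x. f x + c * g x) \<in> borel_measurable leb_0pi" using f g by measurable
  have i: "integrable leb_0pi (\<lambda>x. (cmod (f x + c * g x))\<^sup>2)"
    by (rule Bochner_Integration.integrable_bound[OF dom]) (use m pt in auto)
  show "(\<lambda>x. f x + c * g x) \<in> L2" using m i by (simp add: L2_def)
  have "(LINT x|leb_0pi. (cmod (f x + c * g x))\<^sup>2)
    \<le> (LINT x|leb_0pi. 2 * (cmod (f x))\<^sup>2 + 2 * (cmod c)\<^sup>2 * (cmod (g x))\<^sup>2)"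
    by (rule integral_mono) (use i dom pt in auto)
  also have "\<dots> = 2 * (L2_norm f)\<^sup>2 + 2 * (cmod c * L2_norm g)\<^sup>2"
    using f g by (simp add: L2_norm_def power_mult_distrib)
  also have "\<dots> \<le> (2 * (L2_norm f + cmod c * L2_norm g))\<^sup>2"
  proof -
    have "0 \<le> L2_norm f" "0 \<le> cmod c * L2_norm g" by (simp_all add: L2_norm_def)
    then have "0 \<le> L2_norm f * (cmod c * L2_norm g)" by simp
    then show ?thesis
      using zero_le_power2[of "L2_norm f"] zero_le_power2[of "cmod c * L2_norm g"]
      by (simp add: power2_eq_square algebra_simps)
  qed
  finally have "sqrt (LINT x|leb_0pi. (cmod (f x + c * g x))\<^sup>2) \<le> 2 * (L2_norm f + cmod c * L2_norm g)"
    by (intro real_le_lsqrt) (auto simp: L2_norm_def)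
  then show "L2_norm (\<lambda>x. f x + c * g x) \<le> 2 * (L2_norm f + cmod c * L2_norm g)"
    by (simp add: L2_norm_def)
qed

lemma L2_norm_scale: "L2_norm (\<lambda>x. c * f x) = cmod c * L2_norm f"
  by (simp add: L2_norm_def norm_mult power_mult_distrib real_sqrt_mult)

lemma L2_partial_sum:
  fixes N :: nat
  assumes "f \<in> L2" "\<And>j. \<phi> j \<in> L2"
  shows "(\<lambda>x. f x - (\<Sum>j<N. a j * \<phi> j x)) \<in> L2"
proof (induction N)
  case 0
  then show ?case using assms(1) by simp
next
  case (Suc N)
  show ?case using L2_lincomb(1)[OF Suc assms(2)[of N], of "- a N"] by (simp add: algebra_simps)
qed

definition pairing :: "(real \<Rightarrow> complex) \<Rightarrow> (real \<Rightarrow> complex) \<Rightarrow> complex"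
  where "pairing f v = (LINT x|leb_0pi. f x * v x)"

lemma pairing_integrable:
  fixes f v :: "real \<Rightarrow> complex"
  assumes f: "integrable leb_0pi f" and v: "continuous_on {0..pi} v"
  shows "integrable leb_0pi (\<lambda>x. f x * v x)"
proof -
  obtain C where C: "\<forall>y\<in>v ` {0..pi}. cmod y \<le> C"
    using compact_imp_bounded[OF compact_continuous_image[OF v compact_Icc]]
    unfolding bounded_iff by blast
  show ?thesis
  proof (rule Bochner_Integration.integrable_bound[of _ "\<lambda>x. C * cmod (f x)"])
    show "integrable leb_0pi (\<lambda>x. C * cmod (f x))" using f by simp
    show "(\<lambda>x. f x * v x) \<in> borel_measurable leb_0pi"
      using f continuous_leb_0pi(3)[OF v] by measurable
    have "cmod (f x) * cmod (v x) \<le> \<bar>C\<bar> * cmod (f x)" if "x \<in> {0<..<pi}" for x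
    proof -
      have "cmod (v x) \<le> C" using C that by auto
      then show ?thesis by (subst mult.commute) (intro mult_right_mono, auto)
    qed
    then show "AE x in leb_0pi. norm (f x * v x) \<le> norm (C * cmod (f x))"
      by (intro AE_I2) (simp add: norm_mult abs_mult)
  qed
qed

lemma pairing_bound:
  assumes f: "f \<in> L2" and v: "continuous_on {0..pi} v" and C: "\<And>x. x \<in> {0..pi} \<Longrightarrow> cmod (v x) \<le> C"
  shows "cmod (pairing f v) \<le> 3 * C * L2_norm f"
proof -
  note i = L2_integrable[OF f]
  have "cmod (pairing f v) \<le> (LINT x|leb_0pi. cmod (f x * v x))"
    unfolding pairing_def by (rule integral_norm_bound)
  also have "\<dots> \<le> (LINT x|leb_0pi. C * cmod (f x))"
  proof (rule integral_mono)
    show "integrable leb_0pi (\<lambda>x. cmod (f x * v x))" using pairing_integrable[OF i(1) v] by simp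
    show "integrable leb_0pi (\<lambda>x. C * cmod (f x))" using i(1) by simp
    show "cmod (f x * v x) \<le> C * cmod (f x)" if "x \<in> space leb_0pi" for x
    proof -
      have "cmod (v x) \<le> C" using that by (intro C) auto
      then show ?thesis unfolding norm_mult by (subst mult.commute) (intro mult_right_mono, auto)
    qed
  qed
  also have "\<dots> = C * (LINT x|leb_0pi. cmod (f x))" by simp
  also have "\<dots> \<le> C * (3 * L2_norm f)"
    using i(2) order_trans[OF norm_ge_zero C[of 0]] by (intro mult_left_mono) auto
  finally show ?thesis by simp
qed

text \<open>
  The pairing with \<open>v\<close> picks the coefficient \<open>a j\<close> out of the expansion of \<open>f\<close>. The terms \<open>a i \<phi>\<^sub>i\<close> of a convergent expansion
  have bounded norms, and the bound does not depend on \<open>v\<close>, \<open>j\<close> and \<open>d\<close>.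
\<close>

lemma schauder_coefficient_bound:
  assumes basis: "schauder_basis_L2 \<phi>" and f: "f \<in> L2"
  shows "\<exists>B\<ge>0. \<forall>v j d. continuous_on {0..pi} v \<and> 0 \<le> d \<and> (\<forall>i. i \<noteq> j \<longrightarrow> pairing (\<phi> i) v = 0) \<and>
      cmod (pairing (\<phi> j) v) \<le> d * L2_norm (\<phi> j) \<longrightarrow> cmod (pairing f v) \<le> B * d"
proof -
  have phi: "\<And>j. \<phi> j \<in> L2" using basis unfolding schauder_basis_L2_def by blast
  obtain a where a: "(\<lambda>N. L2_norm (\<lambda>x. f x - (\<Sum>j<N. a j * \<phi> j x))) \<longlonglongrightarrow> 0"
    using basis f unfolding schauder_basis_L2_def by blast
  define R where "R N = (\<lambda>x. f x - (\<Sum>j<N. a j * \<phi> j x))" for N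
  have RL: "R N \<in> L2" for N unfolding R_def by (rule L2_partial_sum[OF f phi])
  have lim: "(\<lambda>N. L2_norm (R N)) \<longlonglongrightarrow> 0" using a by (simp add: R_def)
  then have "Bseq (\<lambda>N. L2_norm (R N))" by (intro convergent_imp_Bseq convergentI)
  then obtain K where "\<forall>N. norm (L2_norm (R N)) \<le> K" by (rule BseqE)
  then have K: "L2_norm (R N) \<le> K" for N using abs_ge_self order_trans by fastforce
  have K0: "0 \<le> K" using order_trans[OF _ K[of 0]] by (simp add: L2_norm_def)
  have coef: "cmod (a N) * L2_norm (\<phi> N) \<le> 4 * K" for N
  proof -
    have eq: "(\<lambda>x. a N * \<phi> N x) = (\<lambda>x. R N x + (-1) * R (Suc N) x)" by (simp add: R_def)
    have "cmod (a N) * L2_norm (\<phi> N) = L2_norm (\<lambda>x. a N * \<phi> N x)" by (rule L2_norm_scale[symmetric])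
    also have "\<dots> = L2_norm (\<lambda>x. R N x + (-1) * R (Suc N) x)" by (simp only: eq)
    also have "\<dots> \<le> 2 * (L2_norm (R N) + cmod (-1) * L2_norm (R (Suc N)))"
      by (rule L2_lincomb(2)[OF RL RL])
    finally have "cmod (a N) * L2_norm (\<phi> N) \<le> 2 * (L2_norm (R N) + cmod (-1) * L2_norm (R (Suc N)))" .
    then show ?thesis using K[of N] K[of "Suc N"] by simp
  qed
  show ?thesis
  proof (intro exI[of _ "4 * K"] conjI allI impI)
    show "0 \<le> 4 * K" using K0 by simp
    fix v j d
    assume "continuous_on {0..pi} v \<and> 0 \<le> d \<and> (\<forall>i. i \<noteq> j \<longrightarrow> pairing (\<phi> i) v = 0) \<and>
      cmod (pairing (\<phi> j) v) \<le> d * L2_norm (\<phi> j)"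
    then have v: "continuous_on {0..pi} v" and d: "0 \<le> d" and orth: "\<And>i. i \<noteq> j \<Longrightarrow> pairing (\<phi> i) v = 0"
      and pj: "cmod (pairing (\<phi> j) v) \<le> d * L2_norm (\<phi> j)" by auto
    obtain C where C: "\<forall>y\<in>v ` {0..pi}. cmod y \<le> C"
      using compact_imp_bounded[OF compact_continuous_image[OF v compact_Icc]]
      unfolding bounded_iff by blast
    note int = pairing_integrable[OF L2_integrable(1) v]
    have pR: "pairing (R N) v = pairing f v - (\<Sum>i<N. a i * pairing (\<phi> i) v)" for N
    proof -
      have "R N x * v x = f x * v x - (\<Sum>i<N. a i * (\<phi> i x * v x))" for x
        by (simp add: R_def algebra_simps sum_distrib_left)
      then show ?thesis unfolding pairing_def using int[OF f] int[OF phi] by simp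
    qed
    have sum: "(\<Sum>i<N. a i * pairing (\<phi> i) v) = a j * pairing (\<phi> j) v" if "j < N" for N
    proof -
      have "(\<Sum>i<N. a i * pairing (\<phi> i) v) = (\<Sum>i<N. if i = j then a j * pairing (\<phi> j) v else 0)"
        using orth by (intro sum.cong) auto
      then show ?thesis using that by simp
    qed
    have "(\<lambda>N. pairing (R N) v) \<longlonglongrightarrow> 0"
    proof (rule tendsto_norm_zero_cancel, rule real_tendsto_sandwich[where f = "\<lambda>_. 0" and h = "\<lambda>N. 3 * C * L2_norm (R N)"])
      show "\<forall>\<^sub>F N in sequentially. norm (pairing (R N) v) \<le> 3 * C * L2_norm (R N)"
        using pairing_bound[OF RL v, of C] C by (intro always_eventually) auto
      show "(\<lambda>N. 3 * C * L2_norm (R N)) \<longlonglongrightarrow> 0" using tendsto_mult_right_zero[OF lim] .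
    qed auto
    moreover have "\<forall>\<^sub>F N in sequentially. pairing (R N) v = pairing f v - a j * pairing (\<phi> j) v"
      using eventually_gt_at_top[of j] by eventually_elim (simp add: pR sum)
    ultimately have "(\<lambda>N. pairing f v - a j * pairing (\<phi> j) v) \<longlonglongrightarrow> 0"
      by (rule Lim_transform_eventually)
    then have eq: "pairing f v = a j * pairing (\<phi> j) v" by (simp add: LIMSEQ_const_iff)
    have "cmod (pairing f v) \<le> cmod (a j) * (d * L2_norm (\<phi> j))"
      unfolding eq norm_mult by (intro mult_left_mono pj) auto
    also have "\<dots> = (cmod (a j) * L2_norm (\<phi> j)) * d" by simp
    also have "\<dots> \<le> 4 * K * d" by (intro mult_right_mono coef d)
    finally show "cmod (pairing f v) \<le> 4 * K * d" .
  qed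
qed

lemma continuous_in_L2:
  assumes "continuous_on {0..pi} f"
  shows "f \<in> L2"
proof -
  have "integrable leb_0pi (\<lambda>x. (cmod (f x))\<^sup>2)"
    by (intro continuous_leb_0pi(1) continuous_on_power continuous_on_norm assms)
  then show ?thesis using continuous_leb_0pi(3)[OF assms] by (simp add: L2_def)
qed

text \<open>
  The functionals \<open>f \<mapsto> \<integral>f v\<^sub>k / d\<^sub>k\<close> on bounded continuous functions are pointwise bounded, hence bounded in norm. At the
  conjugate of \<open>v\<^sub>k\<close>, whose supremum norm is at most \<open>C\<close>, they are at least \<open>1 / (4 d\<^sub>k)\<close>.
\<close>

lemma pairing_uniformly_bounded_below:
  fixes v :: "nat \<Rightarrow> real \<Rightarrow> complex" and d :: "nat \<Rightarrow> real"
  assumes v: "\<And>k. continuous_on {0..pi} (v k)" and C: "\<And>k x. x \<in> {0..pi} \<Longrightarrow> cmod (v k x) \<le> C"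
    and low: "\<And>k. 1 / 4 \<le> integral {0..pi} (\<lambda>x. (cmod (v k x))\<^sup>2)"
    and d: "\<And>k. 0 < d k"
    and bound: "\<And>f. f \<in> L2 \<Longrightarrow> \<exists>B. \<forall>k. cmod (pairing f (v k)) \<le> B * d k"
  shows "\<exists>c>0. \<forall>k. c \<le> d k"
proof -
  have C0: "0 \<le> C" using order_trans[OF norm_ge_zero C[of 0]] by simp
  define T where "T k f = (1 / d k) *\<^sub>R pairing (apply_bcontfun f) (v k)" for k and f :: "real \<Rightarrow>\<^sub>C complex"
  have fc: "continuous_on {0..pi} (apply_bcontfun f)" for f :: "real \<Rightarrow>\<^sub>C complex" by simp
  have int: "integrable leb_0pi (\<lambda>x. apply_bcontfun f x * v k x)" for f k
    by (intro pairing_integrable continuous_leb_0pi(1) fc v)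
  have one: "(LINT x|leb_0pi. c) = c * pi" for c :: real
    using continuous_leb_0pi(2)[OF continuous_on_const, of c] by simp
  have bl: "bounded_linear (T k)" for k
  proof (rule bounded_linear_intro)
    show "T k (f + g) = T k f + T k g" for f g
      using int[of f k] int[of g k] by (simp add: T_def pairing_def distrib_right scaleR_add_right)
    show "T k (r *\<^sub>R f) = r *\<^sub>R T k f" for r f
      by (simp add: T_def pairing_def)
    show "norm (T k f) \<le> norm f * (C * pi / d k)" for f
    proof -
      have "cmod (pairing (apply_bcontfun f) (v k)) \<le> (LINT x|leb_0pi. norm f * C)"
        unfolding pairing_def
      proof (rule order_trans[OF integral_norm_bound integral_mono])
        show "integrable leb_0pi (\<lambda>x. cmod (apply_bcontfun f x * v k x))" using int by simp
        show "cmod (apply_bcontfun f x * v k x) \<le> norm f * C" if "x \<in> space leb_0pi" for x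
          unfolding norm_mult using that C by (intro mult_mono norm_bounded) auto
      qed simp
      then show ?thesis using d[of k] unfolding one T_def by (simp add: field_simps)
    qed
  qed
  have "\<exists>K. \<forall>k. onorm (T k) \<le> K"
  proof (rule uniform_boundedness_principle[OF bl])
    fix f :: "real \<Rightarrow>\<^sub>C complex"
    obtain B where B: "\<And>k. cmod (pairing (apply_bcontfun f) (v k)) \<le> B * d k"
      using bound[OF continuous_in_L2[OF fc]] by blast
    have "norm (T k f) \<le> B" for k using B[of k] d[of k] by (simp add: T_def field_simps)
    then show "\<exists>B. \<forall>k. norm (T k f) \<le> B" by blast
  qed
  then obtain K where K: "\<And>k. onorm (T k) \<le> K" by blast
  define W where "W = (\<bar>K\<bar> + 1) * (C + 1)"
  have pos: "0 < W" using C0 by (simp add: W_def)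
  have main: "1 / 4 \<le> d k * W" for k
  proof -
    define g where "g x = cnj (v k x)" for x
    have gc: "continuous_on (cbox 0 pi) g" unfolding g_def by (intro continuous_intros) (simp add: v)
    obtain G :: "real \<Rightarrow>\<^sub>C complex" where G: "\<And>x. x \<in> cbox 0 pi \<Longrightarrow> apply_bcontfun G x = g x"
      "\<And>x. apply_bcontfun G x = g (clamp 0 pi x)"
      using continuous_on_cbox_bcontfunE[OF gc] by metis
    have "norm G \<le> C"
    proof (rule norm_bound)
      fix x :: real
      have "clamp 0 pi x \<in> cbox 0 pi" by (rule clamp_in_interval) simp
      then show "norm (apply_bcontfun G x) \<le> C" unfolding G(2) g_def using C by simp
    qed
    have "pairing (apply_bcontfun G) (v k) = integral {0..pi} (\<lambda>x. apply_bcontfun G x * v k x)"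
      unfolding pairing_def by (rule continuous_leb_0pi(2)) (intro continuous_on_mult fc v)
    also have "\<dots> = integral {0..pi} (\<lambda>x. complex_of_real ((cmod (v k x))\<^sup>2))"
    proof (rule integral_cong)
      fix x assume "x \<in> {0..pi}"
      then have "apply_bcontfun G x = cnj (v k x)" using G(1)[of x] by (simp add: g_def)
      then show "apply_bcontfun G x * v k x = complex_of_real ((cmod (v k x))\<^sup>2)"
        unfolding complex_norm_square by (simp add: mult.commute)
    qed
    also have "\<dots> = complex_of_real (integral {0..pi} (\<lambda>x. (cmod (v k x))\<^sup>2))"
      by (rule integral_unique, rule has_integral_of_real, rule integrable_integral)
        (intro integrable_continuous_real continuous_intros v)
    finally have "1 / 4 \<le> cmod (pairing (apply_bcontfun G) (v k))"
      using low[of k] by simp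
    also have "\<dots> = d k * norm (T k G)" using d[of k] by (simp add: T_def)
    also have "norm (T k G) \<le> W"
    proof -
      have "norm (T k G) \<le> onorm (T k) * norm G" by (rule onorm[OF bl])
      also have "\<dots> \<le> W" unfolding W_def
        using K[of k] \<open>norm G \<le> C\<close> C0 by (intro mult_mono) auto
      finally show ?thesis .
    qed
    finally show ?thesis using d[of k] by simp
  qed
  have "1 / (4 * W) \<le> d k" for k
  proof -
    have "1 \<le> d k * (4 * W)" using main[of k] by simp
    then show ?thesis using pos by (subst pos_divide_le_eq) simp_all
  qed
  then show ?thesis using pos by (intro exI[of _ "1 / (4 * W)"]) simp
qed

section \<open>Blocks and the growth of multiplicities\<close>

text \<open>
  The hypothesis excludes that the blocks are exhausted after finitely many terms.
\<close>

lemma concat_blocks_cover: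
  fixes m :: "nat \<Rightarrow> nat"
  assumes "\<And>n. n \<le> (\<Sum>i\<le>n. m i)"
  shows "\<exists>n h. h < m n \<and> j = (\<Sum>i<n. m i) + h"
proof -
  have ex: "\<exists>n. j < (\<Sum>i\<le>n. m i)" using assms[of "Suc j"] by (intro exI[of _ "Suc j"]) simp
  define n where "n = (LEAST n. j < (\<Sum>i\<le>n. m i))"
  have n: "j < (\<Sum>i\<le>n. m i)" unfolding n_def using ex by (rule LeastI_ex)
  have low: "(\<Sum>i<n. m i) \<le> j"
  proof (cases n)
    case (Suc n')
    then have "\<not> j < (\<Sum>i\<le>n'. m i)" unfolding n_def by (intro not_less_Least) simp
    then show ?thesis using Suc by (simp add: lessThan_Suc_atMost)
  qed simp
  have "(\<Sum>i\<le>n. m i) = (\<Sum>i<n. m i) + m n" by (simp flip: lessThan_Suc_atMost)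
  then have "j - (\<Sum>i<n. m i) < m n" using n low by linarith
  then show ?thesis using low by (intro exI[of _ n] exI[of _ "j - (\<Sum>i<n. m i)"]) simp
qed

lemma sum_at_least_index:
  fixes m :: "nat \<Rightarrow> nat"
  assumes "\<And>i. i \<noteq> i0 \<Longrightarrow> 1 \<le> m i"
  shows "n \<le> (\<Sum>i\<le>n. m i)"
proof -
  have "n \<le> card ({..n} - {i0})" by (cases "i0 \<in> {..n}") simp_all
  also have "\<dots> = (\<Sum>i\<in>{..n} - {i0}. 1)" by simp
  also have "\<dots> \<le> (\<Sum>i\<in>{..n} - {i0}. m i)" using assms by (intro sum_mono) auto
  also have "\<dots> \<le> (\<Sum>i\<le>n. m i)" by (intro sum_mono2) auto
  finally show ?thesis .
qed

text \<open>
  For large \<open>k\<close>, \<open>m k * ln A\<close> is at most a quarter of \<open>ln |z\<^sub>k\<^sup>2|\<close>.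
\<close>

lemma eventually_power_le_sqrt:
  fixes m :: "nat \<Rightarrow> nat" and z :: "nat \<Rightarrow> complex"
  assumes lim: "(\<lambda>k. real (m k) / ln (cmod ((z k)\<^sup>2))) \<longlonglongrightarrow> 0"
    and large: "\<And>R. \<forall>\<^sub>F k in sequentially. R < cmod (z k)" and A: "1 \<le> A"
  shows "\<forall>\<^sub>F k in sequentially. A ^ m k \<le> sqrt (cmod (z k))"
proof -
  define t where "t = ln A + 1"
  define e where "e = 1 / (4 * t)"
  have lA: "0 \<le> ln A" using A by simp
  have t: "0 < t" "ln A \<le> t" using lA by (auto simp: t_def)
  have e: "0 < e" using t by (simp add: e_def)
  have "\<forall>\<^sub>F k in sequentially. norm (real (m k) / ln (cmod ((z k)\<^sup>2))) < e"
    using lim e unfolding tendsto_iff by (simp add: dist_norm)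
  then show ?thesis using large[of 1]
  proof eventually_elim
    case (elim k)
    define L where "L = ln (cmod (z k))"
    have L: "0 < L" unfolding L_def by (rule ln_gt_zero[OF elim(2)])
    have z0: "0 < cmod (z k)" using elim(2) by linarith
    have "ln (cmod ((z k)\<^sup>2)) = 2 * L" using z0 by (simp add: norm_power L_def ln_realpow)
    then have "real (m k) / (2 * L) < e" using elim(1) L by simp
    then have "real (m k) < e * (2 * L)" using L by (simp add: divide_less_eq)
    then have "real (m k) * ln A \<le> e * (2 * L) * ln A" using lA by (intro mult_right_mono) auto
    also have "e * (2 * L) * ln A = L / 2 * (ln A / t)" by (simp add: e_def)
    also have "\<dots> \<le> L / 2 * 1"
      using L t by (intro mult_left_mono) (auto simp: divide_le_eq)
    finally have "real (m k) * ln A \<le> L / 2" by simp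
    then have "exp (real (m k) * ln A) \<le> exp (L / 2)" by simp
    moreover have "exp (real (m k) * ln A) = A ^ m k"
      using A by (simp add: exp_of_nat_mult)
    moreover have "exp (L / 2) = sqrt (cmod (z k))"
    proof -
      have "exp (L / 2) ^ 2 = cmod (z k)" using z0 by (simp add: L_def flip: exp_of_nat_mult)
      then show ?thesis by (metis exp_ge_zero real_sqrt_unique)
    qed
    ultimately show ?case by simp
  qed
qed

theorem theorem3:
  fixes \<theta> :: nat and q :: "real \<Rightarrow> complex"
    and \<mu> :: "nat \<Rightarrow> complex" and M :: real and r :: "nat \<Rightarrow> nat"
    and u :: "nat \<Rightarrow> nat \<Rightarrow> real \<Rightarrow> complex"
  assumes "\<theta> \<in> {0, 1}"
    and "integrable (lebesgue_on {0<..<pi}) q"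
    and "continuous_on {0<..<pi} q"
    and "\<exists>z. char_det q z \<noteq> 0"
    and "\<forall>n. Re (\<mu> n) \<ge> 0"
    and "inj (\<lambda>n. (\<mu> n)\<^sup>2)"
    and "range (\<lambda>n. (\<mu> n)\<^sup>2) = eigenvalues q"
    and "mono (\<lambda>n. cmod ((\<mu> n)\<^sup>2))"
    and "strict_mono r"
    and "\<forall>k. \<bar>Im (\<mu> (r k))\<bar> < M"
    and "(\<lambda>k. real (multiplicity_at q \<theta> ((\<mu> (r k))\<^sup>2)) / ln (cmod ((\<mu> (r k))\<^sup>2))) \<longlonglongrightarrow> 0"
    and "\<forall>n. canonical_system q \<theta> ((\<mu> n)\<^sup>2) (u n)"
  shows "\<not> schauder_basis_L2 (concat_blocks (\<lambda>n. multiplicity_at q \<theta> ((\<mu> n)\<^sup>2)) u)"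
proof
  define m where "m n = multiplicity_at q \<theta> ((\<mu> n)\<^sup>2)" for n
  define \<phi> where "\<phi> = concat_blocks m u"
  assume "schauder_basis_L2 (concat_blocks (\<lambda>n. multiplicity_at q \<theta> ((\<mu> n)\<^sup>2)) u)"
  then have basis: "schauder_basis_L2 \<phi>" by (simp add: \<phi>_def m_def[abs_def])
  have th: "\<theta> \<in> {0, 1}" by fact
  have "q absolutely_integrable_on {0<..<pi}"
    using assms(2) by (simp add: set_integrable_def integrable_restrict_space)
  then have "q absolutely_integrable_on {0..pi}"
    using absolutely_integrable_on_open_interval[where f = q and a = 0 and b = pi] by (simp add: box_real)
  then interpret potential q using assms(3) by unfold_locales
  have \<mu>_inj: "n = n'" if "(\<mu> n)\<^sup>2 = (\<mu> n')\<^sup>2" for n n' using assms(6) that by (rule injD)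
  have cd_even: "char_det q (- z) = char_det q z" for z
    by (simp add: char_det_def sol_c_def sol_s_def)
  have det0: "char_det q (\<mu> n) = 0" for n
  proof -
    have "(\<mu> n)\<^sup>2 \<in> eigenvalues q" using assms(7) by blast
    then obtain z where z: "(\<mu> n)\<^sup>2 = z\<^sup>2" "char_det q z = 0" unfolding eigenvalues_def by blast
    then have "\<mu> n = z \<or> \<mu> n = - z" by (simp add: power2_eq_iff)
    then show ?thesis using z(2) cd_even by auto
  qed
  have ch: "chain q \<theta> ((\<mu> n)\<^sup>2) (max 1 (m n)) (u n) (\<lambda>i. ddx (u n i))" for n
    unfolding m_def using assms(12) by (intro canonical_system_chain) blast
  have ef: "eigenfunction q \<theta> ((\<mu> n)\<^sup>2) (u n 0)" for n
    using assms(12) unfolding canonical_system_def by blast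
  have m_pos: "1 \<le> m n" if "\<mu> n \<noteq> 0" for n
    unfolding m_def by (rule multiplicity_pos[OF th that det0 assms(4) ef])
  \<comment> \<open>At most one eigenvalue is \<open>0\<close>; for it the multiplicity is left open.\<close>
  obtain i0 where i0: "\<And>i. i \<noteq> i0 \<Longrightarrow> \<mu> i \<noteq> 0"
  proof (cases "\<exists>i. \<mu> i = 0")
    case True
    then obtain i0 where "\<mu> i0 = 0" ..
    then have "\<mu> i \<noteq> 0" if "i \<noteq> i0" for i using \<mu>_inj[of i i0] that by auto
    then show ?thesis by (rule that)
  next
    case False
    then show ?thesis by (intro that[of 0]) blast
  qed
  have cover: "\<exists>n h. h < m n \<and> j = (\<Sum>i<n. m i) + h" for j
    by (rule concat_blocks_cover, rule sum_at_least_index[of i0], rule m_pos, rule i0)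
  \<comment> \<open>the eigenvalues tend to infinity\<close>
  have large: "\<forall>\<^sub>F k in sequentially. R < cmod (\<mu> (r k))" for R
  proof -
    have "\<not> char_det q constant_on UNIV"
    proof
      assume "char_det q constant_on UNIV"
      then obtain y where "\<And>z. char_det q z = y" unfolding constant_on_def by blast
      then show False using det0[of 0] assms(4) by simp
    qed
    then have fin: "finite {z \<in> cball 0 R. char_det q z = 0}"
      by (intro holomorphic_compact_finite_zeros[OF char_det_holomorphic]) auto
    have "inj (\<lambda>k. \<mu> (r k))"
    proof (rule injI)
      fix k k' assume "\<mu> (r k) = \<mu> (r k')"
      then have "r k = r k'" by (intro \<mu>_inj) simp
      then show "k = k'" using strict_mono_eq[OF assms(9)] by blast
    qed
    then have "finite ((\<lambda>k. \<mu> (r k)) -` {z \<in> cball 0 R. char_det q z = 0})"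
      by (intro finite_vimageI fin)
    moreover have "{k. \<not> R < cmod (\<mu> (r k))} \<subseteq> (\<lambda>k. \<mu> (r k)) -` {z \<in> cball 0 R. char_det q z = 0}"
      using det0 by auto
    ultimately have "finite {k. \<not> R < cmod (\<mu> (r k))}" by (rule finite_subset[rotated])
    then show ?thesis by (simp add: cofinite_eq_sequentially[symmetric] eventually_cofinite)
  qed
  have lim: "(\<lambda>k. real (m (r k)) / ln (cmod ((\<mu> (r k))\<^sup>2))) \<longlonglongrightarrow> 0"
    using assms(11) by (simp add: m_def)
  note pow = eventually_power_le_sqrt[OF lim large]
  define M' where "M' = \<bar>M\<bar>"
  have M': "0 \<le> M'" "\<And>k. \<bar>Im (\<mu> (r k))\<bar> \<le> M'"
    using assms(10) by (auto simp: M'_def intro: order_trans[OF less_imp_le])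
  define D' where "D' = 2 * pert * exp (2 * pi * M')"
  have D': "0 \<le> D'" using pert_nonneg by (simp add: D'_def)
  define KC where "KC = chain_const M' D'"
  have KC: "1 \<le> KC"
  proof -
    have C0: "0 \<le> circle_const D'" using pert_nonneg D' by (simp add: circle_const_def)
    have "1 * 1 * 1 * 1 * 1 * 1 \<le> 4 * (24 * (M' + 4))\<^sup>2 * (8 * (M' + 3)) * (1 + pert) * (1 + circle_const D') * exp (2 * pi * (M' + 1))"
      using M'(1) pert_nonneg C0 by (intro mult_mono one_le_power) auto
    then show ?thesis by (simp add: KC_def chain_const_def)
  qed
  define c1 where "c1 = 4 * ((pert + D' * (1 + pert)) * exp (2 * pi * M'))"
  have good: "\<forall>\<^sub>F k in sequentially.
      2 * real (m (r k)) + 2 * M' + 2 + 2 * (24 * (M' + 4)) ^ m (r k) * pert \<le> cmod (\<mu> (r k)) \<and>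
      KC ^ m (r k) \<le> sqrt (cmod (\<mu> (r k))) \<and> D' \<le> cmod (\<mu> (r k)) \<and> c1 \<le> cmod (\<mu> (r k)) \<and>
      M' + 1 \<le> cmod (\<mu> (r k)) \<and> 1 \<le> cmod (\<mu> (r k))"
  proof -
    define b where "b = 2 + 2 * pert + (2 * M' + 2)"
    have b: "0 \<le> b" using pert_nonneg M'(1) by (simp add: b_def)
    have "1 \<le> 24 * (M' + 4)" using M'(1) by simp
    note ev = pow[of 2] pow[OF this] pow[OF KC] large[of "b\<^sup>2"] large[of D'] large[of c1]
      large[of "M' + 1"] large[of 1]
    show ?thesis
      using ev(1)[OF one_le_numeral] ev(2-8)
    proof eventually_elim
      case (elim k)
      define s where "s = sqrt (cmod (\<mu> (r k)))"
      have s1: "1 \<le> s" unfolding s_def using elim(8) by simp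
      have ss: "s * s = cmod (\<mu> (r k))" by (simp add: s_def)
      have "sqrt (b\<^sup>2) < s" unfolding s_def by (rule real_sqrt_less_mono[OF elim(4)])
      then have sb: "b \<le> s" using b by simp
      have "real (m (r k)) \<le> 2 ^ m (r k)" by (rule less_imp_le[OF of_nat_less_two_power])
      moreover have "2 ^ m (r k) \<le> s" using elim(1) by (simp add: s_def)
      ultimately have "2 * real (m (r k)) \<le> 2 * s" by linarith
      moreover have "2 * (24 * (M' + 4)) ^ m (r k) * pert \<le> 2 * s * pert"
        using elim(2) pert_nonneg by (intro mult_right_mono mult_left_mono) (auto simp: s_def)
      moreover have "2 * M' + 2 \<le> (2 * M' + 2) * s"
        using mult_left_mono[OF s1, of "2 * M' + 2"] M'(1) by simp
      ultimately have "2 * real (m (r k)) + 2 * M' + 2 + 2 * (24 * (M' + 4)) ^ m (r k) * pert \<le> b * s"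
        by (simp add: b_def algebra_simps)
      also have "\<dots> \<le> s * s" using sb s1 by (intro mult_right_mono) auto
      finally show ?case using elim ss by (simp add: s_def)
    qed
  qed
  then obtain k0 where k0: "\<And>k. k0 \<le> k \<Longrightarrow>
      2 * real (m (r k)) + 2 * M' + 2 + 2 * (24 * (M' + 4)) ^ m (r k) * pert \<le> cmod (\<mu> (r k)) \<and>
      KC ^ m (r k) \<le> sqrt (cmod (\<mu> (r k))) \<and> D' \<le> cmod (\<mu> (r k)) \<and> c1 \<le> cmod (\<mu> (r k)) \<and>
      M' + 1 \<le> cmod (\<mu> (r k)) \<and> 1 \<le> cmod (\<mu> (r k))"
    unfolding eventually_sequentially by blast
  define N where "N k = r (k + k0)" for k
  define z where "z k = \<mu> (N k)" for k
  have big: "2 * real (m (N k)) + 2 * M' + 2 + 2 * (24 * (M' + 4)) ^ m (N k) * pert \<le> cmod (z k)"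
    "KC ^ m (N k) \<le> sqrt (cmod (z k))" "D' \<le> cmod (z k)" "c1 \<le> cmod (z k)" "M' + 1 \<le> cmod (z k)" "1 \<le> cmod (z k)" for k
    using k0[of "k + k0"] by (simp_all add: N_def z_def)
  have Imz: "\<bar>Im (z k)\<bar> \<le> M'" for k unfolding z_def N_def by (rule M'(2))
  have Rez0: "0 \<le> Re (z k)" for k using assms(5) by (simp add: z_def)
  have Rez: "1 \<le> Re (z k)" for k
    using cmod_le[of "z k"] Rez0[of k] Imz[of k] big(5)[of k] by simp
  have mN: "1 \<le> m (N k)" for k
    using big(6)[of k] by (intro m_pos) (auto simp: z_def)
  have "\<exists>\<kappa>. cmod \<kappa> \<le> D' / cmod (z k) \<and> bc_der \<theta> (solA' \<theta> \<kappa> (z k)) = 0 \<and> bc_val \<theta> (solA \<theta> \<kappa> (z k)) = 0" for k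
    unfolding D'_def
    by (rule adjoint_eigenfunction_exists[OF th _ Imz big(6)]) (use big(3)[of k] det0 in \<open>auto simp: z_def D'_def\<close>)
  then obtain \<kappa> where \<kappa>: "\<And>k. cmod (\<kappa> k) \<le> D' / cmod (z k)"
    "\<And>k. bc_der \<theta> (solA' \<theta> (\<kappa> k) (z k)) = 0" "\<And>k. bc_val \<theta> (solA \<theta> (\<kappa> k) (z k)) = 0" by metis
  define v where "v k = solA \<theta> (\<kappa> k) (z k)" for k
  \<comment> \<open>The factor \<open>3\<close> passes from the \<open>L\<^sub>1\<close> norm in the estimate to the \<open>L\<^sub>2\<close> norm.\<close>
  define d where "d k = 3 * KC ^ m (N k) / cmod (z k)" for k
  have vc: "continuous_on {0..pi} (v k)" for k
    unfolding v_def by (rule ode_sol_continuous(1)[OF solA_ode])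
  have d_pos: "0 < d k" for k
  proof -
    have "0 < cmod (z k)" using big(6)[of k] by linarith
    then show ?thesis using KC by (simp add: d_def)
  qed
  have uc: "continuous_on {0..pi} (u n h)" if "h < max 1 (m n)" for n h
    using ch[of n] that ode_sol_continuous(1) unfolding chain_def by blast
  have pair: "pairing (u n h) (v k) = integral {0..pi} (\<lambda>x. u n h x * v k x)" if "h < max 1 (m n)" for n h k
    unfolding pairing_def by (rule continuous_leb_0pi(2)) (intro continuous_on_mult uc that vc)
  \<comment> \<open>the position of the last function of the block of \<open>z\<^sub>k\<^sup>2\<close>\<close>
  define J where "J k = (\<Sum>i<N k. m i) + (m (N k) - 1)" for k
  have \<phi>J: "\<phi> (J k) = u (N k) (m (N k) - 1)" for k
    unfolding \<phi>_def J_def using mN[of k] by (intro concat_blocks_eq) simp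
  have orth: "pairing (\<phi> j) (v k) = 0" if j: "j \<noteq> J k" for j k
  proof -
    obtain n h where h: "h < m n" "j = (\<Sum>i<n. m i) + h" using cover by blast
    have h1: "h < max 1 (m n)" using h(1) by simp
    have "\<phi> j = u n h" unfolding \<phi>_def h(2) by (rule concat_blocks_eq) (rule h(1))
    moreover have "(\<mu> n)\<^sup>2 \<noteq> (z k)\<^sup>2 \<or> Suc h < max 1 (m n)"
    proof (rule disjCI)
      assume "\<not> Suc h < max 1 (m n)"
      then have "h = m n - 1" using h(1) by linarith
      then have "n \<noteq> N k" using j h(2) by (auto simp: J_def)
      then show "(\<mu> n)\<^sup>2 \<noteq> (z k)\<^sup>2" unfolding z_def using \<mu>_inj by blast
    qed
    then have "integral {0..pi} (\<lambda>x. u n h x * v k x) = 0"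
      unfolding v_def by (rule chain_pairing_zero[OF ch solA_ode \<kappa>(2,3) h1])
    ultimately show ?thesis using pair[OF h1] by simp
  qed
  have last: "cmod (pairing (\<phi> (J k)) (v k)) \<le> d k * L2_norm (\<phi> (J k))" for k
  proof -
    define h where "h = m (N k) - 1"
    have h: "h < max 1 (m (N k))" using mN[of k] by (simp add: h_def)
    have mm: "max 1 (m (N k)) = m (N k)" using mN[of k] by simp
    have big1: "real (2 * m (N k)) + 2 * M' + 2 + 2 * (24 * (M' + 4)) ^ m (N k) * pert \<le> cmod (z k)"
      using big(1)[of k] by simp
    have "cmod (integral {0..pi} (\<lambda>x. u (N k) (m (N k) - 1) x * solA \<theta> (\<kappa> k) (z k) x))
      \<le> KC ^ m (N k) / cmod (z k) * integral {0..pi} (\<lambda>x. cmod (u (N k) (m (N k) - 1) x))"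
      unfolding KC_def
      by (rule chain_top_pairing_estimate[OF th ch[of "N k", unfolded mm, folded z_def] mN M'(1) Imz Rez0 big1 \<kappa>(1) D'])
    also have "\<dots> \<le> KC ^ m (N k) / cmod (z k) * (3 * L2_norm (u (N k) h))"
    proof (rule mult_left_mono)
      have "integral {0..pi} (\<lambda>x. cmod (u (N k) h x)) = (LINT x|leb_0pi. cmod (u (N k) h x))"
        by (rule continuous_leb_0pi(2)[symmetric]) (intro continuous_on_norm uc h)
      then show "integral {0..pi} (\<lambda>x. cmod (u (N k) (m (N k) - 1) x)) \<le> 3 * L2_norm (u (N k) h)"
        using L2_integrable(2)[OF continuous_in_L2[OF uc[OF h]]] by (simp add: h_def)
    qed (use KC in simp)
    finally show ?thesis
      unfolding \<phi>J h_def[symmetric] pair[OF h] by (simp add: d_def v_def h_def mult_ac)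
  qed
  have "\<exists>c>0. \<forall>k. c \<le> d k"
  proof (rule pairing_uniformly_bounded_below[OF vc _ _ d_pos])
    show "cmod (v k x) \<le> (1 + D') * ((1 + pert) * exp (2 * pi * M'))" if "x \<in> {0..pi}" for k x
      unfolding v_def by (rule solA_sup_bound[OF Imz big(6) \<kappa>(1) D' that])
    show "1 / 4 \<le> integral {0..pi} (\<lambda>x. (cmod (v k x))\<^sup>2)" for k
      unfolding v_def
      by (rule solA_norm_lower_bound[OF Imz Rez \<kappa>(1) D']) (use big(4)[of k] in \<open>simp add: c1_def\<close>)
    fix f assume "f \<in> L2"
    from schauder_coefficient_bound[OF basis this] obtain B where B:
      "\<And>v j d. continuous_on {0..pi} v \<and> 0 \<le> d \<and> (\<forall>i. i \<noteq> j \<longrightarrow> pairing (\<phi> i) v = 0) \<and>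
        cmod (pairing (\<phi> j) v) \<le> d * L2_norm (\<phi> j) \<Longrightarrow> cmod (pairing f v) \<le> B * d" by blast
    have "cmod (pairing f (v k)) \<le> B * d k" for k
      by (rule B[of _ _ "J k"]) (use vc d_pos[of k] orth last in auto)
    then show "\<exists>B. \<forall>k. cmod (pairing f (v k)) \<le> B * d k" by blast
  qed
  then obtain c where c: "0 < c" "\<And>k. c \<le> d k" by blast
  obtain K where K: "(3 / c)\<^sup>2 < cmod (\<mu> (r K))" "k0 \<le> K"
  proof -
    have "\<forall>\<^sub>F k in sequentially. (3 / c)\<^sup>2 < cmod (\<mu> (r k)) \<and> k0 \<le> k"
      using large[of "(3 / c)\<^sup>2"] eventually_ge_at_top[of k0] by eventually_elim simp
    then show ?thesis using that unfolding eventually_sequentially by blast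
  qed
  define k where "k = K - k0"
  have zk: "(3 / c)\<^sup>2 < cmod (z k)" using K by (simp add: z_def N_def k_def)
  define s where "s = sqrt (cmod (z k))"
  have s: "3 / c < s" unfolding s_def using real_sqrt_less_mono[OF zk] c(1) by simp
  have s0: "0 < s" using s c(1) by (intro less_trans[OF _ s]) simp
  have ss: "cmod (z k) = s * s" by (simp add: s_def)
  have "d k \<le> 3 * s / (s * s)"
    unfolding d_def ss using big(2)[of k] by (intro divide_right_mono) (auto simp: s_def)
  also have "\<dots> = 3 / s" using s0 by simp
  also have "\<dots> < c" using s s0 c(1) by (simp add: field_simps)
  finally show False using c(2)[of k] by simp
qed

end
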